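(* Let $V$ be a finite-dimensional vector space over a field $\mathbb{F}$ (of arbitrary characteristic), and let $G \leq \mathrm{GL}(V)$ be a finite group with a polynomial ring of invariants. Let $\mathcal{A}$ be the set of reflecting hyperplanes of $G$. Then the Jacobian determinant $J$ of $G$ factors into a product of powers of linear forms defining the reflecting hyperplanes. In fact, $$J \ \doteq\ \prod_{H \in \mathcal{A}} l_H^{\,m_H},$$ where $m_H$ denotes the sum of the exponents of the pointwise stabilizer $G_H$.
   Context: Let $n = \dim V \geq 1$. A subgroup $G \leq \mathrm{GL}(V)$ acts on $V$, hence on $V^*$ and on the polynomial ring $\mathbb{F}[V] = \mathrm{Sym}(V^* )$; $\mathbb{F}[V]^G$ is the ring of invariants. A finite group $G$ has a polynomial ring of invariants if $\mathbb{F}[V]^G = \mathbb{F}[f_1,\ldots,f_n]$ for some algebraically independent homogeneous polynomials $f_1,\ldots,f_n$, called basic invariants. The degrees of basic invariants depend only on $G$, and the integers $\deg f_1 - 1, \ldots, \deg f_n - 1$ are called the exponents of $G$. In this case the Jacobian determinant of $G$ is $J = J(f_1,\ldots,f_n) = \det(\partial f_i/\partial z_j)$, where $\{z_j\}$ is a basis of $V^*$; it is well defined up to a nonzero scalar in $\mathbb{F}$ (depending on the choice of basic invariants and basis). For a hyperplane (codimension-one linear subspace) $H$ of $V$, $G_H = \{g \in G : g|_H = \mathrm{id}_H\}$ is the pointwise stabilizer, and $l_H \in V^*$ is a fixed linear form with $\ker l_H = H$. The reflecting hyperplanes of $G$ are the hyperplanes $H$ with $G_H$ nontrivial. Every finite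 subgroup of $\mathrm{GL}(V)$ fixing a hyperplane pointwise has a polynomial ring of invariants, so the exponents of $G_H$ are defined. The notation $a \doteq b$ means that $a$ and $b$ are equal up to a nonzero constant in $\mathbb{F}$. *)

theory Defs
  imports "HOL-Analysis.Determinants" "HOL-Library.Poly_Mapping" "HOL-Library.Multiset" "HOL-Algebra.Group"
begin

text \<open>Polynomials in variables \<open>z\<^sub>i\<close>, \<open>i :: 'n\<close>: a monomial is an exponent vector, a polynomial a finitely supported family of coefficients
  indexed by monomials; sum and product are those of \<^theory>\<open>HOL-Library.Poly_Mapping\<close>
  (convolution product).\<close>

type_synonym ('n, 'f) mpoly = "('n \<Rightarrow>\<^sub>0 nat) \<Rightarrow>\<^sub>0 'f"

definition mconst :: "'f::zero \<Rightarrow> ('n, 'f) mpoly" where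
  "mconst c = Poly_Mapping.single 0 c"

definition mvar :: "'n \<Rightarrow> ('n, 'f::zero_neq_one) mpoly" where
  "mvar i = Poly_Mapping.single (Poly_Mapping.single i 1) 1"

definition monom_degree :: "('n::finite \<Rightarrow>\<^sub>0 nat) \<Rightarrow> nat" where
  "monom_degree m = (\<Sum>i\<in>UNIV. Poly_Mapping.lookup m i)"

text \<open>The zero polynomial gets degree 0.\<close>

definition total_degree :: "('n::finite, 'f::zero) mpoly \<Rightarrow> nat" where
  "total_degree p = Max (insert 0 (monom_degree ` Poly_Mapping.keys p))"

definition homogeneous :: "('n::finite, 'f::zero) mpoly \<Rightarrow> bool" where
  "homogeneous p \<longleftrightarrow> (\<exists>d. \<forall>m\<in>Poly_Mapping.keys p. monom_degree m = d)"

text \<open>The \<open>'f\<close>-algebra homomorphism sending each variable \<open>z\<^sub>i\<close> to \<open>\<sigma> i\<close>.\<close>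

definition msubst :: "('i::finite \<Rightarrow> ('n, 'f::comm_ring_1) mpoly) \<Rightarrow> ('i, 'f) mpoly \<Rightarrow> ('n, 'f) mpoly" where
  "msubst \<sigma> p = (\<Sum>m\<in>Poly_Mapping.keys p.
     mconst (Poly_Mapping.lookup p m) * (\<Prod>i\<in>UNIV. \<sigma> i ^ Poly_Mapping.lookup m i))"

definition alg_independent :: "('i::finite \<Rightarrow> ('n, 'f::comm_ring_1) mpoly) \<Rightarrow> bool" where
  "alg_independent f \<longleftrightarrow> (\<forall>p. msubst f p = 0 \<longrightarrow> p = 0)"

text \<open>When the exponent of \<open>z\<^sub>j\<close> in \<open>m\<close> is 0, the subtraction truncates, but the coefficient vanishes.\<close>

definition mpderiv :: "'n \<Rightarrow> ('n, 'f::comm_ring_1) mpoly \<Rightarrow> ('n, 'f) mpoly" where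
  "mpderiv j p = (\<Sum>m\<in>Poly_Mapping.keys p.
     Poly_Mapping.single (m - Poly_Mapping.single j 1)
       (of_nat (Poly_Mapping.lookup m j) * Poly_Mapping.lookup p m))"

definition jacobian_det :: "('n::finite \<Rightarrow> ('n, 'f::comm_ring_1) mpoly) \<Rightarrow> ('n, 'f) mpoly" where
  "jacobian_det f = det (\<chi> i j. mpderiv j (f i))"

text \<open>\<open>V\<close> is the type \<open>'v\<close> with scalar multiplication \<open>smul\<close>, and \<open>b :: 'n \<Rightarrow> 'v\<close> is a basis of \<open>V\<close>.
  The ring \<open>\<F>[V] = Sym(V\<^sup>*)\<close> is the polynomial ring in the elements \<open>z\<^sub>i\<close> of the basis of
  \<open>V\<^sup>*\<close> dual to \<open>b\<close>; every basis of \<open>V\<^sup>*\<close> is dual to some \<open>b\<close>.\<close>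

definition GL :: "('f::field \<Rightarrow> 'v::ab_group_add \<Rightarrow> 'v) \<Rightarrow> ('v \<Rightarrow> 'v) monoid" where
  "GL smul = \<lparr>carrier = {g. Vector_Spaces.linear smul smul g \<and> bij g},
               mult = (\<lambda>g h. g \<circ> h), one = id\<rparr>"

definition dual_basis :: "('f::field \<Rightarrow> 'v::ab_group_add \<Rightarrow> 'v) \<Rightarrow> ('n \<Rightarrow> 'v) \<Rightarrow> 'n \<Rightarrow> 'v \<Rightarrow> 'f" where
  "dual_basis smul b i v = module.representation smul (range b) v (b i)"

text \<open>The inclusion of \<open>V\<^sup>*\<close> into \<open>\<F>[V]\<close>: a linear form \<open>l\<close> equals \<open>\<Sum>i. l (b i) z\<^sub>i\<close>.\<close>

definition form_poly :: "('n::finite \<Rightarrow> 'v) \<Rightarrow> ('v \<Rightarrow> 'f::field) \<Rightarrow> ('n, 'f) mpoly" where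
  "form_poly b l = (\<Sum>i\<in>UNIV. mconst (l (b i)) * mvar i)"

text \<open>The action on \<open>V\<^sup>*\<close> is \<open>g \<cdot> l = l \<circ> g\<^sup>-\<^sup>1\<close>, extended to \<open>\<F>[V]\<close> by algebra automorphisms.\<close>

definition poly_act ::
  "('f::field \<Rightarrow> 'v::ab_group_add \<Rightarrow> 'v) \<Rightarrow> ('n::finite \<Rightarrow> 'v) \<Rightarrow> ('v \<Rightarrow> 'v) \<Rightarrow> ('n, 'f) mpoly \<Rightarrow> ('n, 'f) mpoly" where
  "poly_act smul b g = msubst (\<lambda>i. form_poly b (dual_basis smul b i \<circ> inv_into UNIV g))"

definition invariants ::
  "('f::field \<Rightarrow> 'v::ab_group_add \<Rightarrow> 'v) \<Rightarrow> ('n::finite \<Rightarrow> 'v) \<Rightarrow> ('v \<Rightarrow> 'v) set \<Rightarrow> ('n, 'f) mpoly set" where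
  "invariants smul b G = {p. \<forall>g\<in>G. poly_act smul b g p = p}"

definition basic_invariants ::
  "('f::field \<Rightarrow> 'v::ab_group_add \<Rightarrow> 'v) \<Rightarrow> ('n::finite \<Rightarrow> 'v) \<Rightarrow> ('v \<Rightarrow> 'v) set \<Rightarrow> ('n \<Rightarrow> ('n, 'f) mpoly) \<Rightarrow> bool" where
  "basic_invariants smul b G f \<longleftrightarrow>
     (\<forall>i. homogeneous (f i)) \<and> alg_independent f \<and> invariants smul b G = range (msubst f)"

text \<open>The degrees of basic invariants do not depend on their choice. This is used for groups that have
  a polynomial ring of invariants; otherwise the value is unspecified.\<close>

definition exponents ::
  "('f::field \<Rightarrow> 'v::ab_group_add \<Rightarrow> 'v) \<Rightarrow> ('n::finite \<Rightarrow> 'v) \<Rightarrow> ('v \<Rightarrow> 'v) set \<Rightarrow> nat multiset" where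
  "exponents smul b G =
     (let f = (SOME f. basic_invariants smul b G f)
      in image_mset (\<lambda>i. total_degree (f i) - 1) (mset_set UNIV))"

definition hyperplane :: "('f::field \<Rightarrow> 'v::ab_group_add \<Rightarrow> 'v) \<Rightarrow> 'v set \<Rightarrow> bool" where
  "hyperplane smul H \<longleftrightarrow> module.subspace smul H \<and>
     vector_space.dim smul H + 1 = vector_space.dim smul UNIV"

definition pointwise_stabilizer :: "('v \<Rightarrow> 'v) set \<Rightarrow> 'v set \<Rightarrow> ('v \<Rightarrow> 'v) set" where
  "pointwise_stabilizer G H = {g \<in> G. \<forall>v\<in>H. g v = v}"

definition reflecting_hyperplanes ::
  "('f::field \<Rightarrow> 'v::ab_group_add \<Rightarrow> 'v) \<Rightarrow> ('v \<Rightarrow> 'v) set \<Rightarrow> 'v set set" where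
  "reflecting_hyperplanes smul G =
     {H. hyperplane smul H \<and> pointwise_stabilizer G H \<noteq> {id}}"

definition defining_form :: "('f::field \<Rightarrow> 'v::ab_group_add \<Rightarrow> 'v) \<Rightarrow> 'v set \<Rightarrow> ('v \<Rightarrow> 'f) \<Rightarrow> bool" where
  "defining_form smul H l \<longleftrightarrow> Vector_Spaces.linear smul (*) l \<and> {v. l v = 0} = H"

lemma group_GL:
  fixes smul :: "'f::field \<Rightarrow> 'v::ab_group_add \<Rightarrow> 'v"
  assumes "vector_space smul"
  shows "group (GL smul)"
proof -
  interpret vector_space smul by fact
  interpret vector_space_pair smul smul by unfold_locales
  have "\<exists>h. Vector_Spaces.linear smul smul h \<and> bij h \<and> h \<circ> g = id"
    if "Vector_Spaces.linear smul smul g" "bij g" for g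
    using linear_injective_left_inverse[OF that(1)] that(2)
    by (metis bij_betw_comp_iff bij_id bij_is_inj)
  then show ?thesis
    by (intro groupI) (auto simp: GL_def Vector_Spaces.linear_compose linear_id bij_comp comp_assoc)
qed

lemma finite_reflecting_hyperplanes:
  fixes smul :: "'f::field \<Rightarrow> 'v::ab_group_add \<Rightarrow> 'v"
  assumes "finite_dimensional_vector_space smul B" "subgroup G (GL smul)" "finite G"
  shows "finite (reflecting_hyperplanes smul G)"
proof -
  interpret finite_dimensional_vector_space smul B by fact
  have "H \<in> (\<lambda>g. {v. g v = v}) ` G" if H: "H \<in> reflecting_hyperplanes smul G" for H
  proof -
    have "id \<in> G"
      using subgroup.one_closed[OF assms(2)] by (simp add: GL_def)
    then have "id \<in> pointwise_stabilizer G H"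
      by (simp add: pointwise_stabilizer_def)
    then obtain g where g: "g \<in> G" "\<And>v. v \<in> H \<Longrightarrow> g v = v" "g \<noteq> id"
      using H by (auto simp: reflecting_hyperplanes_def pointwise_stabilizer_def)
    have sH: "subspace H" and dH: "dim H + 1 = dim UNIV"
      using H by (auto simp: reflecting_hyperplanes_def hyperplane_def)
    have "Vector_Spaces.linear smul smul g"
      using subgroup.subset[OF assms(2)] g(1) by (auto simp: GL_def)
    then interpret g: Vector_Spaces.linear smul smul g .
    have sF: "subspace {v. g v = v}"
      by (auto simp: subspace_def g.add g.scale g.zero)
    have "{v. g v = v} \<noteq> UNIV"
      using g(3) by (auto simp: fun_eq_iff)
    then have "\<not> dim {v. g v = v} \<ge> dim UNIV"
      using subspace_dim_equal[OF sF subspace_UNIV] by blast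
    then have "H = {v. g v = v}"
      using subspace_dim_equal[OF sH sF] g(2) dH by auto
    then show ?thesis using g(1) by blast
  qed
  then show ?thesis
    using assms(3) by (meson finite_imageI finite_subset subsetI)
qed

end

theory Submission
  imports Defs "HOL-Computational_Algebra.Computational_Algebra"
begin

text \<open>Write \<open>S\<close> for the polynomial ring and \<open>J(f)\<close> for the Jacobian determinant of \<open>n\<close> polynomials.

Let \<open>H\<close> be a reflecting hyperplane with form \<open>l\<close>, and let \<open>h\<close> be basic invariants of the
pointwise stabilizer \<open>K\<close> of \<open>H\<close>. Every invariant of \<open>G\<close> is one of \<open>K\<close>, so the \<open>f\<^sub>i\<close> are
polynomials in the \<open>h\<^sub>j\<close>, and the chain rule gives \<open>J(f) = D J(h)\<close> with \<open>D = det (\<partial>f\<^sub>i/\<partial>h\<^sub>j)\<close>.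
The theorem results from three facts.

  \<^item> \<open>J(f)\<close> is a constant times a product of linear forms, and a linear form that divides it
    defines a reflecting hyperplane of \<open>G\<close> (\<open>jacobian_linear_product\<close>).
  \<^item> The same fact for \<open>K\<close>, which has at most the reflecting hyperplane \<open>H\<close>, shows that \<open>J(h)\<close> is a constant
    times a power of \<open>l\<close>; its degree \<open>\<Sum>\<^sub>i (deg h\<^sub>i - 1)\<close> is the exponent (\<open>jacobian_inertia\<close>).
  \<^item> \<open>l\<close> does not divide \<open>D\<close> (\<open>jacobian_inertia_quotient\<close>).

Linear forms are prime, so the exponent of \<open>l\<close> in \<open>J(f)\<close> is the one in \<open>J(h)\<close>.

The first and the third fact say that \<open>S\<close>, and the ring of invariants of \<open>K\<close>, are unramified over the
invariants of \<open>G\<close> outside certain primes. Both follow from \<open>relative_jacobian_dvd\<close>: if \<open>R\<close> is generated by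
\<open>h\<close> with \<open>J(h) \<noteq> 0\<close> and contains the invariants of \<open>G\<close>, and if for every \<open>g\<close> that acts nontrivially on \<open>R\<close> some \<open>g a - a\<close>
with \<open>a \<in> R\<close> lies in a multiplicatively closed set \<open>P\<close>, then \<open>D\<close> divides an element of \<open>P\<close>. The proof
takes in \<open>S \<otimes> R\<close> the product of the squares \<open>(g a\<^sub>g \<otimes> 1 - 1 \<otimes> a\<^sub>g)\<^sup>2\<close>, one for each nontrivial restriction to
\<open>R\<close> of some \<open>g\<close>, and writes it as \<open>\<Sum>\<^sub>k u\<^sub>k \<otimes> v\<^sub>k\<close>. Put \<open>t = \<Sum>\<^sub>k u\<^sub>k v\<^sub>k \<in> P\<close>, and let the trace \<open>Tr\<close> be the sum over all
restrictions to \<open>R\<close>, which takes values in the invariants of \<open>G\<close>. The tensor yields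
\<open>t \<partial>x = \<Sum>\<^sub>k u\<^sub>k \<partial>Tr (v\<^sub>k x) - x \<Sum>\<^sub>k u\<^sub>k \<partial>Tr v\<^sub>k\<close> for \<open>x \<in> R\<close>. So \<open>t\<close> times the gradient of \<open>x\<close> is a combination of the
gradients of the \<open>f\<^sub>i\<close>, and taking determinants bounds \<open>D\<close>. No group order is inverted, whence the
argument works in every characteristic.

The exponents of \<open>K\<close> refer to a choice of basic invariants, so these have to exist
(\<open>polynomial_invariants_inertia\<close>). The elements of \<open>K\<close> that fix \<open>l\<close>, the transvections, act on suitable
generators by \<open>y\<^sub>i \<mapsto> y\<^sub>i + c l\<^sup>d\<close> with \<open>d = deg y\<^sub>i\<close>. Passing to the invariants of one translation after the other
preserves this shape, as the norm of \<open>y\<^sub>i\<close> is an additive polynomial in \<open>y\<^sub>i\<close>. On the resulting invariants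
\<open>K\<close> acts through its character on \<open>l\<close>, whose image has order prime to the characteristic; averaging makes all generators but \<open>l\<close>
invariant, and \<open>l\<close> is finally replaced by a power.\<close>

section \<open>Evaluation homomorphisms\<close>

text \<open>Substitution with values in an arbitrary ring; values in \<open>S[t]\<close> give the gradings below.\<close>

definition poly_eval :: "('f::comm_ring_1 \<Rightarrow> 'r::comm_ring_1) \<Rightarrow> ('i::finite \<Rightarrow> 'r) \<Rightarrow> ('i, 'f) mpoly \<Rightarrow> 'r" where
  "poly_eval c \<sigma> p = (\<Sum>m\<in>Poly_Mapping.keys p.
     c (Poly_Mapping.lookup p m) * (\<Prod>i\<in>UNIV. \<sigma> i ^ Poly_Mapping.lookup m i))"

definition ring_hom1 :: "('a::comm_ring_1 \<Rightarrow> 'b::comm_ring_1) \<Rightarrow> bool" where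
  "ring_hom1 c \<longleftrightarrow> c 0 = 0 \<and> c 1 = 1 \<and> (\<forall>a b. c (a + b) = c a + c b) \<and> (\<forall>a b. c (a * b) = c a * c b)"

lemma msubst_eq_poly_eval: "msubst = poly_eval mconst"
  by (auto simp: msubst_def poly_eval_def fun_eq_iff)

lemma mconst_0 [simp]: "mconst 0 = 0"
  and mconst_1 [simp]: "mconst 1 = (1 :: ('n, 'f::comm_ring_1) mpoly)"
  and mconst_add: "mconst (a + b) = (mconst a + mconst b :: ('n, 'f) mpoly)"
  and mconst_mult: "mconst (a * b) = (mconst a * mconst b :: ('n, 'f) mpoly)"
  by (simp_all add: mconst_def single_add mult_single)

lemma mconst_diff: "mconst (a - b) = (mconst a - mconst b :: ('n, 'f::comm_ring_1) mpoly)"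
  by (simp add: mconst_def single_diff)

lemma mconst_power: "mconst (a ^ k) = (mconst a ^ k :: ('n, 'f::comm_ring_1) mpoly)"
  by (induction k) (auto simp: mconst_mult)

lemma mconst_sum: "mconst (sum g X) = (\<Sum>x\<in>X. mconst (g x) :: ('n, 'f::comm_ring_1) mpoly)"
  by (induction X rule: infinite_finite_induct) (auto simp: mconst_add)

lemma mconst_of_nat: "mconst (of_nat k) = (of_nat k :: ('n, 'f::comm_ring_1) mpoly)"
  by (induction k) (auto simp: mconst_add)

lemma mconst_eq_iff [simp]: "mconst a = mconst b \<longleftrightarrow> a = b"
  by (auto simp: mconst_def dest: injD[OF inj_single])

lemma mconst_eq_0_iff [simp]: "mconst a = 0 \<longleftrightarrow> a = 0"
  using mconst_eq_iff[of a 0] by simp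

lemma ring_hom1_mconst: "ring_hom1 (mconst :: 'f::comm_ring_1 \<Rightarrow> ('n, 'f) mpoly)"
  by (simp add: ring_hom1_def mconst_add mconst_mult)

lemma poly_mapping_sum_single: "p = (\<Sum>m\<in>Poly_Mapping.keys p. Poly_Mapping.single m (Poly_Mapping.lookup p m))"
  by (rule poly_mapping_eqI)
    (auto simp: lookup_sum lookup_single when_def in_keys_iff sum.delta' if_distrib cong: if_cong)

lemma poly_mapping_induct_single:
  assumes "\<And>m a. P (Poly_Mapping.single m a)" "\<And>p q. P p \<Longrightarrow> P q \<Longrightarrow> P (p + q)"
  shows "P (p :: 'a \<Rightarrow>\<^sub>0 'b::comm_monoid_add)"
proof -
  have "P (\<Sum>m\<in>X. Poly_Mapping.single m (Poly_Mapping.lookup p m))" if "finite X" for X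
    using that by induction (use assms assms(1)[of _ 0] in auto)
  from this[OF finite_keys[of p]] show ?thesis
    unfolding poly_mapping_sum_single[of p, symmetric] .
qed

lemma monomial_eq_prod:
  "Poly_Mapping.single m (a::'f::comm_ring_1) = mconst a * (\<Prod>i\<in>(UNIV::'n::finite set). mvar i ^ Poly_Mapping.lookup m i)"
proof -
  have 1: "(mvar i :: ('n, 'f) mpoly) ^ k = Poly_Mapping.single (Poly_Mapping.single i k) 1" for i k
    by (induction k) (auto simp: mvar_def mult_single simp flip: single_add)
  have "(\<Prod>i\<in>X. Poly_Mapping.single (g i) (1::'f)) = Poly_Mapping.single (\<Sum>i\<in>X. g i) 1" if "finite X"
    for X and g :: "'n \<Rightarrow> 'n \<Rightarrow>\<^sub>0 nat"
    using that by induction (auto simp: mult_single)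
  moreover have "(\<Sum>i\<in>UNIV. Poly_Mapping.single i (Poly_Mapping.lookup m i)) = m"
    by (rule poly_mapping_eqI) (auto simp: lookup_sum lookup_single when_def)
  ultimately show ?thesis
    by (simp add: 1 mconst_def mult_single)
qed

lemma mpoly_induct [case_names const var add mult]:
  fixes p :: "('n::finite, 'f::comm_ring_1) mpoly"
  assumes "\<And>a. P (mconst a)" "\<And>i. P (mvar i)" "\<And>p q. P p \<Longrightarrow> P q \<Longrightarrow> P (p + q)" "\<And>p q. P p \<Longrightarrow> P q \<Longrightarrow> P (p * q)"
  shows "P p"
proof (induction p rule: poly_mapping_induct_single)
  case (1 m a)
  have P1: "P 1" using assms(1)[of 1] by simp
  have 2: "P (q ^ k)" if "P q" for q k
    by (induction k) (use that assms P1 in auto)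
  have "P (\<Prod>i\<in>X. mvar i ^ Poly_Mapping.lookup m i)" if "finite X" for X
    using that by induction (use assms P1 2 in auto)
  then show ?case
    by (simp add: monomial_eq_prod assms)
qed (use assms in auto)

lemma poly_eval_superset:
  assumes "ring_hom1 c" "finite X" "Poly_Mapping.keys p \<subseteq> X"
  shows "poly_eval c \<sigma> p = (\<Sum>m\<in>X. c (Poly_Mapping.lookup p m) * (\<Prod>i\<in>UNIV. \<sigma> i ^ Poly_Mapping.lookup m i))"
  unfolding poly_eval_def using assms
  by (intro sum.mono_neutral_left) (auto simp: in_keys_iff ring_hom1_def)

lemma poly_eval_single:
  assumes "ring_hom1 c"
  shows "poly_eval c \<sigma> (Poly_Mapping.single m a) = c a * (\<Prod>i\<in>UNIV. \<sigma> i ^ Poly_Mapping.lookup m i)"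
  using poly_eval_superset[OF assms, of "{m}" "Poly_Mapping.single m a"] by (auto simp: keys_single)

lemma poly_eval_add:
  assumes "ring_hom1 c"
  shows "poly_eval c \<sigma> (p + q) = poly_eval c \<sigma> p + poly_eval c \<sigma> q"
proof -
  let ?X = "Poly_Mapping.keys p \<union> Poly_Mapping.keys q"
  note s = poly_eval_superset[OF assms, of ?X _ \<sigma>]
  have "poly_eval c \<sigma> (p + q) = (\<Sum>m\<in>?X. c (Poly_Mapping.lookup (p + q) m) * (\<Prod>i\<in>UNIV. \<sigma> i ^ Poly_Mapping.lookup m i))"
    by (rule s) (use keys_add[of p q] in auto)
  also have "\<dots> = poly_eval c \<sigma> p + poly_eval c \<sigma> q"
    using assms by (simp add: s lookup_add ring_hom1_def algebra_simps sum.distrib)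
  finally show ?thesis .
qed

lemma poly_eval_mult:
  assumes c: "ring_hom1 c"
  shows "poly_eval c \<sigma> (p * q) = poly_eval c \<sigma> p * poly_eval c \<sigma> q"
proof (induction p rule: poly_mapping_induct_single)
  case p: (1 m a)
  show ?case
  proof (induction q rule: poly_mapping_induct_single)
    case (1 n b)
    show ?case using c
      by (simp add: mult_single poly_eval_single[OF c] lookup_add power_add prod.distrib ring_hom1_def mult_ac)
  qed (simp add: poly_eval_add[OF c] algebra_simps)
qed (simp add: poly_eval_add[OF c] algebra_simps)

lemma poly_eval_mconst:
  assumes c: "ring_hom1 c"
  shows "poly_eval c \<sigma> (mconst a) = c a"
  by (simp add: mconst_def poly_eval_single[OF c])

lemma poly_eval_mvar:
  assumes c: "ring_hom1 c"
  shows "poly_eval c \<sigma> (mvar i) = \<sigma> i"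
proof -
  have "(\<Prod>j\<in>UNIV. \<sigma> j ^ Poly_Mapping.lookup (Poly_Mapping.single i 1) j) = (\<Prod>j\<in>UNIV. if j = i then \<sigma> i else 1)"
    by (rule prod.cong) (auto simp: lookup_single when_def)
  then show ?thesis
    using c by (simp add: mvar_def poly_eval_single[OF c] ring_hom1_def)
qed

lemma ring_hom1_poly_eval:
  assumes "ring_hom1 c"
  shows "ring_hom1 (poly_eval c \<sigma>)"
  using poly_eval_mconst[OF assms, of \<sigma> 0] poly_eval_mconst[OF assms, of \<sigma> 1]
    poly_eval_add[OF assms] poly_eval_mult[OF assms] assms by (auto simp: ring_hom1_def)

context
  fixes c :: "'a::comm_ring_1 \<Rightarrow> 'b::comm_ring_1"
  assumes c: "ring_hom1 c"
begin

lemma ring_hom1_0: "c 0 = 0" and ring_hom1_1: "c 1 = 1"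
  and ring_hom1_add: "c (x + y) = c x + c y" and ring_hom1_mult: "c (x * y) = c x * c y"
  using c by (auto simp: ring_hom1_def)

lemma ring_hom1_minus: "c (- x) = - c x"
  using ring_hom1_add[of x "- x"] by (simp add: ring_hom1_0 eq_neg_iff_add_eq_0 add.commute)

lemma ring_hom1_diff: "c (x - y) = c x - c y"
  using ring_hom1_add[of x "- y"] by (simp add: ring_hom1_minus)

lemma ring_hom1_power: "c (x ^ k) = c x ^ k"
  by (induction k) (auto simp: ring_hom1_1 ring_hom1_mult)

lemma ring_hom1_sum: "c (sum g X) = (\<Sum>x\<in>X. c (g x))"
  by (induction X rule: infinite_finite_induct) (auto simp: ring_hom1_0 ring_hom1_add)

lemma ring_hom1_prod: "c (prod g X) = (\<Prod>x\<in>X. c (g x))"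
  by (induction X rule: infinite_finite_induct) (auto simp: ring_hom1_1 ring_hom1_mult)

lemma ring_hom1_dvd: "x dvd y \<Longrightarrow> c x dvd c y"
  by (auto simp: dvd_def ring_hom1_mult)

lemmas ring_hom1_simps = ring_hom1_0 ring_hom1_1 ring_hom1_add ring_hom1_mult ring_hom1_minus
  ring_hom1_diff ring_hom1_power ring_hom1_sum ring_hom1_prod

end

lemma ring_hom1_msubst: "ring_hom1 (msubst \<sigma> :: ('i::finite, 'f::comm_ring_1) mpoly \<Rightarrow> ('n, 'f) mpoly)"
  unfolding msubst_eq_poly_eval by (intro ring_hom1_poly_eval ring_hom1_mconst)

lemmas msubst_simps = ring_hom1_simps[OF ring_hom1_msubst]

lemma msubst_mconst [simp]: "msubst \<sigma> (mconst a) = (mconst a :: ('n, 'f::comm_ring_1) mpoly)"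
  unfolding msubst_eq_poly_eval by (rule poly_eval_mconst[OF ring_hom1_mconst])

lemma msubst_mvar [simp]: "msubst \<sigma> (mvar i) = (\<sigma> i :: ('n, 'f::comm_ring_1) mpoly)"
  unfolding msubst_eq_poly_eval by (rule poly_eval_mvar[OF ring_hom1_mconst])

lemma msubst_msubst: "msubst \<sigma> (msubst \<tau> p) = msubst (\<lambda>i. msubst \<sigma> (\<tau> i)) p"
  by (induction p rule: mpoly_induct) (simp_all add: msubst_simps)

lemma msubst_mvar_id [simp]: "msubst mvar p = p"
  by (induction p rule: mpoly_induct) (simp_all add: msubst_simps)

lemma msubst_dvd_diff:
  assumes "\<And>i. d dvd \<sigma> i - \<tau> i"
  shows "d dvd msubst \<sigma> p - msubst \<tau> p"
proof (induction p rule: mpoly_induct)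
  case (add p q)
  then have "d dvd (msubst \<sigma> p - msubst \<tau> p) + (msubst \<sigma> q - msubst \<tau> q)"
    by (rule dvd_add)
  then show ?case by (simp add: msubst_simps algebra_simps)
next
  case (mult p q)
  have "msubst \<sigma> (p * q) - msubst \<tau> (p * q) = msubst \<sigma> p * (msubst \<sigma> q - msubst \<tau> q) + msubst \<tau> q * (msubst \<sigma> p - msubst \<tau> p)"
    by (simp add: msubst_simps algebra_simps)
  then show ?case using mult by simp
qed (use assms in auto)

lemma mvar_nonzero [simp]: "(mvar i :: ('n, 'f::comm_ring_1) mpoly) \<noteq> 0"
  by (auto simp: mvar_def dest: arg_cong[of _ _ Poly_Mapping.keys])

section \<open>Gradings\<close>

text \<open>The homomorphism \<open>S \<rightarrow> S[t]\<close> that sends \<open>z\<^sub>i\<close> to \<open>z\<^sub>i t\<^sup>w\<close> with \<open>w = w\<^sub>i\<close>: the coefficient of \<open>t\<^sup>d\<close> in the image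
of \<open>p\<close> is the component of \<open>p\<close> of weight \<open>d\<close>. Statements on components of products thus become
statements on univariate polynomials over a domain.\<close>

definition grading_hom :: "('n::finite \<Rightarrow> nat) \<Rightarrow> ('n, 'f::comm_ring_1) mpoly \<Rightarrow> ('n, 'f) mpoly poly" where
  "grading_hom w = poly_eval (\<lambda>a. [:mconst a:]) (\<lambda>i. monom (mvar i) (w i))"

lemma ring_hom1_const_mconst: "ring_hom1 (\<lambda>a. [:mconst a :: ('n, 'f::comm_ring_1) mpoly:])"
  by (auto simp: ring_hom1_def mconst_add mconst_mult)

lemma ring_hom1_grading_hom: "ring_hom1 (grading_hom w)"
  unfolding grading_hom_def by (intro ring_hom1_poly_eval ring_hom1_const_mconst)

lemmas grading_hom_simps = ring_hom1_simps[OF ring_hom1_grading_hom]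

lemma grading_hom_mconst [simp]: "grading_hom w (mconst a) = [:mconst a:]"
  unfolding grading_hom_def by (rule poly_eval_mconst[OF ring_hom1_const_mconst])

lemma grading_hom_mvar [simp]: "grading_hom w (mvar i) = monom (mvar i) (w i)"
  unfolding grading_hom_def by (rule poly_eval_mvar[OF ring_hom1_const_mconst])

lemma poly_grading_hom_1 [simp]: "poly (grading_hom w p) 1 = p"
  by (induction p rule: mpoly_induct) (simp_all add: grading_hom_simps poly_monom)

definition hom_deg :: "('n::finite \<Rightarrow> nat) \<Rightarrow> nat \<Rightarrow> ('n, 'f::comm_ring_1) mpoly \<Rightarrow> bool" where
  "hom_deg w d p \<longleftrightarrow> grading_hom w p = monom p d"

lemma hom_deg_0 [simp]: "hom_deg w d 0"
  by (simp add: hom_deg_def grading_hom_simps)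

lemma hom_deg_mconst [simp]: "hom_deg w 0 (mconst a)"
  by (simp add: hom_deg_def monom_0)

lemma hom_deg_1 [simp]: "hom_deg w 0 1"
  using hom_deg_mconst[of w 1] by simp

lemma hom_deg_mvar [simp]: "hom_deg w (w i) (mvar i)"
  by (simp add: hom_deg_def)

lemma hdeg_mvar [simp]: "hom_deg (\<lambda>_. Suc 0) (Suc 0) (mvar i)"
  using hom_deg_mvar[of "\<lambda>_. Suc 0" i] .

lemma hom_deg_add: "hom_deg w d p \<Longrightarrow> hom_deg w d q \<Longrightarrow> hom_deg w d (p + q)"
  and hom_deg_diff: "hom_deg w d p \<Longrightarrow> hom_deg w d q \<Longrightarrow> hom_deg w d (p - q)"
  and hom_deg_minus: "hom_deg w d p \<Longrightarrow> hom_deg w d (- p)"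
  and hom_deg_mult: "hom_deg w d p \<Longrightarrow> hom_deg w e q \<Longrightarrow> hom_deg w (d + e) (p * q)"
  by (simp_all add: hom_deg_def grading_hom_simps add_monom diff_monom minus_monom mult_monom)

lemma hom_deg_power: "hom_deg w d p \<Longrightarrow> hom_deg w (d * k) (p ^ k)"
  by (induction k) (auto simp: hom_deg_mult)

lemma hom_deg_sum: "(\<And>x. x \<in> X \<Longrightarrow> hom_deg w d (g x)) \<Longrightarrow> hom_deg w d (sum g X)"
  by (induction X rule: infinite_finite_induct) (auto simp: hom_deg_add)

lemma hom_deg_prod: "(\<And>x. x \<in> X \<Longrightarrow> hom_deg w (e x) (g x)) \<Longrightarrow> hom_deg w (sum e X) (prod g X)"
  by (induction X rule: infinite_finite_induct) (auto simp: hom_deg_mult)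

lemma hom_deg_scale: "hom_deg w d p \<Longrightarrow> hom_deg w d (mconst a * p)"
  using hom_deg_mult[OF hom_deg_mconst] by fastforce

lemma hom_deg_unique: "hom_deg w d p \<Longrightarrow> hom_deg w e p \<Longrightarrow> p \<noteq> 0 \<Longrightarrow> d = e"
  by (metis hom_deg_def degree_monom_eq)

lemma grading_hom_single:
  "grading_hom w (Poly_Mapping.single m a) = monom (Poly_Mapping.single m a) (\<Sum>i\<in>UNIV. w i * Poly_Mapping.lookup m i)"
proof -
  have "hom_deg w (0 + (\<Sum>i\<in>UNIV. w i * Poly_Mapping.lookup m i)) (Poly_Mapping.single m a)"
    unfolding monomial_eq_prod[of m a]
    by (intro hom_deg_mult hom_deg_prod hom_deg_power) auto
  then show ?thesis by (simp add: hom_deg_def)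
qed

lemma lookup_coeff_grading_hom:
  "Poly_Mapping.lookup (coeff (grading_hom w p) d) m =
     (if (\<Sum>i\<in>UNIV. w i * Poly_Mapping.lookup m i) = d then Poly_Mapping.lookup p m else 0)"
  by (induction p rule: poly_mapping_induct_single)
    (auto simp: grading_hom_single grading_hom_simps lookup_single lookup_add when_def)

lemma hom_deg_iff_keys:
  "hom_deg w d p \<longleftrightarrow> (\<forall>m\<in>Poly_Mapping.keys p. (\<Sum>i\<in>UNIV. w i * Poly_Mapping.lookup m i) = d)"
proof
  assume "hom_deg w d p"
  then have *: "coeff (grading_hom w p) e = (if d = e then p else 0)" for e
    by (simp add: hom_deg_def)
  show "\<forall>m\<in>Poly_Mapping.keys p. (\<Sum>i\<in>UNIV. w i * Poly_Mapping.lookup m i) = d"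
  proof
    fix m assume "m \<in> Poly_Mapping.keys p"
    then show "(\<Sum>i\<in>UNIV. w i * Poly_Mapping.lookup m i) = d"
      using lookup_coeff_grading_hom[of w p "\<Sum>i\<in>UNIV. w i * Poly_Mapping.lookup m i" m] *[of "\<Sum>i\<in>UNIV. w i * Poly_Mapping.lookup m i"]
      by (auto simp: in_keys_iff split: if_splits)
  qed
next
  assume "\<forall>m\<in>Poly_Mapping.keys p. (\<Sum>i\<in>UNIV. w i * Poly_Mapping.lookup m i) = d"
  then show "hom_deg w d p"
    unfolding hom_deg_def
    by (intro poly_eqI poly_mapping_eqI) (auto simp: lookup_coeff_grading_hom coeff_monom in_keys_iff)
qed

abbreviation "hdeg \<equiv> hom_deg (\<lambda>_. 1)"

lemma homogeneous_iff: "homogeneous p \<longleftrightarrow> (\<exists>d. hdeg d p)"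
  by (simp add: homogeneous_def hom_deg_iff_keys monom_degree_def)

lemma total_degree_eq: 
  assumes "hdeg d p" "p \<noteq> 0" shows "total_degree p = d"
proof -
  have "monom_degree ` Poly_Mapping.keys p = {d}"
    using assms by (auto simp: hom_deg_iff_keys monom_degree_def image_iff) (metis keys_eq_empty all_not_in_conv)
  then show ?thesis by (simp add: total_degree_def)
qed

lemma hdeg_0D:
  assumes "hdeg 0 p" shows "\<exists>a. p = mconst a"
proof -
  have "m = 0" if "m \<in> Poly_Mapping.keys p" for m
    using assms that by (intro poly_mapping_eqI) (auto simp: hom_deg_iff_keys)
  then have "p = mconst (Poly_Mapping.lookup p 0)"
    by (intro poly_mapping_eqI) (auto simp: mconst_def lookup_single when_def in_keys_iff)
  then show ?thesis by blast
qed

lemma hdeg_1D: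
  assumes "hdeg 1 p" shows "\<exists>a. p = (\<Sum>i\<in>(UNIV::'n::finite set). mconst (a i) * mvar i)"
proof -
  define S where "S = (\<lambda>i::'n. Poly_Mapping.single i (1::nat))"
  have S: "m \<in> range S" if "m \<in> Poly_Mapping.keys p" for m
  proof -
    have 1: "(\<Sum>i\<in>UNIV. Poly_Mapping.lookup m i) = 1"
      using assms that by (auto simp: hom_deg_iff_keys)
    then obtain i where i: "Poly_Mapping.lookup m i \<noteq> 0"
      by (metis sum.neutral zero_neq_one)
    have "(\<Sum>i\<in>UNIV. Poly_Mapping.lookup m i) = Poly_Mapping.lookup m i + (\<Sum>j\<in>UNIV - {i}. Poly_Mapping.lookup m j)"
      by (simp add: sum.remove)
    then have "Poly_Mapping.lookup m i = 1" "(\<Sum>j\<in>UNIV - {i}. Poly_Mapping.lookup m j) = 0"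
      using 1 i by linarith+
    then have "m = S i"
      by (intro poly_mapping_eqI) (auto simp: S_def lookup_single when_def)
    then show ?thesis by blast
  qed
  have "p = (\<Sum>i\<in>UNIV. Poly_Mapping.single (S i) (Poly_Mapping.lookup p (S i)))"
  proof (rule poly_mapping_eqI)
    fix m
    have inj: "S i = S j \<longleftrightarrow> i = j" for i j
      by (auto simp: S_def dest: arg_cong[of _ _ "\<lambda>m. Poly_Mapping.lookup m i"] simp: lookup_single when_def split: if_splits)
    show "Poly_Mapping.lookup p m = Poly_Mapping.lookup (\<Sum>i\<in>UNIV. Poly_Mapping.single (S i) (Poly_Mapping.lookup p (S i))) m"
    proof (cases "m \<in> range S")
      case False
      then have "Poly_Mapping.lookup p m = 0" "\<And>x. S x \<noteq> m"
        using S[of m] by (auto simp: in_keys_iff)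
      then show ?thesis by (simp add: lookup_sum lookup_single when_def)
    qed (auto simp: lookup_sum lookup_single when_def inj)
  qed
  then show ?thesis
    by (auto simp: mconst_def mvar_def mult_single S_def intro!: exI[of _ "\<lambda>i. Poly_Mapping.lookup p (S i)"])
qed

lemma hdeg_form: "hdeg 1 (\<Sum>i\<in>UNIV. mconst (a i) * mvar i)"
  using hom_deg_mvar[of "\<lambda>_. 1"] by (intro hom_deg_sum hom_deg_scale) auto

lemma grading_hom_msubst:
  assumes "\<And>i. hom_deg v (w i) (\<sigma> i)"
  shows "grading_hom v (msubst \<sigma> p) = map_poly (msubst \<sigma>) (grading_hom w p)"
proof -
  have mp: "ring_hom1 (map_poly (msubst \<sigma>))"
    unfolding ring_hom1_def
    by (auto intro!: poly_eqI simp: coeff_map_poly msubst_simps coeff_mult map_poly_1)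
  show ?thesis
  proof (induction p rule: mpoly_induct)
    case (var i)
    then show ?case using assms[of i] by (simp add: hom_deg_def map_poly_monom msubst_simps)
  next
    case (const a)
    then show ?case by (simp add: map_poly_pCons msubst_simps)
  qed (simp_all add: msubst_simps grading_hom_simps ring_hom1_add[OF mp] ring_hom1_mult[OF mp])
qed

lemma hom_deg_msubst:
  assumes "hom_deg w d p" "\<And>i. hom_deg v (w i) (\<sigma> i)"
  shows "hom_deg v d (msubst \<sigma> p)"
  using assms(1) grading_hom_msubst[of v w \<sigma> p, OF assms(2)]
  by (simp add: hom_deg_def map_poly_monom msubst_simps)

lemma degree_grading_hom_mult:
  fixes p q :: "('n::{finite,linorder}, 'f::idom) mpoly"
  assumes "p * q \<noteq> 0"
  shows "degree (grading_hom w (p * q)) = degree (grading_hom w p) + degree (grading_hom w q)"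
proof -
  have "grading_hom w p \<noteq> 0" "grading_hom w q \<noteq> 0"
    using assms poly_grading_hom_1[of w p] poly_grading_hom_1[of w q] by fastforce+
  then show ?thesis by (simp add: grading_hom_simps degree_mult_eq)
qed

text \<open>In \<open>S[t]\<close> the factor \<open>p t\<^sup>d\<close> can be cancelled.\<close>

lemma hom_deg_quotient:
  fixes p q :: "('n::{finite,linorder}, 'f::idom) mpoly"
  assumes "hom_deg w d p" "p \<noteq> 0" "hom_deg w (d + e) (p * q)"
  shows "hom_deg w e q"
proof -
  have "monom p d * grading_hom w q = monom p d * monom q e"
    using assms by (simp add: hom_deg_def grading_hom_simps mult_monom)
  then show ?thesis using assms(2) by (simp add: hom_deg_def)
qed

text \<open>Degrees add in \<open>S[t]\<close>, so a divisor of a nonzero constant has degree \<open>0\<close>.\<close>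

lemma mconst_dvd_unit:
  fixes p :: "('n::{finite,linorder}, 'f::idom) mpoly"
  assumes "p dvd mconst a" "a \<noteq> 0"
  shows "\<exists>b. b \<noteq> 0 \<and> p = mconst b"
proof -
  obtain q where q: "p * q = mconst a" using assms(1) by (metis dvdE)
  then have "degree (grading_hom (\<lambda>_. 1) p) = 0"
    using degree_grading_hom_mult[of p q "\<lambda>_. 1"] assms(2) by simp
  then obtain r where r: "grading_hom (\<lambda>_. 1) p = [:r:]" by (meson degree_eq_zeroE)
  then have "r = p" using poly_grading_hom_1[of "\<lambda>_. 1" p] by simp
  then have "hdeg 0 p" using r by (simp add: hom_deg_def monom_0)
  moreover have "p \<noteq> 0" using q assms(2) by auto
  ultimately show ?thesis using hdeg_0D by fastforce
qed

section \<open>Partial derivatives\<close>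

lemma mpderiv_superset:
  assumes "finite X" "Poly_Mapping.keys p \<subseteq> X"
  shows "mpderiv j p = (\<Sum>m\<in>X. Poly_Mapping.single (m - Poly_Mapping.single j 1)
       (of_nat (Poly_Mapping.lookup m j) * Poly_Mapping.lookup p m))"
  unfolding mpderiv_def using assms
  by (intro sum.mono_neutral_left) (auto simp: in_keys_iff)

lemma mpderiv_single:
  "mpderiv j (Poly_Mapping.single m a) = Poly_Mapping.single (m - Poly_Mapping.single j 1) (of_nat (Poly_Mapping.lookup m j) * a)"
  using mpderiv_superset[of "{m}" "Poly_Mapping.single m a" j] by (auto simp: keys_single)

lemma mpderiv_add: "mpderiv j (p + q) = mpderiv j p + mpderiv j q"
proof -
  let ?X = "Poly_Mapping.keys p \<union> Poly_Mapping.keys q"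
  note s = mpderiv_superset[of ?X _ j]
  have "mpderiv j (p + q) = (\<Sum>m\<in>?X. Poly_Mapping.single (m - Poly_Mapping.single j 1)
       (of_nat (Poly_Mapping.lookup m j) * Poly_Mapping.lookup (p + q) m))"
    by (rule s) (use keys_add[of p q] in auto)
  then show ?thesis
    by (simp add: s lookup_add algebra_simps single_add sum.distrib)
qed

lemma mpderiv_0 [simp]: "mpderiv j 0 = 0"
  by (simp add: mpderiv_def)

lemma mpderiv_minus: "mpderiv j (- p) = - mpderiv j p"
  using mpderiv_add[of j p "- p"] by (simp add: eq_neg_iff_add_eq_0 add.commute)

lemma mpderiv_sum: "mpderiv j (sum g X) = (\<Sum>x\<in>X. mpderiv j (g x))"
  by (induction X rule: infinite_finite_induct) (auto simp: mpderiv_add)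

lemma mpderiv_mconst [simp]: "mpderiv j (mconst a) = 0"
  by (simp add: mconst_def mpderiv_single)

lemma mpderiv_1 [simp]: "mpderiv j 1 = 0"
  using mpderiv_mconst[of j 1] by simp

lemma mpderiv_mvar: "mpderiv j (mvar i) = (if i = j then 1 else 0)"
  by (auto simp: mvar_def mpderiv_single lookup_single when_def)

lemma mpderiv_mult: "mpderiv j (p * q) = mpderiv j p * q + p * mpderiv j q"
proof (induction p rule: poly_mapping_induct_single)
  case p: (1 m a)
  show ?case
  proof (induction q rule: poly_mapping_induct_single)
    case (1 n b)
    have m: "m + n - Poly_Mapping.single j 1 = (m - Poly_Mapping.single j 1) + n" if "Poly_Mapping.lookup m j \<noteq> 0" for m n :: "'a \<Rightarrow>\<^sub>0 nat"
      using that by (intro poly_mapping_eqI) (auto simp: lookup_add lookup_minus lookup_single when_def)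
    show ?case
      using m[of m n] m[of n m]
      by (cases "Poly_Mapping.lookup m j = 0"; cases "Poly_Mapping.lookup n j = 0")
        (auto simp: mult_single mpderiv_single lookup_add algebra_simps simp flip: single_add)
  qed (simp add: mpderiv_add algebra_simps)
qed (simp add: mpderiv_add algebra_simps)

lemma mpderiv_msubst:
  "mpderiv j (msubst \<sigma> p) = (\<Sum>i\<in>UNIV. msubst \<sigma> (mpderiv i p) * mpderiv j (\<sigma> i))"
  by (induction p rule: mpoly_induct)
    (simp_all add: msubst_simps mpderiv_add mpderiv_mult mpderiv_mvar algebra_simps sum.distrib
      sum_distrib_left if_distrib[of "msubst \<sigma>"] if_distrib[of "\<lambda>x. x * _"] if_distrib[of "\<lambda>x. _ * x"] cong: if_cong)

lemma hdeg_mpderiv: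
  assumes "hdeg d p" "d \<ge> 1" shows "hdeg (d - 1) (mpderiv j p)"
proof -
  have "hdeg (d - 1) (Poly_Mapping.single (m - Poly_Mapping.single j 1)
       (of_nat (Poly_Mapping.lookup m j) * Poly_Mapping.lookup p m))" if m: "m \<in> Poly_Mapping.keys p" for m
  proof (cases "Poly_Mapping.lookup m j = 0")
    case False
    have "(\<Sum>i\<in>UNIV. Poly_Mapping.lookup (m - Poly_Mapping.single j 1) i) + (\<Sum>i\<in>UNIV. if i = j then 1 else 0) = (\<Sum>i\<in>UNIV. Poly_Mapping.lookup m i)"
      unfolding sum.distrib[symmetric]
      by (rule sum.cong) (use False in \<open>auto simp: lookup_minus lookup_single when_def\<close>)
    moreover have "(\<Sum>i\<in>UNIV. Poly_Mapping.lookup m i) = d"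
      using assms(1) m by (auto simp: hom_deg_iff_keys)
    ultimately show ?thesis by (auto simp: hom_deg_iff_keys)
  qed auto
  then show ?thesis unfolding mpderiv_def by (intro hom_deg_sum) auto
qed

lemma jacobian_det_mvar: "jacobian_det (mvar :: 'n::finite \<Rightarrow> ('n, 'f::comm_ring_1) mpoly) = 1"
proof -
  have "(\<chi> i j. mpderiv j (mvar i)) = (mat 1 :: (('n, 'f) mpoly ^ 'n) ^ 'n)"
    by (simp add: vec_eq_iff mat_def mpderiv_mvar)
  then show ?thesis by (simp add: jacobian_det_def)
qed

lemma hdeg_jacobian_det:
  assumes "\<And>i. hdeg (d i) (f i)" "\<And>i. d i \<ge> 1"
  shows "hdeg (\<Sum>i\<in>UNIV. d i - 1) (jacobian_det f)"
  unfolding jacobian_det_def det_def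
proof (rule hom_deg_sum)
  fix p assume "p \<in> {p. p permutes (UNIV::'a set)}"
  have "hdeg (\<Sum>i\<in>UNIV. d i - 1) (\<Prod>i\<in>UNIV. (\<chi> i j. mpderiv j (f i)) $ i $ p i)"
    using assms by (intro hom_deg_prod) (simp add: hdeg_mpderiv del: One_nat_def)
  then show "hdeg (\<Sum>i\<in>UNIV. d i - 1) (of_int (sign p) * (\<Prod>i\<in>UNIV. (\<chi> i j. mpderiv j (f i)) $ i $ p i))"
    by (cases "sign p = 1") (auto simp: sign_def hom_deg_minus)
qed

section \<open>Prime elements\<close>

lemma prime_elem_dvd_prodD:
  assumes "finite I" "prime_elem p" "p dvd (\<Prod>i\<in>I. g i)"
  shows "\<exists>i\<in>I. p dvd g i"
  using assms(1,3)
proof (induction I)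
  case empty
  then show ?case using prime_elem_not_unit[OF assms(2)] by simp
next
  case (insert x I)
  then show ?case using prime_elem_dvd_multD[OF assms(2)] by auto
qed

lemma prod_dvd_of_primes:
  fixes r :: "'a::idom"
  assumes "finite I" "\<And>i. i \<in> I \<Longrightarrow> prime_elem (g i)" "\<And>i j. i \<in> I \<Longrightarrow> j \<in> I \<Longrightarrow> i \<noteq> j \<Longrightarrow> \<not> g i dvd g j"
    "\<And>i. i \<in> I \<Longrightarrow> g i dvd r"
  shows "(\<Prod>i\<in>I. g i) dvd r"
  using assms
proof (induction I)
  case (insert x I)
  then obtain s where s: "r = (\<Prod>i\<in>I. g i) * s" by (metis dvdE insertCI)
  have pr: "prime_elem (g x)" "g x dvd r" using insert by auto
  have "\<not> g x dvd (\<Prod>i\<in>I. g i)"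
    using prime_elem_dvd_prodD[OF insert(1) pr(1)] insert.prems(2)[of x] insert(2) by auto
  then have "g x dvd s" using pr s prime_elem_dvd_mult_iff by blast
  then show ?case using insert(1,2) s by (simp add: mult.commute mult_dvd_mono)
qed simp

text \<open>Applied in both directions, this shows that the exponent of \<open>p\<close> in a factorization is unique.\<close>

lemma power_exponent_le:
  fixes p :: "'a::idom"
  assumes "p \<noteq> 0" "p ^ a * x = p ^ b * y" "\<not> p dvd x"
  shows "b \<le> a"
proof (rule ccontr)
  assume "\<not> b \<le> a"
  then obtain d where b: "b = a + Suc d" using less_imp_Suc_add[of a b] by auto
  have "p ^ a * x = p ^ a * (p * (p ^ d * y))"
    using assms(2) by (simp add: b power_add mult_ac)
  then have "x = p * (p ^ d * y)" using assms(1) by simp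
  then show False using assms(3) by simp
qed

section \<open>Linear forms are prime\<close>

text \<open>The substitution of \<open>a\<close> for \<open>z\<^sub>i\<close> is the identity modulo \<open>z\<^sub>i - a\<close>. The assumption that it fixes \<open>a\<close> holds
when \<open>a\<close> does not involve \<open>z\<^sub>i\<close>, and makes it kill \<open>z\<^sub>i - a\<close>.\<close>

lemma mvar_minus_dvd_iff:
  assumes "msubst (mvar(i := a)) a = a"
  shows "mvar i - a dvd p \<longleftrightarrow> msubst (mvar(i := a)) p = 0"
proof
  assume "mvar i - a dvd p"
  then show "msubst (mvar(i := a)) p = 0" using assms by (auto simp: msubst_simps)
next
  assume *: "msubst (mvar(i := a)) p = 0"
  have "mvar i - a dvd msubst mvar p - msubst (mvar(i := a)) p"
    by (rule msubst_dvd_diff) auto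
  then show "mvar i - a dvd p" using * by simp
qed

lemma prime_elem_mvar_minus:
  fixes a :: "('n::{finite,linorder}, 'f::field) mpoly"
  assumes a: "msubst (mvar(i := a)) a = a" and "mvar i - a \<noteq> 0"
  shows "prime_elem (mvar i - a)"
  using assms(2) by (intro prime_elemI) (auto simp: mvar_minus_dvd_iff[OF a] msubst_simps)

lemma hdeg_1_mvar_minus:
  fixes l :: "('n::{finite,linorder}, 'f::field) mpoly"
  assumes "hdeg 1 l" "l \<noteq> 0"
  obtains i a c where "c \<noteq> 0" "l = mconst c * (mvar i - a)" "msubst (mvar(i := a)) a = a" "hdeg 1 a"
proof -
  obtain c where c: "l = (\<Sum>i\<in>UNIV. mconst (c i) * mvar i)"
    using hdeg_1D[OF assms(1)] by blast
  obtain i where i: "c i \<noteq> 0"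
    using assms(2) c by fastforce
  define a where "a = mvar i - mconst (inverse (c i)) * l"
  have "msubst (mvar(i := a)) l = (\<Sum>j\<in>UNIV. mconst (c j) * mvar j + (if j = i then mconst (c i) * (a - mvar i) else 0))"
    unfolding c msubst_simps by (rule sum.cong) (auto simp: algebra_simps)
  also have "\<dots> = l + mconst (c i) * (a - mvar i)"
    by (simp add: sum.distrib c)
  also have "\<dots> = 0"
    using i by (simp add: a_def algebra_simps flip: mult.assoc mconst_mult)
  finally have l0: "msubst (mvar(i := a)) l = 0" .
  have "l = mconst (c i) * (mvar i - a)"
    using i by (simp add: a_def flip: mult.assoc mconst_mult)
  moreover have "msubst (mvar(i := a)) a = a"
    by (subst (2) a_def) (simp add: msubst_simps l0)
  moreover have "hdeg 1 a"
    unfolding a_def using hom_deg_mvar[of "\<lambda>_. 1" i] assms(1) by (intro hom_deg_diff hom_deg_scale) auto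
  ultimately show ?thesis using that i by blast
qed

lemma mconst_dvd_1: "c \<noteq> (0::'f::field) \<Longrightarrow> (mconst c :: ('n, 'f) mpoly) dvd 1"
  by (rule dvdI[of _ _ "mconst (inverse c)"]) (simp flip: mconst_mult)

text \<open>Up to a unit, \<open>l\<close> is \<open>z\<^sub>i - a\<close> with \<open>a\<close> free of \<open>z\<^sub>i\<close>. The substitution \<open>\<sigma>\<close> of \<open>a\<close> for \<open>z\<^sub>i\<close> realizes
reduction modulo \<open>l\<close> as an endomorphism of the domain \<open>S\<close>.\<close>

lemma linear_form_kill:
  fixes l :: "('n::{finite,linorder}, 'f::field) mpoly"
  assumes "hdeg 1 l" "l \<noteq> 0"
  obtains \<sigma> :: "'n \<Rightarrow> ('n, 'f) mpoly" where "\<And>p. l dvd p \<longleftrightarrow> msubst \<sigma> p = 0" "\<And>i. hdeg 1 (\<sigma> i)"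
proof -
  obtain i a c where *: "c \<noteq> 0" "l = mconst c * (mvar i - a)" "msubst (mvar(i := a)) a = a" "hdeg 1 a"
    by (rule hdeg_1_mvar_minus[OF assms])
  have "l dvd p \<longleftrightarrow> msubst (mvar(i := a)) p = 0" for p
    unfolding *(2) mvar_minus_dvd_iff[OF *(3), symmetric] 
  proof
    assume "mvar i - a dvd p"
    then have "mconst c * (mvar i - a) dvd mconst c * (mconst (inverse c) * p)"
      by (intro mult_dvd_mono dvd_refl) simp
    then show "mconst c * (mvar i - a) dvd p"
      using *(1) by (simp flip: mult.assoc mconst_mult)
  qed (rule dvd_mult_right)
  moreover have "hdeg 1 ((mvar(i := a)) j)" for j
    using *(4) by simp
  ultimately show ?thesis using that by blast
qed

lemma prime_elem_linear_form:
  fixes l :: "('n::{finite,linorder}, 'f::field) mpoly"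
  assumes "hdeg 1 l" "l \<noteq> 0"
  shows "prime_elem l"
proof -
  obtain \<sigma> :: "'n \<Rightarrow> ('n, 'f) mpoly" where "\<And>p. l dvd p \<longleftrightarrow> msubst \<sigma> p = 0"
    using linear_form_kill[OF assms] by blast
  then show ?thesis using assms(2) by (intro prime_elemI) (auto simp: msubst_simps)
qed

lemma linear_form_dvd:
  fixes l u :: "('n::{finite,linorder}, 'f::field) mpoly"
  assumes "hdeg 1 l" "hdeg 1 u" "l dvd u"
  shows "\<exists>a. u = mconst a * l"
proof (cases "l = 0")
  case False
  obtain q where q: "u = l * q" using assms(3) by (metis dvdE)
  then have "hdeg 0 q" using hom_deg_quotient[OF assms(1) False, of 0 q] assms(2) by simp
  then show ?thesis using hdeg_0D q by (metis mult.commute)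
qed (use assms in auto)

lemma linear_forms_associated:
  fixes l u :: "('n::{finite,linorder}, 'f::field) mpoly"
  assumes "hdeg 1 l" "hdeg 1 u" "l dvd u" "u \<noteq> 0"
  shows "\<exists>a. a \<noteq> 0 \<and> u = mconst a * l"
  using linear_form_dvd[OF assms(1-3)] assms(4) by fastforce

text \<open>The Jacobian determinants below divide products of linear forms. Since linear forms are prime,
the divisors of such products are again such products.\<close>

definition linear_products :: "('n::finite, 'f::field) mpoly set" where
  "linear_products = {mconst c * prod_mset U | c U. c \<noteq> 0 \<and> (\<forall>u\<in>#U. hdeg 1 u \<and> u \<noteq> 0)}"

lemma linear_products_1: "1 \<in> linear_products"
  by (auto simp: linear_products_def intro!: exI[of _ 1] exI[of _ "{#}"])

lemma linear_products_mult: "p \<in> linear_products \<Longrightarrow> q \<in> linear_products \<Longrightarrow> p * q \<in> linear_products"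
proof -
  assume "p \<in> linear_products" "q \<in> linear_products"
  then obtain a U b W where "a \<noteq> 0" "b \<noteq> 0" "p = mconst a * prod_mset U" "q = mconst b * prod_mset W"
    "\<forall>u\<in>#U. hdeg 1 u \<and> u \<noteq> 0" "\<forall>u\<in>#W. hdeg 1 u \<and> u \<noteq> 0"
    by (auto simp: linear_products_def)
  then show ?thesis
    by (auto simp: linear_products_def mconst_mult mult_ac intro!: exI[of _ "a * b"] exI[of _ "U + W"])
qed

lemma linear_form_in_linear_products: "hdeg 1 p \<Longrightarrow> p \<noteq> 0 \<Longrightarrow> p \<in> linear_products"
  by (auto simp: linear_products_def intro!: exI[of _ 1] exI[of _ "{#p#}"])

lemma linear_products_nonzero: "(p :: ('n::{finite,linorder}, 'f::field) mpoly) \<in> linear_products \<Longrightarrow> p \<noteq> 0"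
  by (auto simp: linear_products_def)

lemma dvd_linear_products:
  fixes p q :: "('n::{finite,linorder}, 'f::field) mpoly"
  assumes "q \<in> linear_products" "p dvd q"
  shows "p \<in> linear_products"
proof -
  have "p \<in> linear_products" if "c \<noteq> 0" "\<forall>u\<in>#U. hdeg 1 u \<and> u \<noteq> 0" "p dvd mconst c * prod_mset U" for c U
    using that
  proof (induction U arbitrary: p)
    case empty
    then show ?case
      using mconst_dvd_unit[of p c] by (auto simp: linear_products_def intro!: exI[of _ "{#}"])
  next
    case (add u U)
    have u: "hdeg 1 u" "u \<noteq> 0" "prime_elem u" using add prime_elem_linear_form by auto
    obtain x where x: "mconst c * (u * prod_mset U) = p * x"
      using add.prems(3) by (auto simp: dvd_def)
    then have "u dvd p * x" by (metis dvd_triv_left dvd_mult)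
    then consider "u dvd p" | "u dvd x" using u(3) prime_elem_dvd_mult_iff by blast
    then show ?case
    proof cases
      case 1
      then obtain r where r: "p = u * r" by (elim dvdE)
      then have "u * (mconst c * prod_mset U) = u * (r * x)" using x by (simp add: mult_ac)
      then have "r dvd mconst c * prod_mset U" using u(2) by simp
      then have "r \<in> linear_products" using add by auto
      then show ?thesis using r u linear_products_mult linear_form_in_linear_products by blast
    next
      case 2
      then obtain r where r: "x = u * r" by (elim dvdE)
      then have "u * (mconst c * prod_mset U) = u * (p * r)" using x by (simp add: mult_ac)
      then have "p dvd mconst c * prod_mset U" using u(2) by simp
      then show ?thesis using add by auto
    qed
  qed
  then show ?thesis using assms by (auto simp: linear_products_def)
qed

lemma linear_products_factor:
  fixes p :: "('n::{finite,linorder}, 'f::field) mpoly"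
  assumes "p \<in> linear_products" "finite I"
    and L: "\<And>k. k \<in> I \<Longrightarrow> hdeg 1 (L k)"
    and "\<And>u. hdeg 1 u \<Longrightarrow> u \<noteq> 0 \<Longrightarrow> u dvd p \<Longrightarrow> \<exists>k\<in>I. L k dvd u"
  shows "\<exists>c e. c \<noteq> 0 \<and> p = mconst c * (\<Prod>k\<in>I. L k ^ e k)"
proof -
  obtain c U where p: "p = mconst c * prod_mset U" "c \<noteq> 0" and U: "\<forall>u\<in>#U. hdeg 1 u \<and> u \<noteq> 0"
    using assms(1) by (auto simp: linear_products_def)
  have "\<exists>k\<in>I. L k dvd u" if "u \<in># U" for u
    using assms(4)[of u] U that p(1) dvd_prod_mset[OF that] by (auto intro: dvd_mult)
  with U have "\<exists>c e. c \<noteq> 0 \<and> prod_mset U = mconst c * (\<Prod>k\<in>I. L k ^ e k)"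
  proof (induction U)
    case empty
    then show ?case by (auto intro!: exI[of _ 1] exI[of _ "\<lambda>_. 0"])
  next
    case (add u U)
    then obtain c e k where *: "c \<noteq> 0" "prod_mset U = mconst c * (\<Prod>k\<in>I. L k ^ e k)" "k \<in> I" "L k dvd u"
      by (auto; blast)
    obtain a where a: "a \<noteq> 0" "u = mconst a * L k"
      using linear_forms_associated[OF L _ *(4)] * add.prems by auto
    have "(\<Prod>j\<in>I. L j ^ (e(k := Suc (e k))) j) = L k * (\<Prod>j\<in>I. L j ^ e j)"
      using *(3) assms(2) by (simp add: prod.remove mult_ac)
    then show ?case using * a
      by (auto simp: mconst_mult mult_ac intro!: exI[of _ "a * c"] exI[of _ "e(k := Suc (e k))"])
  qed
  then obtain d e where "d \<noteq> 0" "prod_mset U = mconst d * (\<Prod>k\<in>I. L k ^ e k)" by blast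
  then show ?thesis using p by (auto simp: mconst_mult mult_ac intro!: exI[of _ "c * d"] exI[of _ e])
qed

section \<open>Finite groups of linear substitutions\<close>

definition invs :: "(('n, 'f::field) mpoly \<Rightarrow> ('n, 'f) mpoly) set \<Rightarrow> ('n, 'f) mpoly set" where
  "invs \<A> = {p. \<forall>A\<in>\<A>. A p = p}"

text \<open>The finite group \<open>G\<close> enters the main argument only through the automorphisms of \<open>S\<close> that it induces.\<close>

locale linear_action =
  fixes \<A> :: "(('n::{finite,linorder}, 'f::field) mpoly \<Rightarrow> ('n, 'f) mpoly) set"
  assumes finite_action: "finite \<A>"
    and id_mem: "id \<in> \<A>"
    and comp_mem: "A \<in> \<A> \<Longrightarrow> B \<in> \<A> \<Longrightarrow> A \<circ> B \<in> \<A>"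
    and inv_mem: "A \<in> \<A> \<Longrightarrow> \<exists>B\<in>\<A>. A \<circ> B = id \<and> B \<circ> A = id"
    and act_msubst: "A \<in> \<A> \<Longrightarrow> A p = msubst (\<lambda>i. A (mvar i)) p"
    and act_mvar: "A \<in> \<A> \<Longrightarrow> hdeg 1 (A (mvar i))"
begin

lemma act_hom: "A \<in> \<A> \<Longrightarrow> ring_hom1 A"
  using ring_hom1_msubst[of "\<lambda>i. A (mvar i)"] act_msubst[of A] by (metis (mono_tags, lifting) ring_hom1_def)

lemmas act_simps = ring_hom1_simps[OF act_hom]

lemma act_mconst [simp]: "A \<in> \<A> \<Longrightarrow> A (mconst a) = mconst a"
  by (subst act_msubst) auto

lemma act_eq_iff: "A \<in> \<A> \<Longrightarrow> A p = A q \<longleftrightarrow> p = q"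
  using inv_mem[of A] by (metis comp_apply id_apply)

lemma act_0_iff: "A \<in> \<A> \<Longrightarrow> A p = 0 \<longleftrightarrow> p = 0"
  using act_eq_iff[of A p 0] by (simp add: act_simps)

lemma act_hdeg: "A \<in> \<A> \<Longrightarrow> hdeg d p \<Longrightarrow> hdeg d (A p)"
  unfolding act_msubst[of A p] by (intro hom_deg_msubst[of "\<lambda>_. 1"] act_mvar)

lemma act_of_msubst: "A \<in> \<A> \<Longrightarrow> A (msubst \<sigma> p) = msubst (\<lambda>i. A (\<sigma> i)) p"
  by (induction p rule: mpoly_induct) (simp_all add: msubst_simps act_simps)

lemma action_eqI: "A \<in> \<A> \<Longrightarrow> B \<in> \<A> \<Longrightarrow> (\<And>i. A (mvar i) = B (mvar i)) \<Longrightarrow> A = B"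
  by (rule ext) (subst (1 2) act_msubst, auto)

lemma action_eq_idI: "A \<in> \<A> \<Longrightarrow> (\<And>i. A (mvar i) = mvar i) \<Longrightarrow> A = id"
  using action_eqI[OF _ id_mem] by simp

lemma act_bij_betw_comp:
  assumes "A \<in> \<A>" shows "bij_betw (\<lambda>B. A \<circ> B) \<A> \<A>"
proof -
  have "inj_on (\<lambda>B. A \<circ> B) \<A>"
    using act_eq_iff[OF assms] by (auto simp: inj_on_def fun_eq_iff)
  moreover have "(\<lambda>B. A \<circ> B) ` \<A> \<subseteq> \<A>" using comp_mem assms by auto
  ultimately show ?thesis
    using finite_action by (simp add: bij_betw_def endo_inj_surj)
qed

lemma act_dvd_diff: 
  assumes "A \<in> \<A>" "\<And>i. l dvd A (mvar i) - mvar i"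
  shows "l dvd A p - p"
proof -
  have "l dvd msubst (\<lambda>i. A (mvar i)) p - msubst mvar p"
    by (rule msubst_dvd_diff) (use assms in auto)
  then show ?thesis using act_msubst[OF assms(1), of p] by simp
qed

end

section \<open>A divisibility bound for Jacobian determinants\<close>

text \<open>A list of pairs \<open>(u, v)\<close> stands for the tensor \<open>\<Sum> u \<otimes> v\<close>, and \<open>step\<close> is multiplication by
\<open>(a \<otimes> 1 - 1 \<otimes> b)\<^sup>2\<close>. The square makes the value at \<open>M\<close> vanish for \<open>a = M b\<close> even after a derivation
has been applied to the left factors.\<close>

lemma tensor_step:
  fixes a b :: "'r::comm_ring_1"
  defines "step \<equiv> \<lambda>us. map (\<lambda>(u, v). (a\<^sup>2 * u, v)) us @ map (\<lambda>(u, v). (- 2 * a * u, b * v)) us @ map (\<lambda>(u, v). (u, b\<^sup>2 * v)) us"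
  assumes "\<forall>(u, v)\<in>set us. M (b * v) = M b * M v \<and> M (b\<^sup>2 * v) = (M b)\<^sup>2 * M v"
  shows "(\<Sum>(u, v)\<leftarrow>step us. u * M v) = (a - M b)\<^sup>2 * (\<Sum>(u, v)\<leftarrow>us. u * M v)"
    and "(\<And>x y. D (x * y) = D x * y + x * D y) \<Longrightarrow> (\<And>x. D (- x) = - D x) \<Longrightarrow> (\<And>x y. D (x + y) = D x + D y) \<Longrightarrow> D 1 = 0 \<Longrightarrow>
      (\<Sum>(u, v)\<leftarrow>step us. D u * M v) = (a - M b)\<^sup>2 * (\<Sum>(u, v)\<leftarrow>us. D u * M v) + 2 * D a * (a - M b) * (\<Sum>(u, v)\<leftarrow>us. u * M v)"
proof -
  have *: "(\<Sum>(u, v)\<leftarrow>us. \<phi> u * \<psi> v) = sum_list (map (\<lambda>(u, v). \<phi> u * \<psi> v) us)" for \<phi> \<psi> :: "'r \<Rightarrow> 'r" and us ..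
  show "(\<Sum>(u, v)\<leftarrow>step us. u * M v) = (a - M b)\<^sup>2 * (\<Sum>(u, v)\<leftarrow>us. u * M v)"
    using assms(2) unfolding step_def
    by (induction us) (auto simp: algebra_simps power2_eq_square)
  assume D: "\<And>x y. D (x * y) = D x * y + x * D y" "\<And>x. D (- x) = - D x" "\<And>x y. D (x + y) = D x + D y" "D 1 = 0"
  have D2: "D 2 = 0" using D(3)[of 1 1] D(4) by simp
  show "(\<Sum>(u, v)\<leftarrow>step us. D u * M v) = (a - M b)\<^sup>2 * (\<Sum>(u, v)\<leftarrow>us. D u * M v) + 2 * D a * (a - M b) * (\<Sum>(u, v)\<leftarrow>us. u * M v)"
    using assms(2) unfolding step_def
    by (induction us) (auto simp: algebra_simps power2_eq_square D(1,2) D2)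
qed

text \<open>The product of the factors \<open>(M b\<^sub>M \<otimes> 1 - 1 \<otimes> b\<^sub>M)\<^sup>2\<close> over all \<open>M\<close>: each factor makes the tensor vanish at its own \<open>M\<close>,
also after differentiation of the left factors.\<close>

lemma separating_tensor:
  fixes R :: "('n::finite, 'f::field) mpoly set"
  assumes R: "1 \<in> R" "\<And>x y. x \<in> R \<Longrightarrow> y \<in> R \<Longrightarrow> x * y \<in> R"
    and P: "1 \<in> P" "\<And>x y. x \<in> P \<Longrightarrow> y \<in> P \<Longrightarrow> x * y \<in> P"
    and "finite \<M>"
    and mult: "\<And>M x y. M \<in> \<M> \<Longrightarrow> x \<in> R \<Longrightarrow> y \<in> R \<Longrightarrow> M (x * y) = M x * M y"
    and sep: "\<And>M. M \<in> \<M> \<Longrightarrow> \<exists>b\<in>R. M b - b \<in> P"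
  shows "\<exists>us. (\<forall>(u, v)\<in>set us. v \<in> R) \<and> (\<Sum>(u, v)\<leftarrow>us. u * v) \<in> P \<and>
    (\<forall>M\<in>\<M>. (\<Sum>(u, v)\<leftarrow>us. u * M v) = 0 \<and> (\<forall>j. (\<Sum>(u, v)\<leftarrow>us. mpderiv j u * M v) = 0))"
proof -
  have "\<exists>us. (\<forall>(u, v)\<in>set us. v \<in> R) \<and> (\<Sum>(u, v)\<leftarrow>us. u * v) \<in> P \<and>
    (\<forall>M\<in>\<N>. (\<Sum>(u, v)\<leftarrow>us. u * M v) = 0 \<and> (\<forall>j. (\<Sum>(u, v)\<leftarrow>us. mpderiv j u * M v) = 0))"
    if "finite \<N>" "\<N> \<subseteq> \<M>" for \<N>
    using that
  proof induction
    case empty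
    show ?case using R P by (intro exI[of _ "[(1, 1)]"]) auto
  next
    case (insert M \<N>)
    then obtain us where us: "\<forall>(u, v)\<in>set us. v \<in> R" "(\<Sum>(u, v)\<leftarrow>us. u * v) \<in> P"
      "\<And>M. M \<in> \<N> \<Longrightarrow> (\<Sum>(u, v)\<leftarrow>us. u * M v) = 0"
      "\<And>M j. M \<in> \<N> \<Longrightarrow> (\<Sum>(u, v)\<leftarrow>us. mpderiv j u * M v) = 0"
      by auto
    obtain b where b: "b \<in> R" "M b - b \<in> P" using sep[of M] insert.prems by blast
    define a where "a = M b"
    define vs where "vs = map (\<lambda>(u, v). (a\<^sup>2 * u, v)) us @ map (\<lambda>(u, v). (- 2 * a * u, b * v)) us @ map (\<lambda>(u, v). (u, b\<^sup>2 * v)) us"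
    have b2: "b\<^sup>2 \<in> R" using b R by (simp add: power2_eq_square)
    have hom: "\<forall>(u, v)\<in>set us. N (b * v) = N b * N v \<and> N (b\<^sup>2 * v) = (N b)\<^sup>2 * N v" if "N \<in> \<M>" for N
      using us(1) mult[OF that] b R by (auto simp: power2_eq_square mult.assoc)
    have "(\<Sum>(u, v)\<leftarrow>vs. u * v) = (a - b)\<^sup>2 * (\<Sum>(u, v)\<leftarrow>us. u * v)"
      unfolding vs_def using tensor_step(1)[of us "\<lambda>x. x" b a] by auto
    then have 1: "(\<Sum>(u, v)\<leftarrow>vs. u * v) \<in> P"
      using b(2) us(2) P by (simp add: a_def power2_eq_square)
    have 2: "\<forall>(u, v)\<in>set vs. v \<in> R" using us(1) b(1) b2 R by (auto simp: vs_def)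
    have 3: "(\<Sum>(u, v)\<leftarrow>vs. u * N v) = (a - N b)\<^sup>2 * (\<Sum>(u, v)\<leftarrow>us. u * N v)" if "N \<in> \<M>" for N
      unfolding vs_def by (rule tensor_step(1)[OF hom[OF that]])
    have 4: "(\<Sum>(u, v)\<leftarrow>vs. mpderiv j u * N v) = (a - N b)\<^sup>2 * (\<Sum>(u, v)\<leftarrow>us. mpderiv j u * N v)
        + 2 * mpderiv j a * (a - N b) * (\<Sum>(u, v)\<leftarrow>us. u * N v)" if "N \<in> \<M>" for N j
      unfolding vs_def by (rule tensor_step(2)[OF hom[OF that]]) (simp_all add: mpderiv_mult mpderiv_minus mpderiv_add)
    have "(\<Sum>(u, v)\<leftarrow>vs. u * N v) = 0 \<and> (\<forall>j. (\<Sum>(u, v)\<leftarrow>vs. mpderiv j u * N v) = 0)" if N: "N \<in> insert M \<N>" for N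
    proof -
      have N': "N \<in> \<M>" using insert.prems N by auto
      show ?thesis
        using N us(3,4) by (auto simp: 3[OF N'] 4[OF N'] a_def)
    qed
    then show ?case using 1 2 by blast
  qed
  from this[OF assms(5)] show ?thesis by simp
qed

context linear_action
begin

text \<open>The tensor of \<open>separating_tensor\<close> is applied to the restrictions of the group elements to \<open>R\<close>, with
the inclusion left out. Counting equal restrictions once replaces a sum over cosets, whose
multiplicity could vanish in \<open>\<F>\<close>.\<close>

lemma gradient_in_span:
  fixes R :: "('n, 'f) mpoly set"
  assumes R: "1 \<in> R" "\<And>x y. x \<in> R \<Longrightarrow> y \<in> R \<Longrightarrow> x * y \<in> R"
    and P: "1 \<in> P" "\<And>x y. x \<in> P \<Longrightarrow> y \<in> P \<Longrightarrow> x * y \<in> P"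
    and sep: "\<And>A. A \<in> \<A> \<Longrightarrow> (\<forall>x\<in>R. A x = x) \<or> (\<exists>x\<in>R. A x - x \<in> P)"
    and f: "invs \<A> = range (msubst f)"
  shows "\<exists>t\<in>P. \<forall>x\<in>R. \<exists>a. \<forall>j. t * mpderiv j x = (\<Sum>i\<in>UNIV. a i * mpderiv j (f i))"
proof -
  define res where "res = (\<lambda>A x. if x \<in> R then A x else (0 :: ('n, 'f) mpoly))"
  \<comment> \<open>The inclusion of \<open>R\<close> is \<open>res id\<close>; the other restrictions are to be annihilated by the tensor.\<close>
  define \<M> where "\<M> = res ` \<A> - {res id}"
  have fin: "finite (res ` \<A>)" using finite_action by simp
  have res_mult: "M (x * y) = M x * M y" if "M \<in> res ` \<A>" "x \<in> R" "y \<in> R" for M x y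
    using that R by (auto simp: res_def act_simps)
  have "\<exists>us. (\<forall>(u, v)\<in>set us. v \<in> R) \<and> (\<Sum>(u, v)\<leftarrow>us. u * v) \<in> P \<and>
    (\<forall>M\<in>\<M>. (\<Sum>(u, v)\<leftarrow>us. u * M v) = 0 \<and> (\<forall>j. (\<Sum>(u, v)\<leftarrow>us. mpderiv j u * M v) = 0))"
  proof (rule separating_tensor[OF R P])
    fix M assume "M \<in> \<M>"
    then obtain A where A: "A \<in> \<A>" "M = res A" "res A \<noteq> res id" by (auto simp: \<M>_def)
    have "\<not> (\<forall>x\<in>R. A x = x)"
    proof
      assume "\<forall>x\<in>R. A x = x"
      then have "res A = res id" by (auto simp: res_def)
      then show False using A(3) by simp
    qed
    then show "\<exists>b\<in>R. M b - b \<in> P" using sep[OF A(1)] A by (auto simp: res_def)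
  qed (use fin res_mult in \<open>auto simp: \<M>_def\<close>)
  then obtain us where us: "\<forall>(u, v)\<in>set us. v \<in> R"
    "\<And>M. M \<in> \<M> \<Longrightarrow> (\<Sum>(u, v)\<leftarrow>us. u * M v) = 0"
    "\<And>M j. M \<in> \<M> \<Longrightarrow> (\<Sum>(u, v)\<leftarrow>us. mpderiv j u * M v) = 0"
    and tP: "(\<Sum>(u, v)\<leftarrow>us. u * v) \<in> P"
    by auto
  define t where "t = (\<Sum>(u, v)\<leftarrow>us. u * v)"
  define Tr where "Tr = (\<lambda>x. \<Sum>M\<in>res ` \<A>. M x)"
  have Tr_inv: "Tr x \<in> invs \<A>" if "x \<in> R" for x
    unfolding invs_def
  proof safe
    fix A assume A: "A \<in> \<A>"
    have inj: "inj_on (\<lambda>M. A \<circ> M) (res ` \<A>)"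
      using act_eq_iff[OF A] by (auto simp: inj_on_def fun_eq_iff)
    have "A \<circ> res B = res (A \<circ> B)" for B
      using A by (auto simp: res_def fun_eq_iff act_simps)
    then have "(\<lambda>M. A \<circ> M) ` res ` \<A> \<subseteq> res ` \<A>" using A comp_mem by auto
    then have img: "(\<lambda>M. A \<circ> M) ` res ` \<A> = res ` \<A>"
      using inj fin by (simp add: endo_inj_surj)
    have "A (Tr x) = (\<Sum>M\<in>res ` \<A>. (A \<circ> M) x)"
      using A by (simp add: Tr_def act_simps)
    also have "\<dots> = (\<Sum>M\<in>(\<lambda>M. A \<circ> M) ` res ` \<A>. M x)"
      using inj by (simp add: sum.reindex)
    finally show "A (Tr x) = Tr x" unfolding img Tr_def .
  qed
  \<comment> \<open>Only the inclusion of \<open>R\<close> contributes to a sum over the restrictions.\<close>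
  have split: "(\<Sum>M\<in>res ` \<A>. c M * (\<Sum>(u, v)\<leftarrow>us. \<phi> u * M v)) = c (res id) * (\<Sum>(u, v)\<leftarrow>us. \<phi> u * v)"
    if "\<And>M. M \<in> \<M> \<Longrightarrow> (\<Sum>(u, v)\<leftarrow>us. \<phi> u * M v) = 0" for c and \<phi> :: "('n, 'f) mpoly \<Rightarrow> ('n, 'f) mpoly"
  proof -
    have "res id \<in> res ` \<A>" using id_mem by blast
    then have "(\<Sum>M\<in>res ` \<A>. c M * (\<Sum>(u, v)\<leftarrow>us. \<phi> u * M v)) = c (res id) * (\<Sum>(u, v)\<leftarrow>us. \<phi> u * res id v)
      + (\<Sum>M\<in>\<M>. c M * (\<Sum>(u, v)\<leftarrow>us. \<phi> u * M v))"
      using fin by (simp add: sum.remove \<M>_def)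
    moreover have "(\<Sum>(u, v)\<leftarrow>us. \<phi> u * res id v) = (\<Sum>(u, v)\<leftarrow>us. \<phi> u * v)"
      by (intro arg_cong[of _ _ sum_list] map_cong) (use us(1) in \<open>auto simp: res_def\<close>)
    ultimately show ?thesis using that by simp
  qed
  have swap: "(\<Sum>(u, v)\<leftarrow>us. \<phi> u * Tr (v * x)) = (\<Sum>M\<in>res ` \<A>. M x * (\<Sum>(u, v)\<leftarrow>us. \<phi> u * M v))"
    if x: "x \<in> R" for x \<phi>
  proof -
    have "(\<Sum>(u, v)\<leftarrow>ws. \<phi> u * Tr (v * x)) = (\<Sum>M\<in>res ` \<A>. M x * (\<Sum>(u, v)\<leftarrow>ws. \<phi> u * M v))"
      if "\<forall>(u, v)\<in>set ws. v \<in> R" for ws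
      using that
    proof (induction ws)
      case (Cons w ws)
      obtain u v where w: "w = (u, v)" by force
      have "Tr (v * x) = (\<Sum>M\<in>res ` \<A>. M v * M x)"
        unfolding Tr_def by (rule sum.cong) (use Cons.prems w x res_mult in auto)
      then show ?case using Cons w
        by (simp add: sum.distrib algebra_simps sum_distrib_left)
    qed simp
    then show ?thesis using us(1) by blast
  qed
  have res_id: "res id x = x" if "x \<in> R" for x using that by (simp add: res_def)
  have tr_t: "(\<Sum>(u, v)\<leftarrow>us. u * Tr (v * x)) = x * t" if "x \<in> R" for x
    using swap[OF that, of "\<lambda>u. u"] split[of "\<lambda>u. u" "\<lambda>M. M x", OF us(2)] res_id[OF that] by (simp add: t_def)
  have tr_d: "(\<Sum>(u, v)\<leftarrow>us. mpderiv j u * Tr (v * x)) = x * (\<Sum>(u, v)\<leftarrow>us. mpderiv j u * v)" if "x \<in> R" for x j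
    using swap[OF that, of "mpderiv j"] split[of "mpderiv j" "\<lambda>M. M x", OF us(3)] res_id[OF that] by simp
  \<comment> \<open>The \<open>S\<close>-span of the gradients of the \<open>f\<^sub>i\<close>.\<close>
  define Row where "Row = {r. \<exists>a. \<forall>j. r j = (\<Sum>i\<in>UNIV. a i * mpderiv j (f i))}"
  have Row_0: "(\<lambda>_. 0) \<in> Row"
    by (auto simp: Row_def intro!: exI[of _ "\<lambda>_. 0"])
  have Row_add: "(\<lambda>j. r j + s j) \<in> Row" if rs: "r \<in> Row" "s \<in> Row" for r s
  proof -
    obtain a b where "\<forall>j. r j = (\<Sum>i\<in>UNIV. a i * mpderiv j (f i))" "\<forall>j. s j = (\<Sum>i\<in>UNIV. b i * mpderiv j (f i))"
      using rs by (auto simp: Row_def)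
    then show ?thesis
      by (auto simp: Row_def sum.distrib algebra_simps intro!: exI[of _ "\<lambda>i. a i + b i"])
  qed
  have Row_scale: "(\<lambda>j. c * r j) \<in> Row" if "r \<in> Row" for c r
  proof -
    obtain a where "\<forall>j. r j = (\<Sum>i\<in>UNIV. a i * mpderiv j (f i))" using \<open>r \<in> Row\<close> by (auto simp: Row_def)
    then show ?thesis
      by (auto simp: Row_def sum_distrib_left mult.assoc intro!: exI[of _ "\<lambda>i. c * a i"])
  qed
  have Row_inv: "(\<lambda>j. mpderiv j w) \<in> Row" if "w \<in> invs \<A>" for w
    using that unfolding f Row_def by (auto simp: mpderiv_msubst)
  have Row_list: "(\<lambda>j. \<Sum>(u, v)\<leftarrow>ws. u * mpderiv j (Tr (v * x))) \<in> Row"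
    if "\<forall>(u, v)\<in>set ws. v \<in> R" "x \<in> R" for ws x
    using that
  proof (induction ws)
    case (Cons w ws)
    then show ?case
      using Row_add[OF Row_scale[OF Row_inv[OF Tr_inv[OF R(2)[of "snd w" x]]], of "fst w"] Cons.IH] by (auto simp: case_prod_beta)
  qed (simp add: Row_0)
  show ?thesis
  proof (intro bexI[of _ t] ballI)
    show "t \<in> P" using tP by (simp add: t_def)
    fix x assume x: "x \<in> R"
    \<comment> \<open>Differentiating \<open>\<Sum> u Tr (v y) = y t\<close> for \<open>y = x\<close> and \<open>y = 1\<close>, the terms with \<open>\<partial>u\<close> cancel.\<close>
    have der: "mpderiv j (\<Sum>(u, v)\<leftarrow>us. u * Tr (v * y)) =
       (\<Sum>(u, v)\<leftarrow>us. mpderiv j u * Tr (v * y)) + (\<Sum>(u, v)\<leftarrow>us. u * mpderiv j (Tr (v * y)))" for j y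
      by (induction us) (auto simp: mpderiv_add mpderiv_mult algebra_simps)
    have eq: "(\<Sum>(u, v)\<leftarrow>us. u * mpderiv j (Tr (v * y))) = mpderiv j (y * t) - y * (\<Sum>(u, v)\<leftarrow>us. mpderiv j u * v)"
      if "y \<in> R" for y j
      using der[of j y] by (simp add: tr_t[OF that] tr_d[OF that] algebra_simps)
    have "t * mpderiv j x = (\<Sum>(u, v)\<leftarrow>us. u * mpderiv j (Tr (v * x))) + (- x) * (\<Sum>(u, v)\<leftarrow>us. u * mpderiv j (Tr (v * 1)))" for j
      unfolding eq[OF x] eq[OF R(1)] by (simp add: mpderiv_mult algebra_simps)
    moreover have "(\<lambda>j. (\<Sum>(u, v)\<leftarrow>us. u * mpderiv j (Tr (v * x))) + (- x) * (\<Sum>(u, v)\<leftarrow>us. u * mpderiv j (Tr (v * 1)))) \<in> Row"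
      by (intro Row_add Row_scale Row_list us(1) x R)
    ultimately show "\<exists>a. \<forall>j. t * mpderiv j x = (\<Sum>i\<in>UNIV. a i * mpderiv j (f i))"
      by (simp add: Row_def)
  qed
qed

text \<open>By \<open>gradient_in_span\<close>, \<open>t\<close> times the Jacobian matrix of \<open>h\<close> is a matrix \<open>N\<close> times that of \<open>f\<close>. Taking determinants,
\<open>t\<^sup>n J(h) = det N J(f) = det N D J(h)\<close> with \<open>n\<close> the number of variables, and \<open>J(h) \<noteq> 0\<close> cancels.\<close>

lemma relative_jacobian_dvd:
  assumes P: "1 \<in> P" "\<And>x y. x \<in> P \<Longrightarrow> y \<in> P \<Longrightarrow> x * y \<in> P"
    and sep: "\<And>A. A \<in> \<A> \<Longrightarrow> (\<forall>x\<in>range (msubst h). A x = x) \<or> (\<exists>x\<in>range (msubst h). A x - x \<in> P)"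
    and f: "invs \<A> = range (msubst f)" "range (msubst f) \<subseteq> range (msubst h)"
    and h: "jacobian_det h \<noteq> 0"
  shows "\<exists>D. jacobian_det f = D * jacobian_det h \<and> (\<exists>t\<in>P. D dvd t)"
proof -
  have "msubst f (mvar i) \<in> range (msubst h)" for i using f(2) by blast
  then have "\<forall>i. \<exists>Q. f i = msubst h Q" by auto
  then obtain Q where Q: "\<And>i. f i = msubst h (Q i)" by metis
  define Jf Jh Dm where "Jf = (\<chi> i j. mpderiv j (f i))" and "Jh = (\<chi> i j. mpderiv j (h i))"
    and "Dm = (\<chi> i k. msubst h (mpderiv k (Q i)))"
  have "Jf = Dm ** Jh"
    by (simp add: vec_eq_iff Jf_def Jh_def Dm_def matrix_matrix_mult_def Q mpderiv_msubst)
  then have 1: "jacobian_det f = det Dm * jacobian_det h"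
    by (simp add: jacobian_det_def Jf_def Jh_def det_mul flip: Jf_def Jh_def)
  have "\<exists>t\<in>P. \<forall>x\<in>range (msubst h). \<exists>a. \<forall>j. t * mpderiv j x = (\<Sum>i\<in>UNIV. a i * mpderiv j (f i))"
  proof (rule gradient_in_span[OF _ _ P sep f(1)])
    show "1 \<in> range (msubst h)" by (rule image_eqI[of _ _ 1]) (auto simp: msubst_simps)
    show "x * y \<in> range (msubst h)" if "x \<in> range (msubst h)" "y \<in> range (msubst h)" for x y
    proof -
      from that obtain p q where "x = msubst h p" "y = msubst h q" by auto
      then have "x * y = msubst h (p * q)" by (simp add: msubst_simps)
      then show ?thesis by simp
    qed
  qed
  then obtain t where t: "t \<in> P" "\<And>x. x \<in> range (msubst h) \<Longrightarrow> \<exists>a. \<forall>j. t * mpderiv j x = (\<Sum>i\<in>UNIV. a i * mpderiv j (f i))"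
    by blast
  have "h i \<in> range (msubst h)" for i by (rule image_eqI[of _ _ "mvar i"]) auto
  then have "\<forall>i. \<exists>a. \<forall>j. t * mpderiv j (h i) = (\<Sum>k\<in>UNIV. a k * mpderiv j (f k))"
    using t(2) by blast
  then obtain a where a: "\<And>i j. t * mpderiv j (h i) = (\<Sum>k\<in>UNIV. a i k * mpderiv j (f k))" by metis
  have "(\<chi> i. t *s Jh $ i) = (\<chi> i k. a i k) ** Jf"
    by (simp add: vec_eq_iff Jh_def Jf_def matrix_matrix_mult_def a)
  then have "t ^ CARD('n) * det Jh = det (\<chi> i k. a i k) * det Jf"
    using det_rows_mul[of "\<lambda>_. t" "\<lambda>i. Jh $ i"] by (simp add: det_mul)
  then have "jacobian_det h * t ^ CARD('n) = jacobian_det h * (det (\<chi> i k. a i k) * det Dm)"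
    using 1 by (simp add: jacobian_det_def Jf_def Jh_def mult_ac)
  then have "det Dm dvd t ^ CARD('n)" using h by simp
  moreover have "t ^ k \<in> P" for k by (induction k) (use P t in auto)
  ultimately show ?thesis using 1 by blast
qed

text \<open>The case \<open>R = S\<close>, where \<open>h\<close> consists of the variables and \<open>J(h) = 1\<close>.\<close>

lemma jacobian_dvd:
  assumes P: "1 \<in> P" "\<And>x y. x \<in> P \<Longrightarrow> y \<in> P \<Longrightarrow> x * y \<in> P"
    and sep: "\<And>A. A \<in> \<A> \<Longrightarrow> A \<noteq> id \<Longrightarrow> (\<exists>x. A x - x \<in> P)"
    and f: "invs \<A> = range (msubst f)"
  shows "\<exists>t\<in>P. jacobian_det f dvd t"
proof -
  have r: "range (msubst mvar) = (UNIV :: ('n, 'f) mpoly set)" by simp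
  have "(\<forall>x\<in>range (msubst mvar). A x = x) \<or> (\<exists>x\<in>range (msubst mvar). A x - x \<in> P)" if "A \<in> \<A>" for A
    using sep[OF that] by (cases "A = id") (auto simp: r)
  moreover have "range (msubst f) \<subseteq> range (msubst mvar)" unfolding r by blast
  moreover have "jacobian_det (mvar :: 'n \<Rightarrow> ('n, 'f) mpoly) \<noteq> 0" by (simp add: jacobian_det_mvar)
  ultimately have "\<exists>D. jacobian_det f = D * jacobian_det (mvar :: 'n \<Rightarrow> ('n, 'f) mpoly) \<and> (\<exists>t\<in>P. D dvd t)"
    using relative_jacobian_dvd[of P mvar f, OF P _ f] by blast
  then show ?thesis by (auto simp: jacobian_det_mvar)
qed

end

section \<open>Factorization of the Jacobian determinant\<close>

text \<open>The elements that act trivially modulo \<open>l\<close>. For a linear form \<open>l\<close> these come from the group elements that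
fix the hyperplane \<open>l = 0\<close> pointwise.\<close>

definition inertia :: "(('n, 'f::field) mpoly \<Rightarrow> ('n, 'f) mpoly) set \<Rightarrow> ('n, 'f) mpoly \<Rightarrow> (('n, 'f) mpoly \<Rightarrow> ('n, 'f) mpoly) set" where
  "inertia \<A> l = {A \<in> \<A>. \<forall>i. l dvd A (mvar i) - mvar i}"

lemma degree_one_plus_power: "k > 0 \<Longrightarrow> degree ([:1, w:] ^ k) = (if w = 0 then 0 else k)"
  for w :: "'a::idom"
  by (simp add: degree_power_eq)

text \<open>Equal \<open>k\<close>-th powers only determine their bases up to a root of unity; the common constant term \<open>1\<close>
removes this ambiguity.\<close>

lemma one_plus_linear_form_power_inj:
  fixes u v :: "('n::{finite,linorder}, 'f::field) mpoly"
  assumes "hdeg 1 u" "hdeg 1 v" "(1 + u) ^ k = (1 + v) ^ k" "k > 0"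
  shows "u = v"
proof -
  have *: "grading_hom (\<lambda>_. 1) (1 + w) = [:1, w:]" if "hdeg 1 w" for w :: "('n, 'f) mpoly"
    using that by (simp add: grading_hom_simps hom_deg_def monom_Suc monom_0 one_pCons)
  have eq: "[:1, u:] ^ k = [:1, v:] ^ k"
    using arg_cong[OF assms(3), of "grading_hom (\<lambda>_. 1)"]
    unfolding grading_hom_simps(7) *[OF assms(1)] *[OF assms(2)] .
  \<comment> \<open>Homogenize: the polynomials \<open>(t + u)\<^sup>k\<close> and \<open>(t + v)\<^sup>k\<close> coincide.\<close>
  have "[:u, 1:] ^ k = [:v, 1:] ^ k"
  proof (cases "u = 0 \<or> v = 0")
    case True
    have "degree ([:1, u:] ^ k) = degree ([:1, v:] ^ k)" using eq by (rule arg_cong)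
    then have "u = v"
      using True assms(4) unfolding degree_one_plus_power[OF assms(4)] by (auto split: if_splits)
    then show ?thesis by simp
  next
    case False
    then have "reflect_poly [:1, u:] = [:u, 1:]" "reflect_poly [:1, v:] = [:v, 1:]"
      by (auto simp: reflect_poly_pCons' reflect_poly_def)
    then show ?thesis using arg_cong[OF eq, of reflect_poly] by (simp add: reflect_poly_power)
  qed
  then have "poly ([:u, 1:] ^ k) (- u) = poly ([:v, 1:] ^ k) (- u)" by simp
  then show ?thesis using assms(4) by (simp add: poly_power power_0_left)
qed

context linear_action
begin

lemma inertia_dvd: "A \<in> inertia \<A> l \<Longrightarrow> l dvd A p - p"
  by (rule act_dvd_diff) (auto simp: inertia_def)

lemma linear_action_inertia: "linear_action (inertia \<A> l)"
proof
  fix A B assume A: "A \<in> inertia \<A> l" and B: "B \<in> inertia \<A> l"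
  have "l dvd (A (B p) - B p) + (B p - p)" for p
    using inertia_dvd[OF A] inertia_dvd[OF B] by (intro dvd_add)
  then show "A \<circ> B \<in> inertia \<A> l"
    using A B comp_mem by (auto simp: inertia_def)
next
  fix A assume A: "A \<in> inertia \<A> l"
  then obtain B where B: "B \<in> \<A>" "A \<circ> B = id" "B \<circ> A = id"
    using inv_mem by (auto simp: inertia_def)
  have "l dvd - (A (B p) - B p)" for p
    using inertia_dvd[OF A, of "B p"] by (subst dvd_minus_iff)
  then have "B \<in> inertia \<A> l"
    using B by (auto simp: inertia_def fun_eq_iff)
  then show "\<exists>B\<in>inertia \<A> l. A \<circ> B = id \<and> B \<circ> A = id" using B by blast
next
  show "A p = msubst (\<lambda>i. A (mvar i)) p" if "A \<in> inertia \<A> l" for A p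
    using that by (intro act_msubst) (simp add: inertia_def)
  show "hdeg 1 (A (mvar i))" if "A \<in> inertia \<A> l" for A i
    using that by (intro act_mvar) (simp add: inertia_def)
  show "finite (inertia \<A> l)" using finite_action by (simp add: inertia_def)
  show "id \<in> inertia \<A> l" using id_mem by (simp add: inertia_def)
qed

text \<open>For \<open>A \<noteq> id\<close> some \<open>A z\<^sub>i - z\<^sub>i\<close> is a nonzero linear form, so \<open>jacobian_dvd\<close> applies with the products of linear
forms as \<open>P\<close>. If no \<open>A \<noteq> id\<close> is trivial modulo \<open>u\<close>, it also applies with the complement of the prime
ideal of \<open>u\<close> as \<open>P\<close>.\<close>

lemma jacobian_linear_product:
  assumes "invs \<A> = range (msubst f)"
  shows "jacobian_det f \<in> linear_products"
    and "\<And>u. hdeg 1 u \<Longrightarrow> u \<noteq> 0 \<Longrightarrow> u dvd jacobian_det f \<Longrightarrow> inertia \<A> u \<noteq> {id}"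
proof -
  have "\<exists>x. A x - x \<in> linear_products" if A: "A \<in> \<A>" "A \<noteq> id" for A
  proof -
    obtain i where i: "A (mvar i) \<noteq> mvar i" using action_eq_idI[OF A(1)] A(2) by blast
    have "hdeg 1 (A (mvar i) - mvar i)"
      using act_mvar[OF A(1), of i] by (intro hom_deg_diff) auto
    then have "A (mvar i) - mvar i \<in> linear_products"
      using i by (intro linear_form_in_linear_products) simp_all
    then show ?thesis by blast
  qed
  then have "\<exists>t\<in>linear_products. jacobian_det f dvd t"
    by (intro jacobian_dvd assms linear_products_1 linear_products_mult)
  then show "jacobian_det f \<in> linear_products"
    using dvd_linear_products by auto
next
  fix u assume u: "hdeg 1 u" "u \<noteq> 0" "u dvd jacobian_det f"
  have pr: "prime_elem u" using prime_elem_linear_form[OF u(1,2)] .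
  show "inertia \<A> u \<noteq> {id}"
  proof
    assume triv: "inertia \<A> u = {id}"
    define P where "P = {t. \<not> u dvd t}"
    have P: "1 \<in> P" "\<And>x y. x \<in> P \<Longrightarrow> y \<in> P \<Longrightarrow> x * y \<in> P"
      using pr by (auto simp: P_def prime_elem_dvd_mult_iff prime_elem_not_unit)
    have "\<exists>x. A x - x \<in> P" if A: "A \<in> \<A>" "A \<noteq> id" for A
    proof -
      have "A \<notin> inertia \<A> u" using triv A(2) by simp
      then show ?thesis using A(1) by (auto simp: inertia_def P_def)
    qed
    then obtain t where "t \<in> P" "jacobian_det f dvd t"
      using jacobian_dvd[OF P _ assms] by blast
    then show False using u(3) dvd_trans by (auto simp: P_def)
  qed
qed

lemma norm_invs: "(\<Prod>B\<in>\<A>. B x) \<in> invs \<A>"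
  unfolding invs_def
proof safe
  fix A assume A: "A \<in> \<A>"
  have "A (\<Prod>B\<in>\<A>. B x) = (\<Prod>B\<in>\<A>. (A \<circ> B) x)" using A by (simp add: act_simps)
  also have "\<dots> = (\<Prod>B\<in>\<A>. B x)"
    using prod.reindex_bij_betw[OF act_bij_betw_comp[OF A], of "\<lambda>B. B x"] by simp
  finally show "A (\<Prod>B\<in>\<A>. B x) = (\<Prod>B\<in>\<A>. B x)" .
qed

text \<open>The invariant is a norm \<open>N x\<close> under the inertia group, which satisfies \<open>N x \<equiv> x\<^sup>m\<close> modulo \<open>l\<close>. If \<open>A\<close> moves
the hyperplane of \<open>l\<close>, then \<open>N l\<close> works: it is divisible by \<open>l\<close>, and \<open>A (N l)\<close> is not. Otherwise \<open>A\<close> acts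
modulo \<open>l\<close>, nontrivially on some \<open>z\<^sub>i\<close>, and \<open>N (1 + z\<^sub>i)\<close> works.\<close>

lemma separated_by_inertia_invariant:
  assumes l: "hdeg 1 l" "l \<noteq> 0" and A: "A \<in> \<A>" "A \<notin> inertia \<A> l"
  shows "\<exists>x\<in>invs (inertia \<A> l). \<not> l dvd A x - x"
proof -
  interpret K: linear_action "inertia \<A> l" by (rule linear_action_inertia)
  define N where "N = (\<lambda>x. \<Prod>B\<in>inertia \<A> l. B x)"
  have N: "N x \<in> invs (inertia \<A> l)" for x unfolding N_def by (rule K.norm_invs)
  have pr: "prime_elem l" using prime_elem_linear_form[OF l] .
  show ?thesis
  proof (cases "l dvd A l")
    case False
    have "\<not> l dvd A (N l) - N l"
    proof
      assume "l dvd A (N l) - N l"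
      moreover have "l dvd N l"
        unfolding N_def using dvd_prodI[OF K.finite_action K.id_mem, of "\<lambda>B. B l"] by simp
      ultimately have "l dvd (A (N l) - N l) + N l" by (rule dvd_add)
      then have "l dvd A (N l)" by simp
      then have "l dvd (\<Prod>B\<in>inertia \<A> l. A (B l))"
        using A(1) by (simp add: N_def act_simps)
      then obtain B where B: "B \<in> inertia \<A> l" "l dvd A (B l)"
        using prime_elem_dvd_prodD[OF K.finite_action pr] by blast
      have "l dvd (B l - l) + l" using inertia_dvd[OF B(1)] by (intro dvd_add) auto
      then obtain a where a: "a \<noteq> 0" "B l = mconst a * l"
        using linear_forms_associated[OF l(1), of "B l"] K.act_hdeg[OF B(1) l(1)] K.act_0_iff[OF B(1)] l(2) by auto
      have "A l = mconst (inverse a) * A (B l)"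
        using a A(1) by (simp add: act_simps flip: mult.assoc mconst_mult)
      then show False using B(2) False by simp
    qed
    then show ?thesis using N by blast
  next
    case True
    obtain i where i: "\<not> l dvd A (mvar i) - mvar i" using A by (auto simp: inertia_def)
    \<comment> \<open>Congruences modulo \<open>l\<close> are equalities after applying \<open>\<sigma>\<close>.\<close>
    obtain \<sigma> :: "'n \<Rightarrow> ('n, 'f) mpoly" where \<sigma>: "\<And>p. l dvd p \<longleftrightarrow> msubst \<sigma> p = 0" "\<And>i. hdeg 1 (\<sigma> i)"
      using linear_form_kill[OF l] by blast
    have eqI: "msubst \<sigma> p = msubst \<sigma> q" if "l dvd p - q" for p q
      using that by (simp add: \<sigma>(1) msubst_simps)
    define x where "x = 1 + (mvar i :: ('n, 'f) mpoly)"
    have 1: "msubst \<sigma> (N x) = msubst \<sigma> x ^ card (inertia \<A> l)"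
    proof -
      have "msubst \<sigma> (B x) = msubst \<sigma> x" if "B \<in> inertia \<A> l" for B
        by (rule eqI) (rule inertia_dvd[OF that])
      then show ?thesis by (simp add: N_def msubst_simps)
    qed
    have 2: "msubst \<sigma> (A (N x)) = msubst \<sigma> (A x) ^ card (inertia \<A> l)"
    proof -
      have "msubst \<sigma> (A (B x)) = msubst \<sigma> (A x)" if "B \<in> inertia \<A> l" for B
      proof (rule eqI)
        have "A l dvd A (B x - x)"
          using ring_hom1_dvd[OF act_hom[OF A(1)] inertia_dvd[OF that]] .
        then show "l dvd A (B x) - A x" using True A(1) by (simp add: act_simps dvd_trans)
      qed
      then show ?thesis using A(1) by (simp add: N_def msubst_simps act_simps)
    qed
    have "\<not> l dvd A (N x) - N x"
    proof
      assume "l dvd A (N x) - N x"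
      then have "(1 + msubst \<sigma> (A (mvar i))) ^ card (inertia \<A> l) = (1 + msubst \<sigma> (mvar i)) ^ card (inertia \<A> l)"
        using eqI[of "A (N x)" "N x"] A(1) unfolding 1 2 by (simp add: x_def msubst_simps act_simps)
      moreover have "card (inertia \<A> l) > 0"
        using K.finite_action K.id_mem by (auto simp: card_gt_0_iff)
      moreover have "hdeg 1 (msubst \<sigma> (A (mvar i)))" "hdeg 1 (msubst \<sigma> (mvar i))"
        using A(1) act_mvar \<sigma>(2) by (auto intro!: hom_deg_msubst[of "\<lambda>_. 1"] simp del: One_nat_def)
      ultimately have "msubst \<sigma> (A (mvar i)) = msubst \<sigma> (mvar i)"
        using one_plus_linear_form_power_inj by blast
      then show False using i by (simp add: \<sigma>(1) msubst_simps)
    qed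
    then show ?thesis using N by blast
  qed
qed

text \<open>This is \<open>relative_jacobian_dvd\<close> for the complement of the prime ideal of \<open>l\<close>, with the invariants of the inertia
group as \<open>R\<close>.\<close>

lemma jacobian_inertia_quotient:
  assumes l: "hdeg 1 l" "l \<noteq> 0"
    and f: "invs \<A> = range (msubst f)" and h: "invs (inertia \<A> l) = range (msubst h)"
  shows "\<exists>D. jacobian_det f = D * jacobian_det h \<and> \<not> l dvd D"
proof -
  interpret K: linear_action "inertia \<A> l" by (rule linear_action_inertia)
  have pr: "prime_elem l" using prime_elem_linear_form[OF l] .
  define P where "P = {t. \<not> l dvd t}"
  have P: "1 \<in> P" "\<And>x y. x \<in> P \<Longrightarrow> y \<in> P \<Longrightarrow> x * y \<in> P"
    using pr by (auto simp: P_def prime_elem_dvd_mult_iff prime_elem_not_unit)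
  have "(\<forall>x\<in>range (msubst h). A x = x) \<or> (\<exists>x\<in>range (msubst h). A x - x \<in> P)" if "A \<in> \<A>" for A
  proof (cases "A \<in> inertia \<A> l")
    case True
    then show ?thesis unfolding h[symmetric] by (auto simp: invs_def)
  next
    case False
    then show ?thesis
      using separated_by_inertia_invariant[OF l that] unfolding h[symmetric] P_def by blast
  qed
  moreover have "range (msubst f) \<subseteq> range (msubst h)"
    unfolding f[symmetric] h[symmetric] by (auto simp: invs_def inertia_def)
  moreover have "jacobian_det h \<noteq> 0"
    using K.jacobian_linear_product(1)[OF h] linear_products_nonzero by blast
  ultimately obtain D t where "jacobian_det f = D * jacobian_det h" "t \<in> P" "D dvd t"
    using relative_jacobian_dvd[of P h f, OF P _ f] by blast
  then show ?thesis using dvd_trans by (auto simp: P_def)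
qed

lemma alg_independent_nonconstant:
  fixes h :: "'n \<Rightarrow> ('n, 'f) mpoly"
  assumes "alg_independent h" shows "h i \<noteq> mconst a"
proof
  assume "h i = mconst a"
  then have "msubst h (mvar i - mconst a) = 0" by (simp add: msubst_simps)
  then have "(mvar i :: ('n, 'f) mpoly) - mconst a = 0" using assms by (auto simp: alg_independent_def)
  then have *: "(mvar i :: ('n, 'f) mpoly) = mconst a" by simp
  have "hdeg 0 (mvar i :: ('n, 'f) mpoly)" unfolding * by simp
  moreover have "(mvar i :: ('n, 'f) mpoly) \<noteq> 0" by simp
  ultimately show False using hom_deg_unique[of "\<lambda>_. 1" 0 "mvar i :: ('n, 'f) mpoly" 1] by simp
qed

text \<open>Let \<open>u\<close> be a linear form that divides \<open>J(h)\<close>. Some \<open>A \<noteq> id\<close> in the inertia group of \<open>l\<close> is trivial modulo \<open>u\<close> as well, and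
a nonzero \<open>A z\<^sub>i - z\<^sub>i\<close> is then proportional to both \<open>u\<close> and \<open>l\<close>.\<close>

lemma jacobian_inertia:
  assumes l: "hdeg 1 l" "l \<noteq> 0"
    and h: "invs (inertia \<A> l) = range (msubst h)" "\<And>i. homogeneous (h i)" "alg_independent h"
  shows "\<exists>c. c \<noteq> 0 \<and> jacobian_det h = mconst c * l ^ (\<Sum>i\<in>UNIV. total_degree (h i) - 1)"
proof -
  interpret K: linear_action "inertia \<A> l" by (rule linear_action_inertia)
  have "l dvd u" if u: "hdeg 1 u" "u \<noteq> 0" "u dvd jacobian_det h" for u
  proof -
    obtain A where A: "A \<in> inertia \<A> l" "A \<in> inertia (inertia \<A> l) u" "A \<noteq> id"
      using K.jacobian_linear_product(2)[OF h(1) u] K.id_mem by (auto simp: inertia_def)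
    obtain i where i: "A (mvar i) \<noteq> mvar i" using K.action_eq_idI[OF A(1)] A(3) by blast
    have d: "hdeg 1 (A (mvar i) - mvar i)"
      using K.act_mvar[OF A(1), of i] by (intro hom_deg_diff) auto
    obtain a where a: "a \<noteq> 0" "A (mvar i) - mvar i = mconst a * u"
      using linear_forms_associated[OF u(1) d] A(2) i by (auto simp: inertia_def)
    have "l dvd A (mvar i) - mvar i" using A(1) by (auto simp: inertia_def)
    then have "l dvd mconst (inverse a) * (A (mvar i) - mvar i)" by simp
    then show ?thesis using a by (simp flip: mult.assoc mconst_mult)
  qed
  then have "\<exists>c e. c \<noteq> 0 \<and> jacobian_det h = mconst c * (\<Prod>k\<in>{()}. l ^ e k)"
    using l by (intro linear_products_factor K.jacobian_linear_product(1)[OF h(1)]) auto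
  then obtain c e where ce: "c \<noteq> 0" "jacobian_det h = mconst c * l ^ e" by auto
  have nz: "h i \<noteq> 0" for i using alg_independent_nonconstant[OF h(3), of i 0] by simp
  have hd: "hdeg (total_degree (h i)) (h i)" for i
    using h(2)[of i] total_degree_eq[OF _ nz[of i]] by (auto simp: homogeneous_iff)
  have "total_degree (h i) \<noteq> 0" for i
  proof
    assume "total_degree (h i) = 0"
    then have "hdeg 0 (h i)" using hd[of i] by simp
    then show False using hdeg_0D alg_independent_nonconstant[OF h(3), of i] by blast
  qed
  then have "total_degree (h i) \<ge> 1" for i by (simp add: Suc_le_eq)
  then have "hdeg (\<Sum>i\<in>UNIV. total_degree (h i) - 1) (jacobian_det h)"
    by (rule hdeg_jacobian_det[OF hd])
  moreover have "hdeg (1 * e) (jacobian_det h)" unfolding ce(2) by (intro hom_deg_scale hom_deg_power l)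
  moreover have "jacobian_det h \<noteq> 0" using ce l by simp
  ultimately have "1 * e = (\<Sum>i\<in>UNIV. total_degree (h i) - 1)" using hom_deg_unique by blast
  then show ?thesis using ce by auto
qed

theorem jacobian_factorization:
  fixes f :: "'n \<Rightarrow> ('n, 'f) mpoly" and h :: "'k \<Rightarrow> 'n \<Rightarrow> ('n, 'f) mpoly"
  assumes f: "invs \<A> = range (msubst f)" and "finite I"
    and L: "\<And>k. k \<in> I \<Longrightarrow> hdeg 1 (L k)" "\<And>k. k \<in> I \<Longrightarrow> L k \<noteq> 0"
    and L_inj: "\<And>j k. j \<in> I \<Longrightarrow> k \<in> I \<Longrightarrow> L j dvd L k \<Longrightarrow> j = k"
    and L_all: "\<And>u. hdeg 1 u \<Longrightarrow> u \<noteq> 0 \<Longrightarrow> inertia \<A> u \<noteq> {id} \<Longrightarrow> \<exists>k\<in>I. L k dvd u"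
    and h: "\<And>k. k \<in> I \<Longrightarrow> invs (inertia \<A> (L k)) = range (msubst (h k))"
      "\<And>k i. k \<in> I \<Longrightarrow> homogeneous (h k i)" "\<And>k. k \<in> I \<Longrightarrow> alg_independent (h k)"
  shows "\<exists>c. c \<noteq> 0 \<and> jacobian_det f = mconst c * (\<Prod>k\<in>I. L k ^ (\<Sum>i\<in>UNIV. total_degree (h k i) - 1))"
proof -
  have "\<exists>c e. c \<noteq> 0 \<and> jacobian_det f = mconst c * (\<Prod>k\<in>I. L k ^ e k)"
    by (rule linear_products_factor[OF jacobian_linear_product(1)[OF f] \<open>finite I\<close> L(1)])
      (use jacobian_linear_product(2)[OF f] L_all in auto)
  then obtain c e where ce: "c \<noteq> 0" "jacobian_det f = mconst c * (\<Prod>k\<in>I. L k ^ e k)" by blast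
  have "e k = (\<Sum>i\<in>UNIV. total_degree (h k i) - 1)" if k: "k \<in> I" for k
  proof -
    define m where "m = (\<Sum>i\<in>UNIV. total_degree (h k i) - 1)"
    have pr: "prime_elem (L k)" using prime_elem_linear_form L k by blast
    obtain D where D: "jacobian_det f = D * jacobian_det (h k)" "\<not> L k dvd D"
      using jacobian_inertia_quotient[OF L(1,2)[OF k] f h(1)[OF k]] by blast
    obtain d where d: "d \<noteq> 0" "jacobian_det (h k) = mconst d * L k ^ m"
      using jacobian_inertia[OF L(1,2)[OF k] h(1)[OF k] h(2,3)[OF k]] unfolding m_def by blast
    define X where "X = mconst c * (\<Prod>j\<in>I - {k}. L j ^ e j)"
    define Y where "Y = mconst d * D"
    have unit: "\<not> L k dvd mconst a" if "a \<noteq> 0" for a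
      using dvd_trans[OF _ mconst_dvd_1[OF that], of "L k"] prime_elem_not_unit[OF pr] by blast
    have "\<not> L k dvd X"
    proof
      assume "L k dvd X"
      then have "L k dvd (\<Prod>j\<in>I - {k}. L j ^ e j)"
        using pr unit[OF ce(1)] by (simp add: X_def prime_elem_dvd_mult_iff)
      then obtain j where "j \<in> I - {k}" "L k dvd L j ^ e j"
        using prime_elem_dvd_prodD[OF _ pr, of "I - {k}"] \<open>finite I\<close> by blast
      then show False using L_inj[OF k, of j] prime_elem_dvd_power[OF pr] by auto
    qed
    moreover have "\<not> L k dvd Y"
      using pr D(2) unit[OF d(1)] by (simp add: Y_def prime_elem_dvd_mult_iff)
    moreover have eq: "L k ^ e k * X = L k ^ m * Y"
    proof -
      have "jacobian_det f = L k ^ e k * X"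
        using ce(2) prod.remove[OF \<open>finite I\<close> k, of "\<lambda>k. L k ^ e k"] by (simp add: X_def mult_ac)
      then show ?thesis using D(1) d(2) by (simp add: Y_def mult_ac)
    qed
    ultimately have "e k = m"
      using power_exponent_le[OF L(2)[OF k] eq] power_exponent_le[OF L(2)[OF k] eq[symmetric]] by simp
    then show ?thesis by (simp add: m_def)
  qed
  then have "(\<Prod>k\<in>I. L k ^ e k) = (\<Prod>k\<in>I. L k ^ (\<Sum>i\<in>UNIV. total_degree (h k i) - 1))" by simp
  then show ?thesis using ce by auto
qed

end

section \<open>Changes of generators\<close>

text \<open>If only \<open>z\<^sub>i\<close> has positive weight, then weight \<open>0\<close> means that no monomial contains \<open>z\<^sub>i\<close>.\<close>

definition free_of :: "'n::finite \<Rightarrow> ('n, 'f::comm_ring_1) mpoly \<Rightarrow> bool" where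
  "free_of i p \<longleftrightarrow> hom_deg (\<lambda>j. if j = i then 1 else 0) 0 p"

lemma free_of_msubst:
  assumes "free_of i p" shows "msubst (\<sigma>(i := x)) p = msubst \<sigma> p"
  unfolding msubst_def
proof (rule sum.cong)
  fix m assume "m \<in> Poly_Mapping.keys p"
  then have "(\<Sum>j\<in>UNIV. (if j = i then 1 else 0) * Poly_Mapping.lookup m j) = 0"
    using assms by (auto simp: free_of_def hom_deg_iff_keys)
  then have "Poly_Mapping.lookup m i = 0"
    by (simp add: if_distrib[of "\<lambda>x. x * _"] cong: if_cong)
  then have "(\<Prod>j\<in>UNIV. (\<sigma>(i := x)) j ^ Poly_Mapping.lookup m j) = (\<Prod>j\<in>UNIV. \<sigma> j ^ Poly_Mapping.lookup m j)"
    by (intro prod.cong) auto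
  then show "mconst (Poly_Mapping.lookup p m) * (\<Prod>j\<in>UNIV. (\<sigma>(i := x)) j ^ Poly_Mapping.lookup m j) =
    mconst (Poly_Mapping.lookup p m) * (\<Prod>j\<in>UNIV. \<sigma> j ^ Poly_Mapping.lookup m j)" by simp
qed simp

lemma free_of_msubst_mvar: "free_of i p \<Longrightarrow> msubst (mvar(i := x)) p = p"
  by (simp add: free_of_msubst)

lemma free_of_specialize: "free_of i (msubst (mvar(i := 0)) p)"
  unfolding free_of_def
proof (induction p rule: mpoly_induct)
  case (var j)
  then show ?case using hom_deg_mvar[of "\<lambda>j. if j = i then 1 else 0" j] by auto
next
  case (mult p q)
  then show ?case using hom_deg_mult[OF mult] by (simp add: msubst_simps)
qed (auto simp: msubst_simps hom_deg_add)

definition vdeg :: "'n::finite \<Rightarrow> ('n, 'f::comm_ring_1) mpoly \<Rightarrow> nat" where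
  "vdeg i p = degree (grading_hom (\<lambda>j. if j = i then 1 else 0) p)"

lemma free_of_iff_vdeg: "free_of i p \<longleftrightarrow> vdeg i p = 0"
proof
  assume "vdeg i p = 0"
  then obtain a where a: "grading_hom (\<lambda>j. if j = i then 1 else 0) p = [:a:]"
    unfolding vdeg_def by (rule degree_eq_zeroE)
  then have "a = p" using poly_grading_hom_1[of "\<lambda>j. if j = i then 1 else 0" p] by simp
  then show "free_of i p" using a by (simp add: free_of_def hom_deg_def monom_0)
qed (simp add: free_of_def hom_deg_def vdeg_def monom_0)

lemma vdeg_mult:
  fixes p q :: "('n::{finite,linorder}, 'f::idom) mpoly"
  shows "p * q \<noteq> 0 \<Longrightarrow> vdeg i (p * q) = vdeg i p + vdeg i q"
  unfolding vdeg_def by (rule degree_grading_hom_mult)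

lemma vdeg_diff_free: "free_of i q \<Longrightarrow> vdeg i (p - q) \<le> vdeg i p"
  using degree_diff_le_max[of "grading_hom (\<lambda>j. if j = i then 1 else 0) p" "grading_hom (\<lambda>j. if j = i then 1 else 0) q"]
  by (simp add: free_of_iff_vdeg vdeg_def grading_hom_simps)

lemma vdeg_pos:
  assumes "msubst (mvar(i := 0)) r = 0" "r \<noteq> 0"
  shows "vdeg i r > 0"
  using assms free_of_msubst_mvar[of i r 0] by (auto simp: free_of_iff_vdeg)

lemma vanish_dvd: "msubst (mvar(i := 0)) p = 0 \<longleftrightarrow> mvar i dvd p"
  using mvar_minus_dvd_iff[of i 0 p] by (simp add: msubst_simps)

lemma msubst_upd_upd: "msubst (mvar(i := x)) (msubst (mvar(i := y)) p) = msubst (mvar(i := msubst (mvar(i := x)) y)) p"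
  unfolding msubst_msubst by (intro arg_cong[of _ _ "\<lambda>\<sigma>. msubst \<sigma> p"]) auto

lemma specialize_diff: "msubst (mvar(i := 0)) (p - msubst (mvar(i := 0)) p) = 0"
  by (simp add: msubst_simps msubst_upd_upd)

text \<open>Write \<open>p = p\<^sub>0 + z\<^sub>i q\<close> with \<open>p\<^sub>0\<close> free of \<open>z\<^sub>i\<close>. The image is \<open>p\<^sub>0\<close> plus \<open>r\<close> times the image of \<open>q\<close>, so setting
\<open>z\<^sub>i = 0\<close> gives \<open>p\<^sub>0 = 0\<close>, and induction applies to \<open>q\<close>.\<close>

lemma msubst_replace_inj:
  fixes r p :: "('n::{finite,linorder}, 'f::field) mpoly"
  assumes r: "r \<noteq> 0" "msubst (mvar(i := 0)) r = 0"
  shows "msubst (mvar(i := r)) p = 0 \<Longrightarrow> p = 0"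
proof (induction "vdeg i p" arbitrary: p rule: less_induct)
  case less
  define p0 where "p0 = msubst (mvar(i := 0)) p"
  obtain q where q: "p - p0 = mvar i * q"
    using vanish_dvd[of i "p - p0"] specialize_diff[of i p] by (auto simp: p0_def elim: dvdE)
  have p: "p = p0 + mvar i * q" using q by (simp add: algebra_simps)
  have p0: "msubst (mvar(i := x)) p0 = p0" for x
    unfolding p0_def by (rule free_of_msubst_mvar[OF free_of_specialize])
  have eq: "p0 + r * msubst (mvar(i := r)) q = 0"
    using less.prems by (subst (asm) p) (simp add: msubst_simps p0)
  have "msubst (mvar(i := 0)) (p0 + r * msubst (mvar(i := r)) q) = 0" unfolding eq by (simp add: msubst_simps)
  then have z: "p0 = 0" using r(2) by (simp add: msubst_simps p0)
  then have "msubst (mvar(i := r)) q = 0" using eq r(1) by simp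
  show "p = 0"
  proof (rule ccontr)
    assume "p \<noteq> 0"
    then have "vdeg i p = vdeg i (mvar i :: ('n, 'f) mpoly) + vdeg i q"
      using p z vdeg_mult[of "mvar i" q i] by simp
    moreover have "vdeg i (mvar i :: ('n, 'f) mpoly) > 0"
      using \<open>p \<noteq> 0\<close> p z by (intro vdeg_pos) auto
    ultimately have "q = 0" using less.hyps \<open>msubst (mvar(i := r)) q = 0\<close> by simp
    then show False using p z \<open>p \<noteq> 0\<close> by simp
  qed
qed

lemma change_generators:
  fixes y :: "'n::finite \<Rightarrow> ('m, 'f::field) mpoly" and \<sigma> \<tau> :: "'n \<Rightarrow> ('n, 'f) mpoly"
  assumes y: "alg_independent y"
    and \<sigma>: "\<And>i. msubst \<sigma> (\<tau> i) = mvar i" "\<And>i. msubst \<tau> (\<sigma> i) = mvar i"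
  shows "alg_independent (\<lambda>i. msubst y (\<sigma> i))" "range (msubst (\<lambda>i. msubst y (\<sigma> i))) = range (msubst y)"
proof -
  have 1: "msubst \<sigma> (msubst \<tau> p) = p" "msubst \<tau> (msubst \<sigma> p) = p" for p
    using \<sigma> by (simp_all add: msubst_msubst)
  have 2: "msubst (\<lambda>i. msubst y (\<sigma> i)) p = msubst y (msubst \<sigma> p)" for p
    by (simp add: msubst_msubst)
  show "alg_independent (\<lambda>i. msubst y (\<sigma> i))"
    unfolding alg_independent_def 2
  proof safe
    fix p assume "msubst y (msubst \<sigma> p) = 0"
    then have "msubst \<sigma> p = 0" using y by (auto simp: alg_independent_def)
    then have "msubst \<tau> (msubst \<sigma> p) = 0" by (simp add: msubst_simps)
    then show "p = 0" unfolding 1 .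
  qed
  show "range (msubst (\<lambda>i. msubst y (\<sigma> i))) = range (msubst y)"
  proof safe
    fix p
    show "msubst (\<lambda>i. msubst y (\<sigma> i)) p \<in> range (msubst y)" unfolding 2 by blast
    have "msubst y p = msubst (\<lambda>i. msubst y (\<sigma> i)) (msubst \<tau> p)" unfolding 2 1 ..
    then show "msubst y p \<in> range (msubst (\<lambda>i. msubst y (\<sigma> i)))" by blast
  qed
qed

lemma alg_independent_eq: "alg_independent y \<Longrightarrow> msubst y p = msubst y q \<Longrightarrow> p = q"
  using msubst_simps(6)[of y p q] by (auto simp: alg_independent_def)

lemma generator_in_range: "y i \<in> range (msubst y)"
  by (rule image_eqI[of _ _ "mvar i"]) auto

section \<open>Invariants of a translation\<close>

lemma CHAR_mpoly: "CHAR(('n, 'f::comm_ring_1) mpoly) = CHAR('f)"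
proof (rule CHAR_eqI)
  show "of_nat CHAR('f) = (0 :: ('n, 'f) mpoly)"
    unfolding mconst_of_nat[symmetric] by simp
  show "CHAR('f) dvd k" if "of_nat k = (0 :: ('n, 'f) mpoly)" for k
    using that unfolding mconst_of_nat[symmetric] by (simp add: of_nat_eq_0_iff_char_dvd)
qed

lemma hom_deg_0_constD:
  assumes "hom_deg w 0 p" "\<And>i. w i > 0" shows "\<exists>a. p = mconst a"
proof -
  have "w i \<noteq> 0" for i using assms(2)[of i] by simp
  with assms(1) have "hdeg 0 p"
    by (simp add: hom_deg_iff_keys)
  then show ?thesis by (rule hdeg_0D)
qed

lemma translation_norm_nonzero:
  fixes U :: "('n::{finite,linorder}, 'f::field) mpoly"
  assumes U: "msubst (mvar(i := 0)) U = U" "U \<noteq> 0" and k: "k > 1"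
  shows "mvar i ^ k - U ^ (k - 1) * mvar i \<noteq> 0"
proof
  assume "mvar i ^ k - U ^ (k - 1) * mvar i = 0"
  moreover have "mvar i ^ k = mvar i ^ (k - 1) * (mvar i :: ('n, 'f) mpoly)"
    using k by (simp flip: power_Suc2)
  ultimately have "mvar i ^ (k - 1) = U ^ (k - 1)" by simp
  then have "msubst (mvar(i := 0)) (mvar i ^ (k - 1)) = msubst (mvar(i := 0)) (U ^ (k - 1))" by simp
  then show False using U k by (simp add: msubst_simps power_0_left)
qed

text \<open>The polynomial \<open>r = z\<^sub>i\<^sup>p - U\<^sup>p\<^sup>-\<^sup>1 z\<^sub>i\<close> is, up to a constant, the norm \<open>\<Prod>\<^sub>m (z\<^sub>i - m U)\<close> of \<open>z\<^sub>i\<close> under the translation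
by \<open>U\<close>; in this form it is visibly additive. If \<open>q\<close> is invariant, then so is \<open>q\<close> minus its value at \<open>z\<^sub>i = 0\<close>; this
difference vanishes at all \<open>z\<^sub>i = m U\<close>, hence is divisible by \<open>r\<close>, and induction on the degree in \<open>z\<^sub>i\<close> applies
to the quotient.\<close>

lemma translation_invariants:
  fixes q :: "('n::{finite,linorder}, 'f::field) mpoly"
  assumes p: "prime CHAR('f)" and c: "c \<noteq> 0" and j: "j \<noteq> i" and k: "k > 0"
  defines "U \<equiv> (mconst c * mvar j ^ k :: ('n, 'f) mpoly)"
  defines "\<rho> \<equiv> mvar(i := mvar i ^ CHAR('f) - U ^ (CHAR('f) - 1) * mvar i)"
  assumes "msubst (mvar(i := mvar i + U)) q = q"
  shows "q \<in> range (msubst \<rho>)"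
proof -
  let ?p = "CHAR('f)"
  let ?\<theta> = "msubst (mvar(i := mvar i + U))"
  have p0: "?p > 0" using p prime_gt_0_nat by blast
  have U: "msubst (mvar(i := x)) U = U" for x :: "('n, 'f) mpoly"
    using j by (simp add: U_def msubst_simps)
  have mv: "(mvar i' :: ('n, 'f) mpoly) \<noteq> 0" for i' by (rule mvar_nonzero)
  have U0: "U \<noteq> 0" using c mv by (simp add: U_def)
  have of_nat_U: "msubst (mvar(i := x)) (of_nat m * U) = of_nat m * U" for x :: "('n, 'f) mpoly" and m
    unfolding mconst_of_nat[symmetric] by (simp add: msubst_simps U)
  have ne: "mvar i - a \<noteq> 0" if "msubst (mvar(i := 0)) a = a" for a :: "('n, 'f) mpoly"
  proof
    assume "mvar i - a = 0"
    then have "a = mvar i" by simp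
    then show False using that mv[of i] by (simp add: fun_upd_same)
  qed
  define r where "r = \<rho> i"
  have r_eq: "r = mvar i ^ ?p - U ^ (?p - 1) * mvar i" by (simp add: r_def \<rho>_def)
  have \<rho>: "\<rho> = mvar(i := r)" by (simp add: \<rho>_def r_eq)
  have r0: "msubst (mvar(i := 0)) r = 0" using p0 by (simp add: r_eq msubst_simps U power_0_left)
  have fd: "(x + y) ^ ?p = x ^ ?p + y ^ ?p" for x y :: "('n, 'f) mpoly"
    by (rule freshmans_dream) (simp_all add: CHAR_mpoly p)
  have Up: "U * U ^ (?p - Suc 0) = U ^ ?p" using p0 by (simp flip: power_Suc)
  have r\<theta>: "?\<theta> r = r"
    by (simp add: r_eq msubst_simps U fd algebra_simps Up)
  define g where "g = (\<lambda>m. mvar i - of_nat m * U)"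
  define D where "D = (\<Prod>m<?p. g m)"
  \<comment> \<open>An invariant takes the same value at all \<open>z\<^sub>i = m U\<close>.\<close>
  have D_dvd: "D dvd s" if s: "?\<theta> s = s" "msubst (mvar(i := 0)) s = 0" for s
    unfolding D_def
  proof (rule prod_dvd_of_primes)
    have "msubst (mvar(i := of_nat m * U)) s = 0" for m
    proof (induction m)
      case 0
      show ?case using s(2) by (simp only: of_nat_0 mult_zero_left)
    next
      case (Suc m)
      have "msubst (mvar(i := of_nat (Suc m) * U)) s = msubst (mvar(i := of_nat m * U)) (?\<theta> s)"
        by (simp add: msubst_upd_upd msubst_simps U algebra_simps)
      then show ?case unfolding s(1) Suc.IH .
    qed
    then show "g m dvd s" for m
      unfolding g_def using mvar_minus_dvd_iff[OF of_nat_U] by blast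
    show "prime_elem (g m)" for m
      unfolding g_def by (intro prime_elem_mvar_minus of_nat_U ne)
    show "\<not> g m dvd g m'" if m: "m \<in> {..<?p}" "m' \<in> {..<?p}" "m \<noteq> m'" for m m'
    proof
      assume "g m dvd g m'"
      then have "msubst (mvar(i := of_nat m * U)) (g m') = 0"
        unfolding g_def using mvar_minus_dvd_iff[OF of_nat_U] by blast
      then have "of_nat m * U = of_nat m' * U"
        unfolding g_def msubst_simps(6) of_nat_U by simp
      then have "(of_nat m :: 'f) = of_nat m'" using U0
        by (metis mconst_eq_iff mconst_of_nat mult_right_cancel)
      moreover have "(of_nat a :: 'f) \<noteq> of_nat b" if "a < b" "b < ?p" for a b
        using that of_nat_eq_iff_char_dvd[of a b, where 'a = 'f] by (auto dest: dvd_imp_le)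
      ultimately show False using m by (metis lessThan_iff nat_neq_iff)
    qed
  qed simp
  have r_dvd: "r dvd s" if s: "?\<theta> s = s" "msubst (mvar(i := 0)) s = 0" for s
  proof -
    obtain X where X: "r = D * X" using D_dvd[OF r\<theta> r0] by (metis dvdE)
    \<comment> \<open>For the weights that make \<open>U\<close> and \<open>z\<^sub>i\<close> of the same degree, both \<open>r\<close> and \<open>D\<close> are homogeneous of degree \<open>k p\<close>.\<close>
    define w where "w = (\<lambda>j'. if j' = i then k else 1)"
    have wi: "hom_deg w k (mvar i :: ('n, 'f) mpoly)" and wj: "hom_deg w 1 (mvar j :: ('n, 'f) mpoly)"
      using hom_deg_mvar[of w i] hom_deg_mvar[of w j] j by (auto simp: w_def)
    have wU: "hom_deg w k U"
      unfolding U_def using hom_deg_scale[OF hom_deg_power[OF wj, of k]] by simp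
    have "hom_deg w k (g m)" for m
      unfolding g_def mconst_of_nat[symmetric] by (intro hom_deg_diff wi hom_deg_scale wU)
    then have wD: "hom_deg w (?p * k) D"
      unfolding D_def using hom_deg_prod[of "{..<?p}" w "\<lambda>_. k" g] by simp
    have "hom_deg w (k * (?p - 1) + k) (U ^ (?p - 1) * mvar i)"
      by (intro hom_deg_mult hom_deg_power wU wi)
    moreover have "k * (?p - 1) + k = k * ?p" using p0 by (cases ?p) auto
    ultimately have "hom_deg w (k * ?p) r"
      unfolding r_eq by (intro hom_deg_diff hom_deg_power wi) simp
    moreover have "D \<noteq> 0"
      unfolding D_def using ne[OF of_nat_U] by (simp add: g_def)
    ultimately have "hom_deg w 0 X"
      using hom_deg_quotient[OF wD, of 0 X] X by (simp add: mult.commute)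
    moreover have "w j' > 0" for j' using k by (simp add: w_def)
    ultimately obtain a where a: "X = mconst a"
      using hom_deg_0_constD[of w X] by blast
    have "r \<noteq> 0"
      unfolding r_eq by (rule translation_norm_nonzero[OF U U0 prime_gt_1_nat[OF p]])
    then have "a \<noteq> 0" using X a by auto
    obtain Y where "s = D * Y" using D_dvd[OF s] by (metis dvdE)
    then have "s = r * (mconst (inverse a) * Y)"
      using X a \<open>a \<noteq> 0\<close> by (simp add: mult_ac flip: mconst_mult)
    then show ?thesis by simp
  qed
  show ?thesis
    using assms(7)
  proof (induction "vdeg i q" arbitrary: q rule: less_induct)
    case (less q)
    define q0 where "q0 = msubst (mvar(i := 0)) q"
    have q0: "msubst (mvar(i := x)) q0 = q0" for x
      unfolding q0_def by (rule free_of_msubst_mvar[OF free_of_specialize])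
    define s where "s = q - q0"
    have s: "?\<theta> s = s" "msubst (mvar(i := 0)) s = 0"
      using less.prems by (simp_all add: s_def msubst_simps q0 q0_def[symmetric])
    obtain t where t: "s = r * t" using r_dvd[OF s] by (metis dvdE)
    show ?case
    proof (cases "s = 0")
      case True
      then have "q = msubst \<rho> q0" by (simp add: s_def \<rho> q0)
      then show ?thesis by blast
    next
      case False
      then have rt: "r \<noteq> 0" "t \<noteq> 0" using t by auto
      have "r * ?\<theta> t = r * t" using s(1) r\<theta> unfolding t by (simp add: msubst_simps)
      then have "?\<theta> t = t" using rt by simp
      moreover have "vdeg i s = vdeg i r + vdeg i t" using False vdeg_mult[of r t i] unfolding t by simp
      moreover have "vdeg i r > 0" by (rule vdeg_pos[OF r0 rt(1)])
      moreover have "vdeg i s \<le> vdeg i q"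
        unfolding s_def q0_def by (rule vdeg_diff_free[OF free_of_specialize])
      ultimately have "t \<in> range (msubst \<rho>)" using less.hyps[of t] by simp
      then obtain t' where t': "t = msubst \<rho> t'" by blast
      have "q = msubst \<rho> (q0 + mvar i * t')"
        using t by (simp add: s_def msubst_simps \<rho> q0 t' algebra_simps)
      then show ?thesis by blast
    qed
  qed
qed

section \<open>Transvections with a common hyperplane\<close>

text \<open>A group that fixes the hyperplane \<open>l = 0\<close> pointwise acts trivially on \<open>S\<close> modulo \<open>l\<close>.\<close>

locale hyperplane_fixing_action = linear_action \<A>
  for \<A> :: "(('n::{finite,linorder}, 'f::field) mpoly \<Rightarrow> ('n, 'f) mpoly) set" +
  fixes l
  assumes l: "hdeg 1 l" "l \<noteq> 0"
    and fixing: "A \<in> \<A> \<Longrightarrow> l dvd A (mvar i) - mvar i"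
begin

definition transvections where "transvections = {A \<in> \<A>. A l = l}"

lemma fixing_dvd: "A \<in> \<A> \<Longrightarrow> l dvd A p - p"
  by (rule act_dvd_diff) (auto intro: fixing)

lemma transvectionsD: "A \<in> transvections \<Longrightarrow> A \<in> \<A>" "A \<in> transvections \<Longrightarrow> A l = l"
  by (auto simp: transvections_def)

text \<open>This shape is preserved when one passes to the invariants of one more transvection. The invariants of the
transvections are only required to be contained in the algebra generated by \<open>y\<close>, because this algebra
shrinks to them step by step.\<close>

definition translated_generators :: "'n \<Rightarrow> ('n \<Rightarrow> nat) \<Rightarrow> ('n \<Rightarrow> ('n, 'f) mpoly) \<Rightarrow> bool" where
  "translated_generators i0 d y \<longleftrightarrow> alg_independent y \<and> (\<forall>i. hdeg (d i) (y i)) \<and> y i0 = l \<and>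
     invs transvections \<subseteq> range (msubst y) \<and>
     (\<forall>A\<in>transvections. \<forall>i. \<exists>c. A (y i) = y i + mconst c * l ^ d i)"

lemma translated_generators_exist: "\<exists>i0 y. translated_generators i0 (\<lambda>_. 1) y"
proof -
  obtain c where c: "l = (\<Sum>i\<in>UNIV. mconst (c i) * mvar i)"
    using hdeg_1D[OF l(1)] by blast
  obtain i0 where i0: "c i0 \<noteq> 0"
    using l(2) c by fastforce
  define m where "m = (\<Sum>i\<in>UNIV - {i0}. mconst (c i) * mvar i :: ('n, 'f) mpoly)"
  have lm: "l = mconst (c i0) * mvar i0 + m"
    unfolding c m_def by (simp add: sum.remove[of UNIV i0])
  have m: "msubst (mvar(i0 := x)) m = m" for x
    unfolding m_def msubst_simps by (rule sum.cong) auto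
  define \<sigma> where "\<sigma> = mvar(i0 := l)"
  define \<tau> where "\<tau> = mvar(i0 := mconst (inverse (c i0)) * (mvar i0 - m))"
  have *: "msubst \<sigma> (\<tau> i) = mvar i" "msubst \<tau> (\<sigma> i) = mvar i" for i
  proof -
    have "msubst \<sigma> (\<tau> i0) = mvar i0"
      using i0 by (simp add: \<sigma>_def \<tau>_def msubst_simps m) (simp add: lm flip: mconst_mult mult.assoc)
    then show "msubst \<sigma> (\<tau> i) = mvar i" by (cases "i = i0") (auto simp: \<sigma>_def \<tau>_def)
    have "msubst \<tau> (\<sigma> i0) = mvar i0"
      using i0 by (simp add: \<sigma>_def \<tau>_def lm msubst_simps m flip: mconst_mult mult.assoc)
    then show "msubst \<tau> (\<sigma> i) = mvar i" by (cases "i = i0") (auto simp: \<sigma>_def \<tau>_def)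
  qed
  have ind: "alg_independent (mvar :: 'n \<Rightarrow> ('n, 'f) mpoly)" by (simp add: alg_independent_def)
  have \<sigma>: "alg_independent \<sigma>" "range (msubst \<sigma>) = UNIV"
    using change_generators[OF ind *] by simp_all
  have hd: "hdeg 1 (\<sigma> i)" for i using l(1) by (simp add: \<sigma>_def)
  have "\<exists>c. A (\<sigma> i) = \<sigma> i + mconst c * l" if A: "A \<in> transvections" for A i
  proof -
    have "hdeg 1 (A (\<sigma> i) - \<sigma> i)" by (intro hom_deg_diff act_hdeg[OF transvectionsD(1)[OF A]] hd)
    then obtain c where "A (\<sigma> i) - \<sigma> i = mconst c * l"
      using linear_form_dvd[OF l(1)] fixing_dvd transvectionsD[OF A] by blast
    then show ?thesis by (auto simp: algebra_simps intro!: exI[of _ c])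
  qed
  then have "translated_generators i0 (\<lambda>_. 1) \<sigma>"
    using \<sigma> hd by (auto simp: translated_generators_def) (simp add: \<sigma>_def)
  then show ?thesis by blast
qed

text \<open>The powers of \<open>A\<close> translate \<open>y\<close> by the multiples of \<open>c l\<^sup>d\<close>, and only finitely many of them are distinct.\<close>

lemma CHAR_pos_of_translation:
  assumes "A \<in> transvections" "A y = y + mconst c * l ^ d" "c \<noteq> 0"
  shows "prime CHAR('f)"
proof -
  note A = transvectionsD[OF assms(1)]
  have mem: "A ^^ m \<in> \<A>" for m
    by (induction m) (simp_all only: funpow.simps A(1) comp_mem id_mem)
  have pow: "(A ^^ m) y = y + mconst (of_nat m * c) * l ^ d" for m
    by (induction m) (use A in \<open>auto simp: assms(2) act_simps mconst_add algebra_simps\<close>)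
  have "\<not> inj (\<lambda>m. A ^^ m)"
    using finite_subset[OF _ finite_action, of "range (\<lambda>m. A ^^ m)"] mem finite_imageD[of "\<lambda>m. A ^^ m" UNIV] by auto
  then obtain a b where ab: "A ^^ a = A ^^ b" "a < b"
    unfolding inj_def by (metis nat_neq_iff)
  then have "mconst (of_nat a * c) * l ^ d = mconst (of_nat b * c) * l ^ d"
    using trans[OF pow[of a, symmetric, unfolded ab(1)] pow[of b]] by (simp only: add_left_cancel)
  then have "(of_nat a :: 'f) = of_nat b" using l(2) assms(3) by simp
  then have "CHAR('f) dvd b - a" using of_nat_eq_iff_char_dvd[of a b, where 'a = 'f] ab(2) by simp
  then have "CHAR('f) > 0" using ab(2) by (auto intro: Nat.gr0I)
  then show ?thesis by (rule prime_CHAR_semidom)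
qed

text \<open>Among the generators moved by \<open>A\<close> let \<open>y\<^sub>i\<close> have the least degree. Multiples of \<open>y\<^sub>i\<close> by powers of \<open>l\<close>
are subtracted from the other generators to make these invariant under \<open>A\<close>, and then \<open>y\<^sub>i\<close> is replaced by its norm.
By \<open>translation_invariants\<close> the new algebra still contains all invariants of the transvections.\<close>

lemma translated_generators_step:
  assumes tg: "translated_generators i0 d y" and A: "A \<in> transvections" "\<exists>i. A (y i) \<noteq> y i"
  shows "\<exists>d' y'. translated_generators i0 d' y' \<and> (\<forall>i. A (y' i) = y' i) \<and>
    (\<forall>B\<in>transvections. (\<forall>i. B (y i) = y i) \<longrightarrow> (\<forall>i. B (y' i) = y' i))"
proof -
  have ind: "alg_independent y" and hd: "\<And>i. hdeg (d i) (y i)" and yi0: "y i0 = l"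
    and inv: "invs transvections \<subseteq> range (msubst y)"
    and tr: "\<And>B i. B \<in> transvections \<Longrightarrow> \<exists>c. B (y i) = y i + mconst c * l ^ d i"
    using tg unfolding translated_generators_def by blast+
  define c where "c = (\<lambda>B i. SOME c. B (y i) = y i + mconst c * l ^ d i)"
  have c: "B (y i) = y i + mconst (c B i) * l ^ d i" if "B \<in> transvections" for B i
    unfolding c_def by (rule someI_ex[OF tr[OF that]])
  have d: "d i > 0" for i
  proof (rule ccontr)
    assume "\<not> d i > 0"
    then have "hdeg 0 (y i)" using hd[of i] by simp
    then show False using hdeg_0D alg_independent_nonconstant[OF ind] by blast
  qed
  have ci0: "c B i0 = 0" if "B \<in> transvections" for B
    using c[OF that, of i0] transvectionsD[OF that] l(2) by (simp add: yi0)
  have "\<exists>i. c A i \<noteq> 0" using A c by fastforce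
  then obtain i where i: "c A i \<noteq> 0" "\<And>j. c A j \<noteq> 0 \<Longrightarrow> d i \<le> d j"
    using ex_has_least_nat[of "\<lambda>i. c A i \<noteq> 0" _ d] by blast
  have i_i0: "i \<noteq> i0" using i(1) ci0[OF A(1)] by auto
  have p: "prime CHAR('f)" using CHAR_pos_of_translation[OF A(1) c[OF A(1)] i(1)] .
  let ?p = "CHAR('f)"
  have p0: "?p > 0" using p prime_gt_0_nat by blast
  \<comment> \<open>Make all generators other than \<open>y\<^sub>i\<close> invariant under \<open>A\<close>.\<close>
  \<comment> \<open>If \<open>\<kappa> j \<noteq> 0\<close>, then \<open>d i \<le> d j\<close> by the choice of \<open>i\<close>, so the truncated subtraction \<open>d j - d i\<close> is exact.\<close>
  define \<kappa> where "\<kappa> = (\<lambda>j. if j = i then 0 else c A j / c A i)"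
  have \<kappa>i0: "\<kappa> i0 = 0" using ci0[OF A(1)] by (simp add: \<kappa>_def)
  have \<kappa>d: "\<kappa> j \<noteq> 0 \<Longrightarrow> d i \<le> d j" for j using i(2)[of j] by (auto simp: \<kappa>_def split: if_splits)
  define \<sigma> :: "'n \<Rightarrow> ('n, 'f) mpoly" where "\<sigma> = (\<lambda>j. mvar j - mconst (\<kappa> j) * mvar i0 ^ (d j - d i) * mvar i)"
  define \<tau> :: "'n \<Rightarrow> ('n, 'f) mpoly" where "\<tau> = (\<lambda>j. mvar j + mconst (\<kappa> j) * mvar i0 ^ (d j - d i) * mvar i)"
  have \<sigma>\<tau>: "msubst \<sigma> (\<tau> j) = mvar j" "msubst \<tau> (\<sigma> j) = mvar j" for j
  proof -
    have s: "\<sigma> i0 = mvar i0" "\<tau> i0 = mvar i0" "\<sigma> i = mvar i" "\<tau> i = mvar i"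
      using \<kappa>i0 by (simp_all add: \<sigma>_def \<tau>_def \<kappa>_def)
    have "msubst \<sigma> (\<tau> j) = \<sigma> j + mconst (\<kappa> j) * mvar i0 ^ (d j - d i) * mvar i"
      unfolding \<tau>_def by (simp add: msubst_simps s)
    then show "msubst \<sigma> (\<tau> j) = mvar j" by (simp add: \<sigma>_def)
    have "msubst \<tau> (\<sigma> j) = \<tau> j - mconst (\<kappa> j) * mvar i0 ^ (d j - d i) * mvar i"
      unfolding \<sigma>_def by (simp add: msubst_simps s)
    then show "msubst \<tau> (\<sigma> j) = mvar j" by (simp add: \<tau>_def)
  qed
  define y1 where "y1 = (\<lambda>j. msubst y (\<sigma> j))"
  have y1: "alg_independent y1" "range (msubst y1) = range (msubst y)"
    unfolding y1_def by (rule change_generators[OF ind \<sigma>\<tau>])+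
  have y1_eq: "y1 j = y j - mconst (\<kappa> j) * l ^ (d j - d i) * y i" for j
    by (simp add: y1_def \<sigma>_def msubst_simps yi0)
  have y1i: "y1 i = y i" and y1i0: "y1 i0 = l" by (simp_all add: y1_eq \<kappa>_def \<kappa>i0[unfolded \<kappa>_def] yi0 ci0[OF A(1)])
  have B1: "B (y1 j) = y1 j + mconst (c B j - \<kappa> j * c B i) * l ^ d j" if B: "B \<in> transvections" for B j
  proof (cases "\<kappa> j = 0")
    case False
    have "l ^ (d j - d i) * l ^ d i = l ^ d j" using \<kappa>d[OF False] by (simp flip: power_add)
    note lpow = this
    have "B (y1 j) = y j + mconst (c B j) * l ^ d j - mconst (\<kappa> j) * l ^ (d j - d i) * (y i + mconst (c B i) * l ^ d i)"
      using transvectionsD[OF B] by (simp add: y1_eq act_simps c[OF B])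
    also have "\<dots> = y1 j + mconst (c B j) * l ^ d j - mconst (\<kappa> j) * mconst (c B i) * (l ^ (d j - d i) * l ^ d i)"
      by (simp add: y1_eq algebra_simps)
    finally show ?thesis unfolding lpow by (simp add: mconst_diff mconst_mult algebra_simps)
  qed (use transvectionsD[OF B] c[OF B] in \<open>simp add: y1_eq\<close>)
  have A1: "A (y1 j) = y1 j" if "j \<noteq> i" for j
    using B1[OF A(1), of j] i(1) that by (simp add: \<kappa>_def)
  have hd1: "hdeg (d j) (y1 j)" for j
  proof (cases "\<kappa> j = 0")
    case False
    have "hdeg (1 * (d j - d i) + d i) (l ^ (d j - d i) * y i)"
      by (intro hom_deg_mult hom_deg_power l hd)
    then have "hdeg (d j) (l ^ (d j - d i) * y i)" using \<kappa>d[OF False] by simp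
    then show ?thesis
      unfolding y1_eq mult.assoc by (intro hom_deg_diff hd hom_deg_scale)
  qed (use hd in \<open>simp add: y1_eq\<close>)
  \<comment> \<open>Replace \<open>y\<^sub>i\<close> by its norm under \<open>A\<close>, an additive polynomial in \<open>y\<^sub>i\<close>.\<close>
  define U :: "('n, 'f) mpoly" where "U = mconst (c A i) * mvar i0 ^ d i"
  define r where "r = mvar i ^ ?p - U ^ (?p - 1) * mvar i"
  define u where "u = c A i ^ (?p - 1)"
  have lU: "msubst y1 U = mconst (c A i) * l ^ d i" by (simp add: U_def msubst_simps y1i0)
  define y2 where "y2 = y1(i := y i ^ ?p - mconst u * l ^ (d i * (?p - 1)) * y i)"
  define d2 where "d2 = d(i := d i * ?p)"
  have y2_eq: "y2 j = msubst y1 ((mvar(i := r)) j)" for j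
    by (simp add: y2_def r_def msubst_simps lU y1i u_def power_mult_distrib mconst_power flip: power_mult)
  have y2_msubst: "msubst y2 q = msubst y1 (msubst (mvar(i := r)) q)" for q
    unfolding msubst_msubst y2_eq[symmetric] ..
  have r: "r \<noteq> 0" "msubst (mvar(i := 0)) r = 0"
  proof -
    have "msubst (mvar(i := 0)) U = U" "U \<noteq> 0"
      using i_i0 i(1) by (simp_all add: U_def msubst_simps)
    then show "r \<noteq> 0"
      unfolding r_def using prime_gt_1_nat[OF p] by (rule translation_norm_nonzero)
    show "msubst (mvar(i := 0)) r = 0" using p0 by (simp add: r_def msubst_simps power_0_left)
  qed
  have ind2: "alg_independent y2"
    unfolding alg_independent_def y2_msubst
  proof safe
    fix q assume "msubst y1 (msubst (mvar(i := r)) q) = 0"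
    then have "msubst (mvar(i := r)) q = 0" using y1(1) unfolding alg_independent_def by blast
    then show "q = 0" by (rule msubst_replace_inj[OF r])
  qed
  have fd: "(a + b) ^ ?p = a ^ ?p + b ^ ?p" for a b :: "('n, 'f) mpoly"
    by (rule freshmans_dream) (simp_all add: CHAR_mpoly p)
  have l_pow: "l ^ (d i * (?p - 1)) * l ^ d i = l ^ (d i * ?p)"
    using p0 by (cases ?p) (simp_all add: mult.commute flip: power_add)
  have B2i: "B (y2 i) = y2 i + mconst (c B i ^ ?p - u * c B i) * l ^ (d i * ?p)" if B: "B \<in> transvections" for B
  proof -
    have "B (y2 i) = (y i + mconst (c B i) * l ^ d i) ^ ?p - mconst u * l ^ (d i * (?p - 1)) * (y i + mconst (c B i) * l ^ d i)"
      using transvectionsD[OF B] by (simp add: y2_def act_simps c[OF B])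
    also have "\<dots> = y2 i + mconst (c B i ^ ?p) * l ^ (d i * ?p) - mconst u * mconst (c B i) * (l ^ (d i * (?p - 1)) * l ^ d i)"
      by (simp add: y2_def fd power_mult_distrib mconst_power algebra_simps flip: power_mult)
    finally show ?thesis unfolding l_pow by (simp add: mconst_diff mconst_mult algebra_simps)
  qed
  have y2j: "y2 j = y1 j" "d2 j = d j" if "j \<noteq> i" for j using that by (simp_all add: y2_def d2_def)
  have A2: "A (y2 j) = y2 j" for j
  proof (cases "j = i")
    case True
    have "c A i ^ ?p = u * c A i" using p0 by (simp add: u_def flip: power_Suc2)
    then show ?thesis using True B2i[OF A(1)] by simp
  qed (use A1 y2j in simp)
  have hd2: "hdeg (d2 j) (y2 j)" for j
  proof (cases "j = i")
    case True
    have "hdeg (1 * (d i * (?p - 1)) + d i) (l ^ (d i * (?p - 1)) * y i)"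
      by (intro hom_deg_mult hom_deg_power l hd)
    moreover have "1 * (d i * (?p - 1)) + d i = d i * ?p" using p0 by (cases ?p) auto
    ultimately have "hdeg (d i * ?p) (y i ^ ?p - mconst u * (l ^ (d i * (?p - 1)) * y i))"
      by (intro hom_deg_diff hom_deg_scale hom_deg_power hd) simp
    then show ?thesis using True by (simp add: y2_def d2_def mult.assoc)
  qed (use hd1 y2j in simp)
  have tr2: "\<exists>a. B (y2 j) = y2 j + mconst a * l ^ d2 j" if B: "B \<in> transvections" for B j
  proof (cases "j = i")
    case True
    then show ?thesis using B2i[OF B] by (auto simp: d2_def)
  qed (use B1[OF B] y2j in auto)
  have inv2: "invs transvections \<subseteq> range (msubst y2)"
  proof
    fix x assume x: "x \<in> invs transvections"
    then obtain q where q: "x = msubst y1 q" using inv y1(2) by blast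
    have Ay1: "A (y1 j) = msubst y1 ((mvar(i := mvar i + U)) j)" for j
      using A1[of j] c[OF A(1), of i] by (simp add: y1i msubst_simps lU)
    have "msubst y1 (msubst (mvar(i := mvar i + U)) q) = A x"
      using transvectionsD[OF A(1)] by (simp add: q act_of_msubst Ay1 msubst_msubst)
    also have "\<dots> = msubst y1 q" using x A(1) q by (simp add: invs_def)
    finally have "msubst (mvar(i := mvar i + U)) q = q" by (rule alg_independent_eq[OF y1(1)])
    then have "q \<in> range (msubst (mvar(i := r)))"
      unfolding r_def U_def by (intro translation_invariants p i d) (use i_i0 in auto)
    then obtain q' where "q = msubst (mvar(i := r)) q'" by blast
    then have "x = msubst y2 q'" by (simp only: q y2_msubst)
    then show "x \<in> range (msubst y2)" by blast
  qed
  have "translated_generators i0 d2 y2"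
    unfolding translated_generators_def using ind2 hd2 inv2 tr2 y2j(1)[OF i_i0[symmetric]] y1i0 by auto
  moreover have "B (y2 j) = y2 j" if B: "B \<in> transvections" "\<forall>i. B (y i) = y i" for B j
  proof -
    have "B (y1 j) = y1 j" for j using B transvectionsD[OF B(1)] by (simp add: y1_def act_of_msubst)
    then show ?thesis using transvectionsD[OF B(1)] unfolding y2_eq by (simp add: act_of_msubst)
  qed
  ultimately show ?thesis using A2 by blast
qed

text \<open>Each step makes a further transvection act trivially on the generators. Once all of them do, the
generators are themselves invariant.\<close>

lemma transvection_invariants:
  "\<exists>(i0::'n) d y. alg_independent y \<and> (\<forall>i. hdeg (d i) (y i)) \<and> y i0 = l \<and> invs transvections = range (msubst y)"
proof -
  define N where "N = (\<lambda>y. {A \<in> transvections. \<exists>i::'n. A (y i) \<noteq> y i})"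
  have finN: "finite (N y)" for y using finite_action by (simp add: N_def transvections_def)
  have "\<exists>d' y'. translated_generators i0 d' y' \<and> N y' = {}" if "translated_generators i0 d y" for i0 d y
    using that
  proof (induction "card (N y)" arbitrary: d y rule: less_induct)
    case less
    show ?case
    proof (cases "N y = {}")
      case False
      then obtain A where A: "A \<in> transvections" "\<exists>i. A (y i) \<noteq> y i" by (auto simp: N_def)
      obtain d' y' where y': "translated_generators i0 d' y'" "\<forall>i. A (y' i) = y' i"
        "\<forall>B\<in>transvections. (\<forall>i. B (y i) = y i) \<longrightarrow> (\<forall>i. B (y' i) = y' i)"
        using translated_generators_step[OF less.prems A] by blast
      have "N y' \<subset> N y" using A y'(2,3) by (auto simp: N_def)
      then have "card (N y') < card (N y)" by (rule psubset_card_mono[OF finN])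
      then show ?thesis using less.hyps y'(1) by blast
    qed (use less.prems in blast)
  qed
  then obtain i0 d y where y: "translated_generators i0 d y" "N y = {}"
    using translated_generators_exist by blast
  have "msubst y p \<in> invs transvections" for p
  proof -
    have "A (msubst y p) = msubst y p" if "A \<in> transvections" for A
    proof -
      have "(\<lambda>i. A (y i)) = y" using y(2) that by (auto simp: N_def)
      then show ?thesis using transvectionsD(1)[OF that] by (simp add: act_of_msubst)
    qed
    then show ?thesis by (simp add: invs_def)
  qed
  then have "invs transvections = range (msubst y)"
    using y(1) by (auto simp: translated_generators_def)
  then have *: "alg_independent y \<and> (\<forall>i. hdeg (d i) (y i)) \<and> y i0 = l \<and> invs transvections = range (msubst y)"
    using y(1) unfolding translated_generators_def by simp
  show ?thesis by (rule exI[of _ i0], rule exI[of _ d], rule exI[of _ y], rule *)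
qed

end

section \<open>Groups fixing a hyperplane pointwise\<close>

text \<open>Every \<open>a \<in> X\<close> satisfies \<open>a\<^sup>m = 1\<close> with \<open>m = card X\<close>. If \<open>m = p e\<close> for the characteristic \<open>p\<close>, then
\<open>(a\<^sup>e - 1)\<^sup>p = a\<^sup>m - 1 = 0\<close>, so the polynomial \<open>x\<^sup>e - 1\<close> has more than \<open>e\<close> roots.\<close>

lemma card_unit_group:
  fixes X :: "'f::field set"
  assumes fin: "finite X" "X \<noteq> {}" and X0: "0 \<notin> X" and mult: "\<And>a b. a \<in> X \<Longrightarrow> b \<in> X \<Longrightarrow> a * b \<in> X"
  shows "\<And>a. a \<in> X \<Longrightarrow> a ^ card X = 1" "of_nat (card X) \<noteq> (0 :: 'f)"
proof -
  have bij: "bij_betw ((*) a) X X" if a: "a \<in> X" for a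
  proof -
    have "inj_on ((*) a) X" using a X0 by (auto simp: inj_on_def)
    moreover have "(*) a ` X \<subseteq> X" using a mult by auto
    ultimately show ?thesis using fin(1) by (simp add: bij_betw_def endo_inj_surj)
  qed
  show pow: "a ^ card X = 1" if a: "a \<in> X" for a
  proof -
    have "(\<Prod>x\<in>X. a * x) = \<Prod>X" using prod.reindex_bij_betw[OF bij[OF a], of "\<lambda>x. x"] by simp
    then have "a ^ card X * \<Prod>X = \<Prod>X" by (simp add: prod.distrib)
    moreover have "\<Prod>X \<noteq> 0" using fin(1) X0 by auto
    ultimately show ?thesis by simp
  qed
  show "of_nat (card X) \<noteq> (0 :: 'f)"
  proof
    assume "of_nat (card X) = (0 :: 'f)"
    then obtain e where e: "card X = CHAR('f) * e" by (auto simp: of_nat_eq_0_iff_char_dvd elim: dvdE)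
    have "card X > 0" using fin by (simp add: card_gt_0_iff)
    then have pos: "CHAR('f) > 0" "e > 0" using e by (auto intro!: Nat.gr0I)
    then have p: "prime CHAR('f)" by (intro prime_CHAR_semidom)
    have "a ^ e = 1" if a: "a \<in> X" for a
    proof -
      have "((a ^ e - 1) + 1) ^ CHAR('f) = (a ^ e - 1) ^ CHAR('f) + 1 ^ CHAR('f)"
        by (rule freshmans_dream[OF p refl])
      moreover have "(a ^ e) ^ CHAR('f) = 1" using pow[OF a] e by (simp add: mult.commute flip: power_mult)
      ultimately have "(a ^ e - 1) ^ CHAR('f) = 0" by simp
      then show ?thesis by simp
    qed
    then have sub: "X \<subseteq> {x. poly (monom 1 e - 1) x = 0}" by (auto simp: poly_monom)
    have ne: "monom 1 e - 1 \<noteq> (0 :: 'f poly)"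
      using pos(2) by (metis degree_1 degree_monom_eq eq_iff_diff_eq_0 less_numeral_extra(3) zero_neq_one)
    have "card X \<le> card {x. poly (monom (1::'f) e - 1) x = 0}"
      by (rule card_mono[OF poly_roots_finite[OF ne] sub])
    also have "\<dots> \<le> degree (monom (1::'f) e - 1)" by (rule card_poly_roots_bound[OF ne])
    also have "\<dots> \<le> e" by (rule degree_diff_le) (simp_all add: degree_monom_le)
    finally have "card X \<le> e" .
    moreover have "CHAR('f) \<ge> 2" using prime_ge_2_nat[OF p] .
    ultimately show False using e pos(2) by (auto simp: not_le)
  qed
qed

text \<open>The components of \<open>p\<close> with weight other than \<open>e\<close> are mapped to \<open>0\<close>, hence vanish by independence.\<close>

lemma weighted_homogeneous_preimage:
  assumes y: "alg_independent y" "\<And>i. hdeg (d i) (y i)" and "hdeg e (msubst y p)"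
  shows "hom_deg d e p"
proof -
  have hom: "msubst y (coeff (grading_hom d p) k) = (if k = e then msubst y p else 0)" for k
  proof -
    have "grading_hom (\<lambda>_. 1) (msubst y p) = map_poly (msubst y) (grading_hom d p)"
      by (rule grading_hom_msubst) (rule y(2))
    then have "monom (msubst y p) e = map_poly (msubst y) (grading_hom d p)"
      using assms(3) by (simp add: hom_deg_def)
    then have "coeff (monom (msubst y p) e) k = coeff (map_poly (msubst y) (grading_hom d p)) k" by simp
    then show ?thesis by (simp add: coeff_map_poly msubst_simps split: if_splits)
  qed
  have "coeff (grading_hom d p) k = (if k = e then p else 0)" for k
    using hom[of k] alg_independent_eq[OF y(1), of "coeff (grading_hom d p) k" p]
      alg_independent_eq[OF y(1), of "coeff (grading_hom d p) k" 0] by (auto simp: msubst_simps)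
  then show ?thesis unfolding hom_deg_def by (intro poly_eqI) simp
qed

lemma free_of_low_weight:
  assumes "hom_deg d e p" "e < d i"
  shows "free_of i p"
  unfolding free_of_def hom_deg_iff_keys
proof
  fix m assume "m \<in> Poly_Mapping.keys p"
  then have s: "(\<Sum>j\<in>UNIV. d j * Poly_Mapping.lookup m j) = e" using assms(1) by (simp add: hom_deg_iff_keys)
  have "d i * Poly_Mapping.lookup m i \<le> (\<Sum>j\<in>UNIV. d j * Poly_Mapping.lookup m j)"
    by (rule member_le_sum) auto
  then have lt: "d i * Poly_Mapping.lookup m i < d i * 1" using s assms(2) by linarith
  then have "Poly_Mapping.lookup m i < 1" unfolding mult_less_cancel1 by blast
  then have "Poly_Mapping.lookup m i = 0" by simp
  then show "(\<Sum>j\<in>UNIV. (if j = i then 1 else 0) * Poly_Mapping.lookup m j) = 0"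
    by (intro sum.neutral) auto
qed

lemma lookup_msubst_scale:
  "Poly_Mapping.lookup (msubst (mvar(i := mconst a * mvar i)) p) m = a ^ Poly_Mapping.lookup m i * Poly_Mapping.lookup p m"
proof (induction p rule: poly_mapping_induct_single)
  case (1 n b)
  have "msubst (mvar(i := mconst a * mvar i)) (Poly_Mapping.single n b) =
    mconst b * (\<Prod>j\<in>UNIV. (if j = i then mconst a ^ Poly_Mapping.lookup n i else 1) * mvar j ^ Poly_Mapping.lookup n j)"
    unfolding monomial_eq_prod[of n b] msubst_simps msubst_mconst msubst_mvar
    by (intro arg_cong[of _ _ "(*) (mconst b)"] prod.cong) (simp_all add: power_mult_distrib)
  also have "\<dots> = mconst (a ^ Poly_Mapping.lookup n i) * Poly_Mapping.single n b"
    by (simp add: prod.distrib monomial_eq_prod[of n b] mconst_power mult_ac)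
  also have "\<dots> = Poly_Mapping.single n (a ^ Poly_Mapping.lookup n i * b)"
    by (simp add: mconst_def mult_single)
  finally have eq: "msubst (mvar(i := mconst a * mvar i)) (Poly_Mapping.single n b) = Poly_Mapping.single n (a ^ Poly_Mapping.lookup n i * b)" .
  show ?case unfolding eq by (simp add: lookup_single when_def)
qed (simp add: msubst_simps lookup_add algebra_simps)

lemma range_msubst_replace_power:
  fixes p :: "('n::finite, 'f::comm_ring_1) mpoly"
  assumes "\<And>m. m \<in> Poly_Mapping.keys p \<Longrightarrow> e dvd Poly_Mapping.lookup m i"
  shows "p \<in> range (msubst (mvar(i := mvar i ^ e)))"
proof -
  define \<rho> :: "'n \<Rightarrow> ('n, 'f) mpoly" where "\<rho> = mvar(i := mvar i ^ e)"
  have "\<exists>q. Poly_Mapping.single m a = msubst \<rho> q" if m: "m \<in> Poly_Mapping.keys p" for m a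
  proof -
    define q where "q = mconst a * (\<Prod>j\<in>UNIV. mvar j ^ (if j = i then Poly_Mapping.lookup m j div e else Poly_Mapping.lookup m j))"
    have "msubst \<rho> q = mconst a * (\<Prod>j\<in>UNIV. mvar j ^ Poly_Mapping.lookup m j)"
    proof -
      have "\<rho> j ^ (if j = i then Poly_Mapping.lookup m j div e else Poly_Mapping.lookup m j) = mvar j ^ Poly_Mapping.lookup m j" for j
        using assms[OF m] by (auto simp: \<rho>_def simp flip: power_mult)
      then show ?thesis by (simp add: q_def msubst_simps)
    qed
    then show ?thesis unfolding monomial_eq_prod by metis
  qed
  then have "\<forall>m\<in>Poly_Mapping.keys p. \<exists>q. Poly_Mapping.single m (Poly_Mapping.lookup p m) = msubst \<rho> q" by blast
  then obtain q where q: "\<And>m. m \<in> Poly_Mapping.keys p \<Longrightarrow> Poly_Mapping.single m (Poly_Mapping.lookup p m) = msubst \<rho> (q m)"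
    by metis
  have "p = (\<Sum>m\<in>Poly_Mapping.keys p. msubst \<rho> (q m))"
    by (subst poly_mapping_sum_single) (simp add: q)
  also have "\<dots> = msubst \<rho> (\<Sum>m\<in>Poly_Mapping.keys p. q m)" by (simp add: msubst_simps)
  finally show ?thesis unfolding \<rho>_def by blast
qed

context hyperplane_fixing_action
begin

text \<open>The character by which the group acts on \<open>l\<close>; its kernel consists of the transvections.\<close>

definition scaling where "scaling A = (SOME c. A l = mconst c * l)"

lemma act_l:
  assumes "A \<in> \<A>" shows "A l = mconst (scaling A) * l"
proof -
  have "l dvd (A l - l) + l" using fixing_dvd[OF assms] by (intro dvd_add) auto
  then have "\<exists>c. A l = mconst c * l"
    using linear_form_dvd[OF l(1) act_hdeg[OF assms l(1)]] by simp
  then show ?thesis unfolding scaling_def by (rule someI_ex)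
qed

lemma scaling_unique: "A \<in> \<A> \<Longrightarrow> A l = mconst c * l \<Longrightarrow> scaling A = c"
  using act_l[of A] l(2) by simp

lemma scaling_comp: "A \<in> \<A> \<Longrightarrow> B \<in> \<A> \<Longrightarrow> scaling (A \<circ> B) = scaling A * scaling B"
  by (rule scaling_unique) (simp_all add: comp_mem act_l act_simps mconst_mult mult_ac)

lemma scaling_nonzero: "A \<in> \<A> \<Longrightarrow> scaling A \<noteq> 0"
  using act_l[of A] act_0_iff[of A l] l(2) by auto

definition rep where "rep a = (SOME A. A \<in> \<A> \<and> scaling A = a)"

lemma rep: assumes "a \<in> scaling ` \<A>" shows "rep a \<in> \<A> \<and> scaling (rep a) = a"
proof -
  have "\<exists>A. A \<in> \<A> \<and> scaling A = a" using assms by blast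
  then show ?thesis unfolding rep_def by (rule someI_ex)
qed

lemma transvection_invariant_eq:
  assumes "x \<in> invs transvections" "A \<in> \<A>" "B \<in> \<A>" "scaling A = scaling B"
  shows "A x = B x"
proof -
  obtain C where C: "C \<in> \<A>" "B \<circ> C = id" "C \<circ> B = id" using inv_mem[OF assms(3)] by blast
  have "C (A l) = C (B l)" by (simp add: act_l[OF assms(2)] act_l[OF assms(3)] assms(4))
  then have "(C \<circ> A) l = l" using C(3) by (simp add: fun_eq_iff)
  then have "C \<circ> A \<in> transvections" using C(1) assms(2) comp_mem by (simp add: transvections_def)
  then have "C (A x) = x" using assms(1) by (auto simp: invs_def)
  then have "B (C (A x)) = B x" by simp
  then show ?thesis using C(2) by (simp add: fun_eq_iff)
qed

text \<open>The average is taken over the group of scalars \<open>scaling A\<close>, through which the group acts on the invariants of the transvections;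
by \<open>card_unit_group\<close> its order is invertible in \<open>\<F>\<close>, while that of the whole group need not be.\<close>

definition average where
  "average x = mconst (inverse (of_nat (card (scaling ` \<A>)))) * (\<Sum>a\<in>scaling ` \<A>. rep a x)"

lemma scaling_image:
  "finite (scaling ` \<A>)" "scaling ` \<A> \<noteq> {}" "0 \<notin> scaling ` \<A>" "\<And>a b. a \<in> scaling ` \<A> \<Longrightarrow> b \<in> scaling ` \<A> \<Longrightarrow> a * b \<in> scaling ` \<A>"
proof -
  show "a * b \<in> scaling ` \<A>" if ab: "a \<in> scaling ` \<A>" "b \<in> scaling ` \<A>" for a b
  proof -
    obtain A B where "A \<in> \<A>" "B \<in> \<A>" "a = scaling A" "b = scaling B" using ab by blast
    then have "a * b = scaling (A \<circ> B)" "A \<circ> B \<in> \<A>" using scaling_comp comp_mem by auto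
    then show ?thesis by blast
  qed
qed (use finite_action id_mem scaling_nonzero in \<open>auto simp: image_iff\<close>)

lemma average_invariant:
  assumes "x \<in> invs transvections" shows "average x \<in> invs \<A>"
  unfolding invs_def
proof safe
  fix A assume A: "A \<in> \<A>"
  have inj: "inj_on ((*) (scaling A)) (scaling ` \<A>)" using scaling_nonzero[OF A] by (auto simp: inj_on_def)
  moreover have "(*) (scaling A) ` scaling ` \<A> \<subseteq> scaling ` \<A>" using A scaling_image(4) by blast
  ultimately have bij: "bij_betw ((*) (scaling A)) (scaling ` \<A>) (scaling ` \<A>)"
    using scaling_image(1) by (simp add: bij_betw_def endo_inj_surj)
  have "A (rep a x) = rep (scaling A * a) x" if a: "a \<in> scaling ` \<A>" for a
  proof -
    have m: "scaling A * a \<in> scaling ` \<A>" using a A scaling_image(4) by blast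
    have "(A \<circ> rep a) x = rep (scaling A * a) x"
      using rep[OF a] rep[OF m] A
      by (intro transvection_invariant_eq[OF assms, of "A \<circ> rep a"]) (simp_all add: scaling_comp comp_mem)
    then show ?thesis by simp
  qed
  then have "(\<Sum>a\<in>scaling ` \<A>. A (rep a x)) = (\<Sum>a\<in>scaling ` \<A>. rep (scaling A * a) x)" by (rule sum.cong[OF refl])
  also have "\<dots> = (\<Sum>a\<in>scaling ` \<A>. rep a x)" by (rule sum.reindex_bij_betw[OF bij])
  finally show "A (average x) = average x"
    using A by (simp only: average_def act_simps[OF A] act_mconst[OF A])
qed

lemma average_dvd: "l dvd average x - x"
proof -
  let ?e = "of_nat (card (scaling ` \<A>)) :: 'f"
  have e: "?e \<noteq> 0" using card_unit_group(2)[OF scaling_image] .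
  have "l dvd (\<Sum>a\<in>scaling ` \<A>. rep a x - x)"
    using rep fixing_dvd by (intro dvd_sum) blast
  also have "(\<Sum>a\<in>scaling ` \<A>. rep a x - x) = (\<Sum>a\<in>scaling ` \<A>. rep a x) - mconst ?e * x"
    by (simp add: sum_subtractf mconst_of_nat)
  finally have "l dvd mconst (inverse ?e) * ((\<Sum>a\<in>scaling ` \<A>. rep a x) - mconst ?e * x)" by simp
  also have "\<dots> = average x - x"
    using e by (simp add: average_def right_diff_distrib flip: mult.assoc mconst_mult)
  finally show ?thesis .
qed

lemma hdeg_average:
  assumes "hdeg k x" shows "hdeg k (average x)"
proof -
  have "hdeg k (rep a x)" if "a \<in> scaling ` \<A>" for a
    using act_hdeg[OF conjunct1[OF rep[OF that]] assms] .
  then show ?thesis unfolding average_def by (intro hom_deg_scale hom_deg_sum)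
qed

text \<open>The difference between \<open>y\<^sub>i\<close> and its average is \<open>l w\<close> with \<open>w\<close> invariant under the transvections. As a
polynomial in the generators, \<open>w\<close> has smaller degree than \<open>y\<^sub>i\<close>, so it does not involve \<open>y\<^sub>i\<close>, and adding
\<open>l w\<close> to \<open>y\<^sub>i\<close> is an invertible change of generators.\<close>

lemma fixed_generator_step:
  fixes i i0 :: 'n
  assumes y: "alg_independent y" "\<And>i. hdeg (d i) (y i)" "y i0 = l" "invs transvections = range (msubst y)"
    and i: "i \<noteq> i0"
  shows "alg_independent (y(i := average (y i)))" "\<And>j. hdeg (d j) ((y(i := average (y i))) j)"
    "invs transvections = range (msubst (y(i := average (y i))))"
proof -
  have yi: "y i \<in> invs transvections" unfolding y(4) by (rule generator_in_range)
  show "hdeg (d j) ((y(i := average (y i))) j)" for j using y(2) hdeg_average by auto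
  have d: "d i > 0"
  proof (rule ccontr)
    assume "\<not> d i > 0"
    then have "hdeg 0 (y i)" using y(2)[of i] by simp
    then show False using hdeg_0D alg_independent_nonconstant[OF y(1)] by blast
  qed
  obtain w where w: "average (y i) - y i = l * w" using average_dvd[of "y i"] by (rule dvdE)
  have "w \<in> invs transvections"
    unfolding invs_def
  proof safe
    fix A assume A: "A \<in> transvections"
    note A' = transvectionsD[OF A]
    have "A (average (y i)) = average (y i)" using average_invariant[OF yi] A'(1) by (simp add: invs_def)
    moreover have "A (y i) = y i" using yi A by (simp add: invs_def)
    ultimately have "A (l * w) = l * w" unfolding w[symmetric] using A'(1) by (simp add: act_simps)
    then have "l * A w = l * w" using A' by (simp add: act_simps)
    then show "A w = w" using l(2) by simp
  qed
  then obtain W where W: "w = msubst y W" unfolding y(4) by blast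
  have "hdeg (1 + (d i - 1)) (l * w)"
    unfolding w[symmetric] using y(2)[of i] hdeg_average[OF y(2)[of i]] d by (simp add: hom_deg_diff)
  then have "hdeg (d i - 1) w" by (rule hom_deg_quotient[OF l])
  then have "hom_deg d (d i - 1) W"
    unfolding W by (rule weighted_homogeneous_preimage[OF y(1,2)])
  then have free: "free_of i W" by (rule free_of_low_weight) (use d in simp)
  define \<sigma> where "\<sigma> = mvar(i := mvar i + mvar i0 * W)"
  define \<tau> where "\<tau> = mvar(i := mvar i - mvar i0 * W)"
  have \<sigma>\<tau>: "msubst \<sigma> (\<tau> j) = mvar j" "msubst \<tau> (\<sigma> j) = mvar j" for j
    using i by (auto simp: \<sigma>_def \<tau>_def msubst_simps free_of_msubst_mvar[OF free])
  have eq: "y(i := average (y i)) = (\<lambda>j. msubst y (\<sigma> j))"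
    using w by (auto simp: \<sigma>_def fun_eq_iff msubst_simps W y(3) algebra_simps)
  show "alg_independent (y(i := average (y i)))" "invs transvections = range (msubst (y(i := average (y i))))"
    unfolding eq y(4) using change_generators[OF y(1) \<sigma>\<tau>] by simp_all
qed

lemma fixed_generators:
  "\<exists>(i0::'n) d y. alg_independent y \<and> (\<forall>i. hdeg (d i) (y i)) \<and> y i0 = l \<and> invs transvections = range (msubst y) \<and>
     (\<forall>i. i \<noteq> i0 \<longrightarrow> y i \<in> invs \<A>)"
proof -
  from transvection_invariants obtain i0 :: 'n and d y where *: "alg_independent y \<and> (\<forall>i. hdeg (d i) (y i)) \<and> y i0 = l \<and> invs transvections = range (msubst y)"
    by (elim exE)
  then have y: "alg_independent y" "\<And>i. hdeg (d i) (y i)" "y i0 = l" "invs transvections = range (msubst y)"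
    by simp_all
  have "\<exists>y' :: 'n \<Rightarrow> ('n, 'f) mpoly. alg_independent y' \<and> (\<forall>i. hdeg (d i) (y' i)) \<and> y' i0 = l \<and> invs transvections = range (msubst y') \<and>
     (\<forall>i\<in>I. y' i \<in> invs \<A>)" if "finite I" "i0 \<notin> I" for I
    using that
  proof (induction I)
    case empty
    then show ?case using y by blast
  next
    case (insert i I)
    then obtain y' :: "'n \<Rightarrow> ('n, 'f) mpoly" where y': "alg_independent y'" "\<And>i. hdeg (d i) (y' i)" "y' i0 = l" "invs transvections = range (msubst y')"
      "\<forall>i\<in>I. y' i \<in> invs \<A>" by auto
    have i: "i \<noteq> i0" using insert by auto
    have "y' i \<in> invs transvections" unfolding y'(4) by (rule generator_in_range)
    then have "average (y' i) \<in> invs \<A>" by (rule average_invariant)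
    moreover define z where "z = y'(i := average (y' i))"
    ultimately have "\<forall>j\<in>insert i I. z j \<in> invs \<A>" "z i0 = l" using y'(3,5) i by simp_all
    moreover have "alg_independent z" "\<And>j. hdeg (d j) (z j)" "invs transvections = range (msubst z)"
      unfolding z_def by (rule fixed_generator_step[OF y'(1-4) i])+
    ultimately show ?case by blast
  qed
  from this[of "UNIV - {i0}"] obtain y' :: "'n \<Rightarrow> ('n, 'f) mpoly" where "alg_independent y'"
    "\<forall>i. hdeg (d i) (y' i)" "y' i0 = l" "invs transvections = range (msubst y')" "\<forall>i\<in>UNIV - {i0}. y' i \<in> invs \<A>"
    by auto
  then have "alg_independent y' \<and> (\<forall>i. hdeg (d i) (y' i)) \<and> y' i0 = l \<and> invs transvections = range (msubst y') \<and>
     (\<forall>i. i \<noteq> i0 \<longrightarrow> y' i \<in> invs \<A>)" by simp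
  then show ?thesis by (rule exI[of _ i0, OF exI[of _ d, OF exI[of _ y']]])
qed

text \<open>In terms of generators of which all but \<open>l\<close> are invariant, the group rescales the single generator \<open>l\<close>. The
invariant polynomials are those in which \<open>l\<close> occurs only with exponents divisible by \<open>e\<close>, where \<open>e\<close> is
least with \<open>a\<^sup>e = 1\<close> for all scalars \<open>a\<close> that occur.\<close>

lemma polynomial_invariants:
  "\<exists>h :: 'n \<Rightarrow> ('n, 'f) mpoly. (\<forall>i. homogeneous (h i)) \<and> alg_independent h \<and> invs \<A> = range (msubst h)"
proof -
  from fixed_generators obtain i0 :: 'n and d y where *: "alg_independent y \<and> (\<forall>i. hdeg (d i) (y i)) \<and> y i0 = l \<and> invs transvections = range (msubst y) \<and>
     (\<forall>i. i \<noteq> i0 \<longrightarrow> y i \<in> invs \<A>)"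
    by (elim exE)
  then have y: "alg_independent y" "\<And>i. hdeg (d i) (y i)" "y i0 = l" "invs transvections = range (msubst y)"
    and fixed: "\<And>i. i \<noteq> i0 \<Longrightarrow> y i \<in> invs \<A>"
    by simp_all
  \<comment> \<open>With this \<open>e\<close>, the least invariant power of \<open>l\<close> is \<open>l\<^sup>e\<close>.\<close>
  define good where "good = (\<lambda>e. e > 0 \<and> (\<forall>a\<in>scaling ` \<A>. a ^ e = 1))"
  define e where "e = (LEAST e. good e)"
  have "good (card (scaling ` \<A>))"
    using card_unit_group(1)[OF scaling_image] scaling_image(1,2) by (auto simp: good_def card_gt_0_iff)
  then have e: "good e" unfolding e_def by (rule LeastI)
  have e_dvd: "e dvd k" if "\<forall>a\<in>scaling ` \<A>. a ^ k = 1" for k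
  proof -
    have "a ^ (k mod e) = 1" if a: "a \<in> scaling ` \<A>" for a
    proof -
      have "a ^ k = (a ^ e) ^ (k div e) * a ^ (k mod e)" by (simp flip: power_mult power_add)
      moreover have "a ^ k = 1" "a ^ e = 1" using a \<open>\<forall>a\<in>scaling ` \<A>. a ^ k = 1\<close> e unfolding good_def by blast+
      ultimately show ?thesis by simp
    qed
    moreover have "k mod e < e" using e by (simp add: good_def)
    ultimately have "k mod e = 0"
      using not_less_Least[of "k mod e" good] unfolding e_def[symmetric] by (auto simp: good_def)
    then show ?thesis by (simp add: mod_eq_0_iff_dvd)
  qed
  define h where "h = y(i0 := l ^ e)"
  define \<rho> :: "'n \<Rightarrow> ('n, 'f) mpoly" where "\<rho> = mvar(i0 := mvar i0 ^ e)"
  have h_eq: "h j = msubst y (\<rho> j)" for j by (simp add: h_def \<rho>_def msubst_simps y(3))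
  have h_msubst: "msubst h p = msubst y (msubst \<rho> p)" for p
    unfolding msubst_msubst h_eq[symmetric] ..
  have r: "(mvar i0 ^ e :: ('n, 'f) mpoly) \<noteq> 0" "msubst (mvar(i0 := 0)) (mvar i0 ^ e :: ('n, 'f) mpoly) = 0"
    using e by (simp_all add: msubst_simps good_def power_0_left)
  have "alg_independent h"
    unfolding alg_independent_def h_msubst
  proof safe
    fix q assume "msubst y (msubst \<rho> q) = 0"
    then have "msubst \<rho> q = 0" using y(1) unfolding alg_independent_def by blast
    then show "q = 0" unfolding \<rho>_def by (rule msubst_replace_inj[OF r])
  qed
  moreover have "homogeneous (h j)" for j
    using y(2)[of j] hom_deg_power[OF l(1), of e] by (auto simp: h_def homogeneous_iff simp del: One_nat_def)
  moreover have "invs \<A> = range (msubst h)"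
  proof safe
    fix x assume x: "x \<in> invs \<A>"
    then have "x \<in> invs transvections" by (auto simp: invs_def transvections_def)
    then obtain q where q: "x = msubst y q" unfolding y(4) by blast
    have "e dvd Poly_Mapping.lookup m i0" if m: "m \<in> Poly_Mapping.keys q" for m
    proof (rule e_dvd, safe)
      fix A assume A: "A \<in> \<A>"
      have Ay: "A (y j) = msubst y ((mvar(i0 := mconst (scaling A) * mvar i0)) j)" for j
        using fixed[of j] A act_l[OF A] by (auto simp: invs_def msubst_simps y(3))
      have "msubst y (msubst (mvar(i0 := mconst (scaling A) * mvar i0)) q) = A x"
        using A by (simp add: q act_of_msubst Ay msubst_msubst)
      also have "\<dots> = msubst y q" using x A q by (simp add: invs_def)
      finally have "msubst (mvar(i0 := mconst (scaling A) * mvar i0)) q = q" by (rule alg_independent_eq[OF y(1)])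
      then have "scaling A ^ Poly_Mapping.lookup m i0 * Poly_Mapping.lookup q m = Poly_Mapping.lookup q m"
        using lookup_msubst_scale[of i0 "scaling A" q m] by simp
      then show "scaling A ^ Poly_Mapping.lookup m i0 = 1" using m by (simp add: in_keys_iff)
    qed
    then have "q \<in> range (msubst \<rho>)" unfolding \<rho>_def by (rule range_msubst_replace_power)
    then obtain q' where "q = msubst \<rho> q'" by blast
    then have "x = msubst h q'" by (simp only: q h_msubst)
    then show "x \<in> range (msubst h)" by blast
  next
    fix p
    show "msubst h p \<in> invs \<A>"
      unfolding invs_def
    proof safe
      fix A assume A: "A \<in> \<A>"
      have "A (h j) = h j" for j
      proof (cases "j = i0")
        case True
        have "scaling A ^ e = 1" using e A by (simp add: good_def)
        then show ?thesis using True A act_l[OF A]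
          by (simp add: h_def act_simps power_mult_distrib flip: mconst_power)
      qed (use fixed[of j] A in \<open>auto simp: h_def invs_def\<close>)
      then show "A (msubst h p) = msubst h p" using A by (simp add: act_of_msubst)
    qed
  qed
  ultimately show ?thesis by blast
qed

end

lemma (in linear_action) polynomial_invariants_inertia:
  assumes "hdeg 1 l" "l \<noteq> 0"
  shows "\<exists>h :: 'n \<Rightarrow> ('n, 'f) mpoly. (\<forall>i. homogeneous (h i)) \<and> alg_independent h \<and> invs (inertia \<A> l) = range (msubst h)"
proof -
  interpret K: linear_action "inertia \<A> l" by (rule linear_action_inertia)
  interpret hyperplane_fixing_action "inertia \<A> l" l
    by unfold_locales (use assms in \<open>auto simp: inertia_def\<close>)
  show ?thesis by (rule polynomial_invariants)
qed

section \<open>Linear groups and their action on polynomials\<close>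

lemma form_poly_diff: "form_poly b (\<lambda>v. l v - m v) = form_poly b l - form_poly b m"
  and form_poly_scale: "form_poly b (\<lambda>v. c * l v) = mconst c * form_poly b l"
  by (simp_all add: form_poly_def mconst_add mconst_diff mconst_mult algebra_simps sum.distrib sum_subtractf sum_distrib_left)

lemma hdeg_form_poly: "hdeg 1 (form_poly b l)"
  unfolding form_poly_def by (rule hdeg_form)

lemma mpderiv_form_poly: "mpderiv j (form_poly b l) = mconst (l (b j))"
  unfolding form_poly_def mpderiv_sum
  by (simp add: mpderiv_mult mpderiv_mvar if_distrib[of "\<lambda>x. _ * x"] cong: if_cong)

text \<open>The action of \<open>G\<close> on \<open>S\<close> is a \<open>linear_action\<close>, and under this translation the pointwise stabilizers of
hyperplanes become inertia groups of linear forms.\<close>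

locale polynomial_action = finite_dimensional_vector_space smul "range b"
  for smul :: "'f::field \<Rightarrow> 'v::ab_group_add \<Rightarrow> 'v" and b :: "'n::{finite,linorder} \<Rightarrow> 'v" +
  fixes G :: "('v \<Rightarrow> 'v) set"
  assumes inj_b: "inj b" and subgroup_G: "subgroup G (GL smul)" and finite_G: "finite G"
begin

abbreviation linear_form :: "('v \<Rightarrow> 'f) \<Rightarrow> bool" where
  "linear_form \<equiv> Vector_Spaces.linear smul (*)"

abbreviation dual :: "'n \<Rightarrow> 'v \<Rightarrow> 'f" where "dual \<equiv> dual_basis smul b"
abbreviation act :: "('v \<Rightarrow> 'v) \<Rightarrow> ('n, 'f) mpoly \<Rightarrow> ('n, 'f) mpoly" where "act \<equiv> poly_act smul b"

lemma vector_space_field: "vector_space ((*) :: 'f \<Rightarrow> 'f \<Rightarrow> 'f)"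
  by unfold_locales (auto simp: algebra_simps)

lemma linear_form_iff: "linear_form l \<longleftrightarrow> (\<forall>v w. l (v + w) = l v + l w) \<and> (\<forall>c v. l (smul c v) = c * l v)"
  using vector_space_field vector_space_axioms by (auto simp: Vector_Spaces.linear_iff)

lemma linear_form_simps:
  assumes "linear_form l"
  shows "l (v + w) = l v + l w" "l (smul c v) = c * l v" "l 0 = 0" "l (v - w) = l v - l w" "l (sum g X) = (\<Sum>x\<in>X. l (g x))"
proof -
  show a: "l (v + w) = l v + l w" "l (smul c v) = c * l v" for v w c using assms by (auto simp: linear_form_iff)
  show z: "l 0 = 0" using a(2)[of 0 0] by simp
  show "l (v - w) = l v - l w" using a(1)[of "v - w" w] by simp
  show "l (sum g X) = (\<Sum>x\<in>X. l (g x))"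
    by (induction X rule: infinite_finite_induct) (auto simp: a z)
qed

lemma linear_form_dual: "linear_form (dual i)"
  unfolding dual_basis_def using independent_Basis span_Basis by (rule linear_representation)

lemma dual_basis_basis: "dual i (b j) = (if i = j then 1 else 0)"
  using representation_basis[OF independent_Basis, of "b j"] inj_b by (auto simp: dual_basis_def inj_eq)

lemma dual_basis_expansion: "v = (\<Sum>i\<in>UNIV. smul (dual i v) (b i))"
proof -
  have "(\<Sum>x\<in>range b. smul (representation (range b) v x) x) = v"
    using independent_Basis span_Basis by (intro sum_representation_eq) auto
  then show ?thesis using inj_b by (simp add: sum.reindex dual_basis_def)
qed

lemma linear_form_expansion:
  assumes "linear_form l" shows "l v = (\<Sum>i\<in>UNIV. dual i v * l (b i))"
  by (subst dual_basis_expansion[of v]) (simp add: linear_form_simps[OF assms])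

lemma linear_form_eqI: "linear_form l \<Longrightarrow> linear_form m \<Longrightarrow> (\<And>i. l (b i) = m (b i)) \<Longrightarrow> l v = m v"
  by (simp add: linear_form_expansion[of l v] linear_form_expansion[of m v])

lemma form_poly_dual: "form_poly b (dual i) = mvar i"
  by (simp add: form_poly_def dual_basis_basis if_distrib[of mconst] if_distrib[of "\<lambda>x. x * _"] cong: if_cong)

lemma form_poly_inj: "linear_form l \<Longrightarrow> linear_form m \<Longrightarrow> form_poly b l = form_poly b m \<Longrightarrow> l v = m v"
  by (rule linear_form_eqI) (auto simp: mpderiv_form_poly dest: arg_cong[of _ _ "mpderiv _"])

lemma form_poly_surj:
  assumes "hdeg 1 u" shows "\<exists>l. linear_form l \<and> u = form_poly b l"
proof -
  obtain c where c: "u = (\<Sum>i\<in>UNIV. mconst (c i) * mvar i)" using hdeg_1D[OF assms] by blast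
  define l where "l = (\<lambda>v. \<Sum>i\<in>UNIV. c i * dual i v)"
  have "linear_form l"
    unfolding linear_form_iff l_def
    by (simp add: linear_form_simps[OF linear_form_dual] algebra_simps sum.distrib sum_distrib_left)
  moreover have "l (b i) = c i" for i
    by (simp add: l_def dual_basis_basis if_distrib[of "\<lambda>x. _ * x"] cong: if_cong)
  ultimately show ?thesis by (auto simp: form_poly_def c)
qed

lemma G_linear: "g \<in> G \<Longrightarrow> Vector_Spaces.linear smul smul g" and G_bij: "g \<in> G \<Longrightarrow> bij g"
  using subgroup.subset[OF subgroup_G] by (auto simp: GL_def)

lemma G_id: "id \<in> G"
  using subgroup.one_closed[OF subgroup_G] by (simp add: GL_def)

lemma G_comp: "g \<in> G \<Longrightarrow> h \<in> G \<Longrightarrow> g \<circ> h \<in> G"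
  using subgroup.m_closed[OF subgroup_G] by (simp add: GL_def)

lemma G_inv: assumes "g \<in> G" shows "inv_into UNIV g \<in> G"
proof -
  interpret GL: group "GL smul" by (rule group_GL) (rule vector_space_axioms)
  have g: "g \<in> carrier (GL smul)" using subgroup.subset[OF subgroup_G] assms by blast
  have "g \<circ> m_inv (GL smul) g = id" using GL.r_inv[OF g] by (simp add: GL_def)
  then have "inv_into UNIV g = m_inv (GL smul) g"
    using G_bij[OF assms] by (metis bij_is_inj comp_assoc id_comp comp_id inv_o_cancel)
  then show ?thesis using subgroup.m_inv_closed[OF subgroup_G assms] by simp
qed

lemma linear_form_comp: "linear_form l \<Longrightarrow> g \<in> G \<Longrightarrow> linear_form (l \<circ> inv_into UNIV g)"
  using G_linear[OF G_inv, of g] by (intro Vector_Spaces.linear_compose)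

lemma act_form_poly:
  assumes "linear_form l" "g \<in> G"
  shows "act g (form_poly b l) = form_poly b (l \<circ> inv_into UNIV g)"
proof -
  have "act g (form_poly b l) = (\<Sum>i\<in>UNIV. mconst (l (b i)) * (\<Sum>j\<in>UNIV. mconst (dual i (inv_into UNIV g (b j))) * mvar j))"
    by (simp add: poly_act_def form_poly_def[of b l] msubst_simps) (simp add: form_poly_def)
  also have "\<dots> = (\<Sum>j\<in>UNIV. \<Sum>i\<in>UNIV. mconst (dual i (inv_into UNIV g (b j)) * l (b i)) * mvar j)"
    unfolding sum_distrib_left by (subst sum.swap) (simp add: mconst_mult mult_ac)
  also have "\<dots> = form_poly b (l \<circ> inv_into UNIV g)"
    by (simp add: form_poly_def linear_form_expansion[OF assms(1), of "inv_into UNIV g _"] mconst_sum sum_distrib_right)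
  finally show ?thesis .
qed

lemma act_mvar_eq: "g \<in> G \<Longrightarrow> act g (mvar i) = form_poly b (dual i \<circ> inv_into UNIV g)"
  using act_form_poly[OF linear_form_dual] by (simp add: form_poly_dual)

lemma act_comp: 
  assumes "g \<in> G" "h \<in> G" shows "act g (act h p) = act (g \<circ> h) p"
proof -
  have "act g (act h (mvar i)) = act (g \<circ> h) (mvar i)" for i
    using assms act_form_poly[OF linear_form_comp[OF linear_form_dual assms(2)] assms(1)]
    by (simp add: act_mvar_eq G_comp o_inv_distrib G_bij comp_assoc)
  then show ?thesis
    unfolding poly_act_def msubst_msubst msubst_mvar by simp
qed

lemma act_id: "act id = id"
  by (rule ext) (simp add: poly_act_def form_poly_dual)

lemma linear_action_act: "linear_action (act ` G)"
proof
  show "finite (act ` G)" using finite_G by simp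
  show "id \<in> act ` G" using G_id act_id by (metis imageI)
  show "A \<circ> B \<in> act ` G" if AB: "A \<in> act ` G" "B \<in> act ` G" for A B
  proof -
    obtain g h where gh: "g \<in> G" "h \<in> G" "A = act g" "B = act h" using AB by blast
    then have "A \<circ> B = act (g \<circ> h)" using act_comp by (simp add: fun_eq_iff)
    then show ?thesis using gh G_comp by blast
  qed
  show "\<exists>B\<in>act ` G. A \<circ> B = id \<and> B \<circ> A = id" if A: "A \<in> act ` G" for A
  proof -
    obtain g where g: "g \<in> G" "A = act g" using A by blast
    have gi: "g \<circ> inv_into UNIV g = id" "inv_into UNIV g \<circ> g = id"
      using G_bij[OF g(1)] by (simp_all add: bij_is_inj bij_is_surj surj_iff[symmetric])
    have "A \<circ> act (inv_into UNIV g) = id" "act (inv_into UNIV g) \<circ> A = id"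
      using act_comp[OF g(1) G_inv[OF g(1)]] act_comp[OF G_inv[OF g(1)] g(1)]
      by (auto simp: g(2) gi act_id)
    then show ?thesis using G_inv[OF g(1)] by blast
  qed
  show "A p = msubst (\<lambda>i. A (mvar i)) p" if "A \<in> act ` G" for A p
    using that by (auto simp: poly_act_def)
  show "hdeg 1 (A (mvar i))" if "A \<in> act ` G" for A i
    using that hdeg_form_poly by (auto simp: act_mvar_eq)
qed

lemma invariants_eq_invs: "X \<subseteq> G \<Longrightarrow> invariants smul b X = invs (act ` X)"
  by (auto simp: invariants_def invs_def)

lemma linear_form_multiple:
  assumes l: "linear_form l" and m: "linear_form m" and ker: "\<And>v. l v = 0 \<Longrightarrow> m v = 0"
  shows "\<exists>c. \<forall>v. m v = c * l v"
proof (cases "\<exists>v0. l v0 \<noteq> 0")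
  case True
  then obtain v0 where v0: "l v0 \<noteq> 0" by blast
  have "m v = m v0 / l v0 * l v" for v
  proof -
    have "m (v - smul (l v / l v0) v0) = 0"
      using v0 by (intro ker) (simp add: linear_form_simps[OF l])
    then show ?thesis by (simp add: linear_form_simps[OF m])
  qed
  then show ?thesis by blast
qed (use ker in auto)

lemma form_poly_dvd_iff:
  assumes "linear_form l" "linear_form m"
  shows "form_poly b l dvd form_poly b m \<longleftrightarrow> (\<forall>v. l v = 0 \<longrightarrow> m v = 0)"
proof
  assume "form_poly b l dvd form_poly b m"
  then obtain a where "form_poly b m = mconst a * form_poly b l"
    using linear_form_dvd hdeg_form_poly by blast
  then have eq: "form_poly b m = form_poly b (\<lambda>v. a * l v)" by (simp add: form_poly_scale)
  have "linear_form (\<lambda>v. a * l v)"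
    using assms(1) by (auto simp: linear_form_iff algebra_simps)
  then have "m v = a * l v" for v using form_poly_inj[OF assms(2) _ eq] by blast
  then show "\<forall>v. l v = 0 \<longrightarrow> m v = 0" by simp
next
  assume "\<forall>v. l v = 0 \<longrightarrow> m v = 0"
  then obtain c where "\<And>v. m v = c * l v" using linear_form_multiple[OF assms] by blast
  then have "m = (\<lambda>v. c * l v)" by auto
  then show "form_poly b l dvd form_poly b m" by (simp add: form_poly_scale)
qed

text \<open>The linear forms \<open>g z\<^sub>i - z\<^sub>i\<close> are the coordinates of \<open>g\<^sup>-\<^sup>1 v - v\<close> as functions of \<open>v\<close>. All are multiples of \<open>l\<close>
iff they vanish on \<open>H\<close>, that is, iff \<open>g\<close> fixes \<open>H\<close> pointwise.\<close>

lemma inertia_eq_pointwise_stabilizer: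
  assumes l: "linear_form l" and H: "H = {v. l v = 0}"
  shows "inertia (act ` G) (form_poly b l) = act ` pointwise_stabilizer G H"
proof -
  have "(\<forall>i. form_poly b l dvd act g (mvar i) - mvar i) \<longleftrightarrow> (\<forall>v\<in>H. g v = v)" if g: "g \<in> G" for g
  proof -
    have lin: "linear_form (\<lambda>v. dual i (inv_into UNIV g v) - dual i v)" for i
    proof -
      have *: "linear_form (\<lambda>v. dual i (inv_into UNIV g v))"
        using linear_form_comp[OF linear_form_dual g, of i] by (simp add: comp_def)
      show ?thesis
        unfolding linear_form_iff
        by (simp add: linear_form_simps[OF *] linear_form_simps[OF linear_form_dual] algebra_simps)
    qed
    have "act g (mvar i) - mvar i = form_poly b (\<lambda>v. dual i (inv_into UNIV g v) - dual i v)" for i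
      using act_mvar_eq[OF g, of i] by (simp add: form_poly_diff form_poly_dual comp_def)
    then have "(\<forall>i. form_poly b l dvd act g (mvar i) - mvar i) \<longleftrightarrow> (\<forall>v\<in>H. \<forall>i. dual i (inv_into UNIV g v) = dual i v)"
      using form_poly_dvd_iff[OF l lin] by (auto simp: H)
    also have "\<dots> \<longleftrightarrow> (\<forall>v\<in>H. inv_into UNIV g v = v)"
    proof -
      have "inv_into UNIV g v = v" if "\<forall>i. dual i (inv_into UNIV g v) = dual i v" for v
        using dual_basis_expansion[of "inv_into UNIV g v"] dual_basis_expansion[of v] that by simp
      then show ?thesis by auto
    qed
    also have "\<dots> \<longleftrightarrow> (\<forall>v\<in>H. g v = v)"
      using G_bij[OF g] by (metis bij_inv_eq_iff)
    finally show ?thesis .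
  qed
  then show ?thesis by (auto simp: inertia_def pointwise_stabilizer_def)
qed

lemma hyperplane_kernel:
  assumes l: "linear_form l" and "l v0 \<noteq> 0"
  shows "hyperplane smul {v. l v = 0}"
proof -
  let ?H = "{v. l v = 0}"
  have sub: "subspace ?H" by (auto simp: subspace_def linear_form_simps[OF l])
  have "v \<in> span (insert v0 ?H)" for v
  proof -
    have "v - smul (l v / l v0) v0 \<in> ?H" using assms(2) by (simp add: linear_form_simps[OF l])
    then have "(v - smul (l v / l v0) v0) + smul (l v / l v0) v0 \<in> span (insert v0 ?H)"
      by (intro span_add span_scale span_base) auto
    then show ?thesis by simp
  qed
  then have "dim UNIV = dim (insert v0 ?H)" by (metis UNIV_eq_I dim_span)
  also have "v0 \<notin> span ?H" using assms(2) unfolding span_eq_iff[THEN iffD2, OF sub] by simp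
  then have "dim (insert v0 ?H) = dim ?H + 1" by (simp add: dim_insert)
  finally show ?thesis using sub by (simp add: hyperplane_def)
qed

lemma sum_exponents:
  assumes "f = (SOME f. basic_invariants smul b X f)"
  shows "\<Sum>\<^sub># (exponents smul b X) = (\<Sum>i\<in>UNIV. total_degree (f i) - 1)"
  by (simp add: exponents_def assms sum_unfold_sum_mset)

theorem jacobian_det_basic_invariants:
  assumes f: "basic_invariants smul b G f"
    and l: "\<And>H. H \<in> reflecting_hyperplanes smul G \<Longrightarrow> defining_form smul H (l H)"
  shows "\<exists>c::'f. c \<noteq> 0 \<and>
    jacobian_det f = mconst c *
      (\<Prod>H\<in>reflecting_hyperplanes smul G.
         form_poly b (l H) ^ (\<Sum>\<^sub># (exponents smul b (pointwise_stabilizer G H))))"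
proof -
  interpret linear_action "act ` G" by (rule linear_action_act)
  define I where "I = reflecting_hyperplanes smul G"
  define L where "L = (\<lambda>H. form_poly b (l H))"
  define h where "h = (\<lambda>H. SOME h. basic_invariants smul b (pointwise_stabilizer G H) h)"
  have lin: "linear_form (l H)" and ker: "H = {v. l H v = 0}" if "H \<in> I" for H
    using l[of H] that by (auto simp: I_def defining_form_def)
  have inertia: "inertia (act ` G) (L H) = act ` pointwise_stabilizer G H" if "H \<in> I" for H
    unfolding L_def by (rule inertia_eq_pointwise_stabilizer[OF lin[OF that] ker[OF that]])
  have L_deg: "hdeg 1 (L H)" for H unfolding L_def by (rule hdeg_form_poly)
  have L_nz: "L H \<noteq> 0" if H: "H \<in> I" for H
  proof
    assume "L H = 0"
    moreover have "form_poly b (\<lambda>_. 0 :: 'f) = 0" by (simp add: form_poly_def)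
    moreover have "linear_form (\<lambda>_. 0)" by (simp add: linear_form_iff)
    ultimately have "l H v = 0" for v using form_poly_inj[OF lin[OF H]] by (simp add: L_def)
    then have "H = UNIV" using ker[OF H] by auto
    then show False using H by (simp add: I_def reflecting_hyperplanes_def hyperplane_def)
  qed
  have L_inj: "H = H'" if H: "H \<in> I" "H' \<in> I" "L H dvd L H'" for H H'
  proof -
    obtain a where a: "a \<noteq> 0" "L H' = mconst a * L H"
      using linear_forms_associated[OF L_deg L_deg H(3) L_nz[OF H(2)]] by blast
    have "mconst (inverse a) * L H' = L H" using a by (simp flip: mult.assoc mconst_mult)
    then have "L H' dvd L H" by (metis dvd_triv_right)
    then show ?thesis
      using H form_poly_dvd_iff[OF lin[OF H(1)] lin[OF H(2)]] form_poly_dvd_iff[OF lin[OF H(2)] lin[OF H(1)]]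
        ker[OF H(1)] ker[OF H(2)] unfolding L_def by blast
  qed
  have L_all: "\<exists>H\<in>I. L H dvd u" if u: "hdeg 1 u" "u \<noteq> 0" "inertia (act ` G) u \<noteq> {id}" for u
  proof -
    obtain m where m: "linear_form m" "u = form_poly b m" using form_poly_surj[OF u(1)] by blast
    define H where "H = {v. m v = 0}"
    have "\<exists>v0. m v0 \<noteq> 0"
    proof (rule ccontr)
      assume "\<not> (\<exists>v0. m v0 \<noteq> 0)"
      then show False using u(2) m(2) by (simp add: form_poly_def)
    qed
    then have "hyperplane smul H" unfolding H_def using hyperplane_kernel[OF m(1)] by blast
    moreover have "pointwise_stabilizer G H \<noteq> {id}"
    proof
      assume "pointwise_stabilizer G H = {id}"
      then have "inertia (act ` G) u = {id}"
        unfolding m(2) inertia_eq_pointwise_stabilizer[OF m(1) H_def] by (simp add: act_id)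
      then show False using u(3) by simp
    qed
    ultimately have H: "H \<in> I" by (simp add: I_def reflecting_hyperplanes_def)
    have "L H dvd u"
      unfolding L_def m(2) form_poly_dvd_iff[OF lin[OF H] m(1)] using ker[OF H] by (auto simp: H_def)
    then show ?thesis using H by blast
  qed
  have h: "basic_invariants smul b (pointwise_stabilizer G H) (h H)" if H: "H \<in> I" for H
  proof -
    have "\<exists>h. basic_invariants smul b (pointwise_stabilizer G H) h"
      using polynomial_invariants_inertia[OF L_deg L_nz[OF H]]
      unfolding inertia[OF H] basic_invariants_def
      by (simp add: invariants_eq_invs pointwise_stabilizer_def)
    then show ?thesis unfolding h_def by (rule someI_ex)
  qed
  have "\<exists>c. c \<noteq> 0 \<and> jacobian_det f = mconst c * (\<Prod>H\<in>I. L H ^ (\<Sum>i\<in>UNIV. total_degree (h H i) - 1))"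
  proof (rule jacobian_factorization[OF _ _ L_deg L_nz L_inj L_all])
    show "invs (act ` G) = range (msubst f)"
      using f by (simp add: basic_invariants_def invariants_eq_invs)
    show "finite I"
      unfolding I_def using finite_dimensional_vector_space_axioms subgroup_G finite_G
      by (rule finite_reflecting_hyperplanes)
    show "invs (inertia (act ` G) (L H)) = range (msubst (h H))" if "H \<in> I" for H
      using h[OF that] unfolding inertia[OF that]
      by (simp add: basic_invariants_def invariants_eq_invs pointwise_stabilizer_def)
    show "homogeneous (h H i)" "alg_independent (h H)" if "H \<in> I" for H i
      using h[OF that] by (simp_all add: basic_invariants_def)
  qed
  then show ?thesis
    unfolding I_def L_def h_def by (simp add: sum_exponents)
qed

end

theorem theorem8:
  fixes smul :: "'f::field \<Rightarrow> 'v::ab_group_add \<Rightarrow> 'v"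
    and b :: "'n::{finite,linorder} \<Rightarrow> 'v"
    and G :: "('v \<Rightarrow> 'v) set"
    and f :: "'n \<Rightarrow> ('n, 'f) mpoly"
    and l :: "'v set \<Rightarrow> 'v \<Rightarrow> 'f"
  assumes "finite_dimensional_vector_space smul (range b)" and "inj b"
    and "subgroup G (GL smul)" and "finite G"
    and "basic_invariants smul b G f"
    and "\<And>H. H \<in> reflecting_hyperplanes smul G \<Longrightarrow> defining_form smul H (l H)"
  shows "\<exists>c::'f. c \<noteq> 0 \<and>
    jacobian_det f = mconst c *
      (\<Prod>H\<in>reflecting_hyperplanes smul G.
         form_poly b (l H) ^ (\<Sum>\<^sub># (exponents smul b (pointwise_stabilizer G H))))"
proof -
  interpret polynomial_action smul b G
    using assms(1-4) by (intro polynomial_action.intro polynomial_action_axioms.intro)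
  show ?thesis by (rule jacobian_det_basic_invariants[OF assms(5,6)])
qed

end
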